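(* Let $T>0$ and $n\in\mathbb{N}$. Let $a\in\tilde\Lambda_n$ and let $u$ be any nontrivial solution of the antiperiodic problem $u''(x)+a(x)u(x)=0$, $x\in(0,T)$, $u(0)+u(T)=u'(0)+u'(T)=0$, such that $u(0)=u(T)=0$. Denote the zeros of $u$ in $[0,T]$ by $0=x_0<x_2<\dots<x_{2m}=T$ and the zeros of $u'$ in $(0,T)$ by $x_1<x_3<\dots<x_{2m-1}$ (the zeros of $u$ and of $u'$ alternate, so that $x_0<x_1<x_2<\dots<x_{2m}$). Then: (1) $x_{i+1}-x_i\le\frac{T}{2(2n-1)}$ for all $i$ with $0\le i\le 2m-1$, and at least one of these inequalities is strict. (2) $m$ is an odd number and $m\ge 2n+1$. Any odd value $m\ge 2n+1$ is possible (that is, it occurs for some $a\in\tilde\Lambda_n$ and some such $u$). (3) For $0\le i\le 2m-1$, $$\|a-\tilde\lambda_{2n-1}\|_{L^1(x_i,x_{i+1})}\ \ge\ \frac{(2n-1)\pi}{T}\cot\Big(\frac{(2n-1)\pi}{T}(x_{i+1}-x_i)\Big).$$ Moreover: (4) $$\tilde\beta_{1,n}:=\inf_{a\in\tilde\Lambda_n}\|a-\tilde\lambda_{2n-1}\|_{L^1(0,T)}=\frac{2\pi(2n-1)(2n+1)}{T}\cot\frac{(2n-1)\pi}{2(2n+1)},$$ and the infimum $\tilde\beta_{1,n}$ is not attained. (5) If $a\in L_T(\mathbb{R},\mathbb{R})$ satisfies $\tilde\lambda_{2n-1}\prec a$ and $\|a\|_{L^1(0,T)}\le\tilde\gamma_{1,n}:=T\tilde\lambda_{2n-1}+\tilde\beta_{1,n}$,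 then $$\tilde\lambda_{2n}(a)<0<\tilde\lambda_{2n+1}(a).$$
   Context: $\mathbb{N}=\{1,2,\dots\}$. $L_T(\mathbb{R},\mathbb{R})$ is the set of $T$-periodic functions $a:\mathbb{R}\to\mathbb{R}$ with $a|_{[0,T]}\in L^1(0,T)$. For $c,d\in L^1(0,T)$, $c\prec d$ means $c(x)\le d(x)$ for a.e. $x\in[0,T]$ and $c(x)<d(x)$ on a set of positive measure (constants are regarded as constant functions). Solutions are $C^1$ functions with absolutely continuous derivative satisfying the equation a.e. For $a\in L_T(\mathbb{R},\mathbb{R})$, the eigenvalues $\tilde\lambda$ of $u''(x)+(\tilde\lambda+a(x))u(x)=0$, $x\in(0,T)$, $u(0)+u(T)=u'(0)+u'(T)=0$, counted with multiplicity, form a sequence $\tilde\lambda_1(a)\le\tilde\lambda_2(a)<\dots<\tilde\lambda_{2n-1}(a)\le\tilde\lambda_{2n}(a)<\dots$. Write $\tilde\lambda_i=\tilde\lambda_i(0)$; thus $\tilde\lambda_{2n-1}=\tilde\lambda_{2n}=(2n-1)^2\pi^2/T^2$ for $n\in\mathbb{N}$. $\tilde\Lambda_n$ is the set of all $a\in L_T(\mathbb{R},\mathbb{R})$ such that $\tilde\lambda_{2n-1}\prec a$ and the problem $u''(x)+a(x)u(x)=0$, $x\in(0,T)$, $u(0)+u(T)=u'(0)+u'(T)=0$, has nontrivial solutions. *)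

theory Defs
  imports "HOL-Analysis.Analysis" "HOL-Library.Function_Algebras"
begin

definition L_per :: "real \<Rightarrow> (real \<Rightarrow> real) set" where
  "L_per T = {a. (\<forall>x. a (x + T) = a x) \<and> a absolutely_integrable_on {0..T}}"

definition L1_norm :: "real \<Rightarrow> real \<Rightarrow> (real \<Rightarrow> real) \<Rightarrow> real" where
  "L1_norm p q f = (LINT x:{p..q}|lebesgue. \<bar>f x\<bar>)"

definition prec_L1 :: "real \<Rightarrow> (real \<Rightarrow> real) \<Rightarrow> (real \<Rightarrow> real) \<Rightarrow> bool" where
  "prec_L1 T c d \<longleftrightarrow>
     (AE x in lebesgue. x \<in> {0..T} \<longrightarrow> c x \<le> d x) \<and>
     emeasure lebesgue {x \<in> {0..T}. c x < d x} > 0"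

text \<open>Absolute continuity of a function on \<open>{p..q}\<close>; the constant
  \<^const>\<open>absolutely_continuous\<close> of the library is about measures. The members of a division
  are nonempty compact intervals with pairwise disjoint interiors, and \<open>t\<close> is their union.\<close>
definition abs_cont_on :: "(real \<Rightarrow> real) \<Rightarrow> real \<Rightarrow> real \<Rightarrow> bool" where
  "abs_cont_on f p q \<longleftrightarrow>
     (\<forall>e>0. \<exists>d>0. \<forall>D t. D division_of t \<and> t \<subseteq> {p..q} \<and> (\<Sum>I\<in>D. Sup I - Inf I) < d \<longrightarrow>
        (\<Sum>I\<in>D. \<bar>f (Sup I) - f (Inf I)\<bar>) < e)"

text \<open>\<open>u\<close>, with derivative \<open>v = u'\<close> on \<open>{0..T}\<close> (one-sided at the end points), is a solution of
  \<open>u'' + q u = 0\<close>, \<open>u(0) + u(T) = u'(0) + u'(T) = 0\<close>. Values outside \<open>{0..T}\<close> are irrelevant.\<close>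
definition antiper_solution ::
    "real \<Rightarrow> (real \<Rightarrow> real) \<Rightarrow> (real \<Rightarrow> real) \<Rightarrow> (real \<Rightarrow> real) \<Rightarrow> bool" where
  "antiper_solution T q u v \<longleftrightarrow>
     (\<forall>x\<in>{0..T}. (u has_real_derivative v x) (at x within {0..T})) \<and>
     abs_cont_on v 0 T \<and>
     (AE x in lebesgue. x \<in> {0<..<T} \<longrightarrow>
        (\<exists>w. (v has_real_derivative w) (at x) \<and> w + q x * u x = 0)) \<and>
     u 0 + u T = 0 \<and> v 0 + v T = 0"

definition nontrivial :: "real \<Rightarrow> (real \<Rightarrow> real) \<Rightarrow> bool" where
  "nontrivial T u \<longleftrightarrow> (\<exists>x\<in>{0..T}. u x \<noteq> 0)"

text \<open>Functions on \<open>{0..T}\<close> are represented by total functions vanishing outside \<open>{0..T}\<close>, so that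
  the dimension below is that of the eigenspace (and \<open>0\<close> if \<open>\<mu>\<close> is not an eigenvalue).\<close>
definition antiper_eigenspace :: "real \<Rightarrow> (real \<Rightarrow> real) \<Rightarrow> real \<Rightarrow> (real \<Rightarrow> real) set" where
  "antiper_eigenspace T a \<mu> =
     {u. (\<forall>x. x \<notin> {0..T} \<longrightarrow> u x = 0) \<and> (\<exists>v. antiper_solution T (\<lambda>x. \<mu> + a x) u v)}"

lemma vector_space_real_fun: "vector_space (\<lambda>(c::real) (f::real \<Rightarrow> real) x. c * f x)"
  by unfold_locales (auto simp: fun_eq_iff algebra_simps)

definition antiper_mult :: "real \<Rightarrow> (real \<Rightarrow> real) \<Rightarrow> real \<Rightarrow> nat" where
  "antiper_mult T a \<mu> =
     vector_space.dim (\<lambda>(c::real) (f::real \<Rightarrow> real) x. c * f x) (antiper_eigenspace T a \<mu>)"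

text \<open>The \<open>k\<close>-th eigenvalue, \<open>k \<ge> 1\<close>, in increasing order and counted with multiplicity: the least
  \<open>\<mu>\<close> such that at least \<open>k\<close> eigenvalues, with multiplicity, are \<open>\<le> \<mu>\<close>.\<close>
definition antiper_eigenvalue :: "real \<Rightarrow> (real \<Rightarrow> real) \<Rightarrow> nat \<Rightarrow> real" where
  "antiper_eigenvalue T a k =
     (LEAST \<mu>. k \<le> (\<Sum>\<nu> | \<nu> \<le> \<mu> \<and> antiper_mult T a \<nu> > 0. antiper_mult T a \<nu>))"

text \<open>Any nondecreasing sequence, indexed from \<open>1\<close>, that lists every eigenvalue as often as its
  multiplicity coincides with \<open>antiper_eigenvalue\<close>.\<close>
lemma antiper_eigenvalue_eqI:
  fixes l :: "nat \<Rightarrow> real"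
  assumes mono: "\<And>i j. 1 \<le> i \<Longrightarrow> i \<le> j \<Longrightarrow> l i \<le> l j"
    and fin: "\<And>\<mu>. finite {i. 1 \<le> i \<and> l i = \<mu>}"
    and card: "\<And>\<mu>. card {i. 1 \<le> i \<and> l i = \<mu>} = antiper_mult T a \<mu>"
    and k: "1 \<le> k"
  shows "antiper_eigenvalue T a k = l k"
proof -
  have ev: "antiper_mult T a \<nu> > 0 \<longleftrightarrow> (\<exists>i\<ge>1. l i = \<nu>)" for \<nu>
  proof -
    have "antiper_mult T a \<nu> > 0 \<longleftrightarrow> {i. 1 \<le> i \<and> l i = \<nu>} \<noteq> {}"
      using card_gt_0_iff[of "{i. 1 \<le> i \<and> l i = \<nu>}"] fin[of \<nu>] card[of \<nu>] by metis
    then show ?thesis by blast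
  qed
  have finle: "finite {i. 1 \<le> i \<and> l i \<le> \<mu>}" if "\<mu> \<le> l k" for \<mu>
  proof -
    have "\<exists>j\<ge>k. l j \<noteq> l k"
    proof (rule ccontr)
      assume "\<not> ?thesis"
      then have "l j = l k" if "j \<ge> k" for j using that by blast
      then have "{k..} \<subseteq> {i. 1 \<le> i \<and> l i = l k}" using k order_trans by blast
      with fin[of "l k"] show False using infinite_Ici finite_subset by blast
    qed
    then obtain j where j: "j \<ge> k" "l j > l k" using mono[OF k] by (metis order_le_less)
    have "{i. 1 \<le> i \<and> l i \<le> \<mu>} \<subseteq> {..j}"
    proof
      fix i assume i: "i \<in> {i. 1 \<le> i \<and> l i \<le> \<mu>}"
      show "i \<in> {..j}"
      proof (rule ccontr)
        assume "i \<notin> {..j}"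
        then have "l j \<le> l i" using mono[of j i] j k by auto
        with i j that show False by auto
      qed
    qed
    then show ?thesis using finite_subset by blast
  qed
  have cnt: "(\<Sum>\<nu> | \<nu> \<le> \<mu> \<and> antiper_mult T a \<nu> > 0. antiper_mult T a \<nu>)
      = card {i. 1 \<le> i \<and> l i \<le> \<mu>}" if "\<mu> \<le> l k" for \<mu>
  proof -
    have A: "{\<nu>. \<nu> \<le> \<mu> \<and> antiper_mult T a \<nu> > 0} = l ` {i. 1 \<le> i \<and> l i \<le> \<mu>}"
      by (auto simp: ev)
    have B: "{i. 1 \<le> i \<and> l i \<le> \<mu>}
        = (\<Union>\<nu>\<in>{\<nu>. \<nu> \<le> \<mu> \<and> antiper_mult T a \<nu> > 0}. {i. 1 \<le> i \<and> l i = \<nu>})"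
      by (auto simp: ev)
    have F: "finite {\<nu>. \<nu> \<le> \<mu> \<and> antiper_mult T a \<nu> > 0}"
      unfolding A using finle[OF that] by simp
    show ?thesis
      unfolding B using F fin card by (subst card_UN_disjoint) (auto simp del: One_nat_def)
  qed
  show ?thesis
    unfolding antiper_eigenvalue_def
  proof (rule Least_equality)
    have "{1..k} \<subseteq> {i. 1 \<le> i \<and> l i \<le> l k}" using mono by auto
    then have "card {1..k} \<le> card {i. 1 \<le> i \<and> l i \<le> l k}"
      by (intro card_mono finle) auto
    then show "k \<le> (\<Sum>\<nu> | \<nu> \<le> l k \<and> antiper_mult T a \<nu> > 0. antiper_mult T a \<nu>)"
      by (simp add: cnt)
  next
    fix \<mu> assume *: "k \<le> (\<Sum>\<nu> | \<nu> \<le> \<mu> \<and> antiper_mult T a \<nu> > 0. antiper_mult T a \<nu>)"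
    show "l k \<le> \<mu>"
    proof (rule ccontr)
      assume "\<not> l k \<le> \<mu>"
      then have lt: "\<mu> < l k" by simp
      have "{i. 1 \<le> i \<and> l i \<le> \<mu>} \<subseteq> {1..<k}"
        using mono[OF k] lt by (force simp: not_le[symmetric])
      then have "card {i. 1 \<le> i \<and> l i \<le> \<mu>} \<le> card {1..<k}" by (intro card_mono) auto
      with * cnt[of \<mu>] lt k show False by simp
    qed
  qed
qed

definition Lam :: "real \<Rightarrow> nat \<Rightarrow> (real \<Rightarrow> real) set" where
  "Lam T n =
     {a \<in> L_per T. prec_L1 T (\<lambda>_. antiper_eigenvalue T (\<lambda>_. 0) (2 * n - 1)) a \<and>
                   (\<exists>u v. antiper_solution T a u v \<and> nontrivial T u)}"

text \<open>\<open>x 0, \<dots>, x (2 * m)\<close> are the interlacing zeros of \<open>u\<close> in \<open>{0..T}\<close> (even indices) and of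
  \<open>v = u'\<close> in \<open>{0<..<T}\<close> (odd indices); \<open>x i\<close> is irrelevant for \<open>i > 2 * m\<close>.\<close>
definition zero_enum ::
    "real \<Rightarrow> (real \<Rightarrow> real) \<Rightarrow> (real \<Rightarrow> real) \<Rightarrow> nat \<Rightarrow> (nat \<Rightarrow> real) \<Rightarrow> bool" where
  "zero_enum T u v m x \<longleftrightarrow>
     x 0 = 0 \<and> x (2 * m) = T \<and> (\<forall>i<2 * m. x i < x (i + 1)) \<and>
     {t \<in> {0..T}. u t = 0} = (\<lambda>j. x (2 * j)) ` {..m} \<and>
     {t \<in> {0<..<T}. v t = 0} = (\<lambda>j. x (2 * j + 1)) ` {..<m}"

definition beta1 :: "real \<Rightarrow> nat \<Rightarrow> real" where
  "beta1 T n =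
     (INF a\<in>Lam T n. L1_norm 0 T (\<lambda>t. a t - antiper_eigenvalue T (\<lambda>_. 0) (2 * n - 1)))"

definition gamma1 :: "real \<Rightarrow> nat \<Rightarrow> real" where
  "gamma1 T n = T * antiper_eigenvalue T (\<lambda>_. 0) (2 * n - 1) + beta1 T n"

end

theory Submission
  imports Defs
begin

text \<open>
  Everything is read off from the Pruefer angle. Writing a solution of \<open>u'' + q u = 0\<close> as \<open>u = r sin \<theta>\<close>,
  \<open>u' = r cos \<theta>\<close> gives \<open>\<theta>' = cos\<^sup>2 \<theta> + q sin\<^sup>2 \<theta>\<close>. The difference of two such angles solves a linear first
  order equation; hence \<open>\<theta>\<close> depends continuously and monotonically on \<open>q\<close> and on its initial value
  (\<open>prufer_comparison\<close>, \<open>prufer_dependence\<close>).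

  Call \<open>\<theta>(T) - \<theta>(0)\<close> the turn, a \<open>\<pi>\<close>-periodic function of \<open>\<theta>(0)\<close>. A solution is antiperiodic iff its
  turn is an odd multiple of \<open>\<pi>\<close> and \<open>r(T) = r(0)\<close>. Because the monodromy matrix has determinant \<open>1\<close>, a turn
  that is an odd multiple of \<open>\<pi>\<close> belongs to an antiperiodic solution exactly if it is the maximal or the minimal
  turn (\<open>growth_at_extremum\<close>, \<open>eigendirection_extremal\<close>). So the multiplicity of \<open>\<mu>\<close> counts how many of the two
  extremal turns of \<open>\<mu> + a\<close> are odd multiples of \<open>\<pi>\<close> (\<open>antiper_mult_eq\<close>), and the eigenvalues with numbers
  \<open>2k - 1\<close> and \<open>2k\<close> are the values of \<open>\<mu>\<close> at which the maximal and the minimal turn equal \<open>(2k - 1) \<pi>\<close>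
  (\<open>antiper_eigenvalue_extremal\<close>).

  Let \<open>w = (2n - 1) \<pi> / T\<close> and let \<open>a\<close> lie above \<open>w\<^sup>2\<close>. Then the angle is strictly increasing, so the zeros of \<open>u\<close> and
  \<open>u'\<close> are the points where it passes the multiples of \<open>\<pi>/2\<close>, and antiperiodicity says that the total turn is
  \<open>m \<pi>\<close> with \<open>m\<close> odd. On each quarter wave the Wronskian with a sine of frequency \<open>w\<close> shows that its length \<open>l\<close>
  is at most \<open>\<pi> / (2w)\<close> and that the integral of \<open>a - w\<^sup>2\<close> is at least \<open>w cot (w l)\<close> (\<open>quarter_wave\<close>). Summing
  up with the tangent line of the cotangent yields the lower bound for the norm, always strictly
  (\<open>excess_lower_bound\<close>). It is approached by coefficients whose excess is concentrated near the extrema of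
  the solution (\<open>concentrated_coefficient\<close>).

  For the last assertion, follow the segment from \<open>w\<^sup>2\<close> to \<open>a\<close>. The minimal turn exceeds its initial value
  \<open>(2n - 1) \<pi>\<close>. If the maximal turn reached \<open>(2n + 1) \<pi>\<close>, a point of the segment would belong to the set over
  which the infimum is taken and would have a norm not above the infimum, which is not attained
  (\<open>small_norm_extremal_turns\<close>).\<close>

section \<open>Absolutely continuous functions as indefinite integrals\<close>

text \<open>The derivative \<open>f\<close> is kept as a function of its own because the equation prescribes it only almost
  everywhere. Below, \<open>primitive_on p q F f\<close> turns out to be the same as: \<open>F\<close> is absolutely continuous
  and has the integrable derivative \<open>f\<close> almost everywhere. Each description is used where it is
  convenient: integrals for estimates, absolute continuity for products and compositions.\<close>
definition primitive_on :: "real \<Rightarrow> real \<Rightarrow> (real \<Rightarrow> real) \<Rightarrow> (real \<Rightarrow> real) \<Rightarrow> bool" where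
  "primitive_on p q F f \<longleftrightarrow>
     f absolutely_integrable_on {p..q} \<and> (\<forall>x\<in>{p..q}. F x = F p + integral {p..x} f)"

lemma AE_lebesgue_iff_negligible:
  fixes P :: "real \<Rightarrow> bool"
  shows "(AE x in lebesgue. P x) \<longleftrightarrow> (\<exists>N. negligible N \<and> (\<forall>x. x \<notin> N \<longrightarrow> P x))"
  unfolding eventually_ae_filter_negligible by blast

text \<open>Truncate \<open>\<bar>f\<bar>\<close> at a height \<open>k\<close>: the part above \<open>k\<close> has small integral by dominated convergence, and
  the part below \<open>k\<close> contributes at most \<open>k\<close> times the measure of the set.\<close>
lemma abs_integrable_small_on_small_sets:
  fixes f :: "real \<Rightarrow> real"
  assumes f: "f absolutely_integrable_on {p..q}" and e: "e > 0"
  obtains d where "d > 0"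
    "\<And>S. S \<in> lmeasurable \<Longrightarrow> S \<subseteq> {p..q} \<Longrightarrow> measure lebesgue S < d \<Longrightarrow> integral S (\<lambda>x. \<bar>f x\<bar>) < e"
proof -
  let ?g = "\<lambda>k x. min \<bar>f x\<bar> (real k)"
  have fa: "(\<lambda>x. \<bar>f x\<bar>) absolutely_integrable_on {p..q}"
    using absolutely_integrable_abs[OF f] by simp
  have g: "?g k absolutely_integrable_on {p..q}" for k
    by (rule absolutely_integrable_min_1[OF fa]) (auto intro: absolutely_integrable_continuous_real continuous_intros)
  have "(\<lambda>k. integral {p..q} (?g k)) \<longlonglongrightarrow> integral {p..q} (\<lambda>x. \<bar>f x\<bar>)"
  proof (rule dominated_convergence)
    show "?g k integrable_on {p..q}" for k
      using g by (simp add: set_lebesgue_integral_eq_integral(1))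
    show "(\<lambda>x. \<bar>f x\<bar>) integrable_on {p..q}"
      using fa by (simp add: set_lebesgue_integral_eq_integral(1))
    show "norm (?g k x) \<le> \<bar>f x\<bar>" for k x by auto
    fix x assume "x \<in> {p..q}"
    obtain K :: nat where "\<bar>f x\<bar> \<le> real K" using real_arch_simple by blast
    then have "\<forall>\<^sub>F k in sequentially. ?g k x = \<bar>f x\<bar>"
      by (intro eventually_sequentiallyI[of K]) (auto simp: min_def)
    then show "(\<lambda>k. ?g k x) \<longlonglongrightarrow> \<bar>f x\<bar>" by (rule tendsto_eventually)
  qed
  then obtain k where k: "\<bar>integral {p..q} (?g k) - integral {p..q} (\<lambda>x. \<bar>f x\<bar>)\<bar> < e/2"
    using e by (metis LIMSEQ_iff half_gt_zero order_refl real_norm_def)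
  show thesis
  proof
    show "e / (2 * (real k + 1)) > 0" using e by auto
    fix S assume S: "S \<in> lmeasurable" "S \<subseteq> {p..q}" "measure lebesgue S < e / (2 * (real k + 1))"
    have Sl: "S \<in> sets lebesgue" using S(1) by (rule fmeasurableD)
    have fS: "(\<lambda>x. \<bar>f x\<bar>) absolutely_integrable_on S" "?g k absolutely_integrable_on S"
      using set_integrable_subset[OF fa _ S(2)] set_integrable_subset[OF g _ S(2)] Sl by auto
    have d: "(\<lambda>x. \<bar>f x\<bar> - ?g k x) absolutely_integrable_on {p..q}"
       "(\<lambda>x. \<bar>f x\<bar> - ?g k x) absolutely_integrable_on S"
      using fa g fS by (auto intro: set_integral_diff)
    have "integral S (\<lambda>x. \<bar>f x\<bar>) = integral S (\<lambda>x. \<bar>f x\<bar> - ?g k x) + integral S (?g k)"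
      using fS by (subst integral_diff) (auto simp: set_lebesgue_integral_eq_integral(1))
    also have "integral S (\<lambda>x. \<bar>f x\<bar> - ?g k x) \<le> integral {p..q} (\<lambda>x. \<bar>f x\<bar> - ?g k x)"
      using S(2) d by (intro integral_subset_le) (auto simp: set_lebesgue_integral_eq_integral(1))
    also have "\<dots> = integral {p..q} (\<lambda>x. \<bar>f x\<bar>) - integral {p..q} (?g k)"
      using fa g by (subst integral_diff) (auto simp: set_lebesgue_integral_eq_integral(1))
    also have "integral S (?g k) \<le> integral S (\<lambda>x. real k)"
      using fS S(1) by (intro integral_le) (auto simp: set_lebesgue_integral_eq_integral(1) integrable_on_const)
    also have "integral S (\<lambda>x. real k) = real k * measure lebesgue S"
      using S(1) by (simp add: lmeasure_integral flip: integral_mult_right)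
    also have "\<dots> \<le> real k * (e / (2 * (real k + 1)))" using S(3) by (intro mult_left_mono) auto
    also have "\<dots> \<le> e/2" using e by (simp add: field_simps)
    finally show "integral S (\<lambda>x. \<bar>f x\<bar>) < e" using k by linarith
  qed
qed

lemma division_of_real_interval:
  fixes t :: "real set"
  assumes "D division_of t" "I \<in> D"
  shows "I = {Inf I..Sup I} \<and> Inf I \<le> Sup I"
proof -
  obtain a b where ab: "I = {a..b}" using division_ofD(4)[OF assms] by (auto simp: cbox_interval)
  with division_ofD(3)[OF assms] have "a \<le> b" by auto
  then show ?thesis using ab by auto
qed

lemma division_of_real_measure:
  fixes t :: "real set"
  assumes D: "D division_of t"
  shows "t \<in> lmeasurable" "measure lebesgue t = (\<Sum>I\<in>D. Sup I - Inf I)"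
proof -
  show "t \<in> lmeasurable" using D by (rule lmeasurable_division)
  have "measure lebesgue I = Sup I - Inf I" if "I \<in> D" for I
  proof -
    obtain a b where "I = {a..b}" "a \<le> b" using division_of_real_interval[OF D \<open>I \<in> D\<close>] by metis
    then show ?thesis by simp
  qed
  then show "measure lebesgue t = (\<Sum>I\<in>D. Sup I - Inf I)"
    unfolding content_division[OF D, symmetric] by (rule sum.cong[OF refl])
qed

lemma primitive_on_integral:
  assumes "primitive_on p q F f" "p \<le> x" "x \<le> y" "y \<le> q"
  shows "F y - F x = integral {x..y} f" "f absolutely_integrable_on {x..y}"
proof -
  have f: "f absolutely_integrable_on {p..q}" using assms by (simp add: primitive_on_def)
  then show "f absolutely_integrable_on {x..y}"
    using assms by (auto intro: absolutely_integrable_on_subinterval)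
  have fi: "f integrable_on {p..q}" using f by (simp add: set_lebesgue_integral_eq_integral(1))
  have sp: "integral {p..y} f = integral {p..x} f + integral {x..y} f"
    using assms fi by (intro Henstock_Kurzweil_Integration.integral_combine[symmetric] integrable_on_subinterval[OF fi]) auto
  have *: "F z = F p + integral {p..z} f" if "z \<in> {p..q}" for z
    using assms(1) that unfolding primitive_on_def by blast
  show "F y - F x = integral {x..y} f"
    using *[of x] *[of y] assms(2-4) sp by simp
qed

lemma indefinite_integral_abs_cont:
  assumes "primitive_on p q F f"
  shows "abs_cont_on F p q"
  unfolding abs_cont_on_def
proof (intro allI impI)
  fix e :: real assume e: "e > 0"
  have f: "f absolutely_integrable_on {p..q}" using assms by (simp add: primitive_on_def)
  obtain d where d: "d > 0" and
    small: "\<And>S. S \<in> lmeasurable \<Longrightarrow> S \<subseteq> {p..q} \<Longrightarrow> measure lebesgue S < d \<Longrightarrow> integral S (\<lambda>x. \<bar>f x\<bar>) < e"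
    using abs_integrable_small_on_small_sets[OF f e] by blast
  show "\<exists>d>0. \<forall>D t. D division_of t \<and> t \<subseteq> {p..q} \<and> (\<Sum>I\<in>D. Sup I - Inf I) < d \<longrightarrow>
        (\<Sum>I\<in>D. \<bar>F (Sup I) - F (Inf I)\<bar>) < e"
  proof (intro exI[of _ d] conjI d allI impI)
    fix D t assume A: "D division_of t \<and> t \<subseteq> {p..q} \<and> (\<Sum>I\<in>D. Sup I - Inf I) < d"
    then have D: "D division_of t" and t: "t \<subseteq> {p..q}" by auto
    have fa: "(\<lambda>x. \<bar>f x\<bar>) absolutely_integrable_on {p..q}"
      using absolutely_integrable_abs[OF f] by simp
    have tm: "t \<in> lmeasurable" and "measure lebesgue t = (\<Sum>I\<in>D. Sup I - Inf I)"
      using division_of_real_measure[OF D] by auto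
    then have "integral t (\<lambda>x. \<bar>f x\<bar>) < e" using A small by auto
    moreover have "\<bar>F (Sup I) - F (Inf I)\<bar> \<le> integral I (\<lambda>x. \<bar>f x\<bar>)" if ID: "I \<in> D" for I
    proof -
      obtain a b where ab: "I = {a..b}" "a \<le> b" using division_of_real_interval[OF D ID] by metis
      moreover have "I \<subseteq> {p..q}" using division_ofD(2)[OF D ID] t by blast
      ultimately have ab: "I = {a..b}" "a \<le> b" "p \<le> a" "b \<le> q" by auto
      have "F b - F a = integral {a..b} f"
        using primitive_on_integral(1)[OF assms] ab by auto
      also have "\<bar>\<dots>\<bar> \<le> integral {a..b} (\<lambda>x. \<bar>f x\<bar>)"
        using ab absolutely_integrable_on_subinterval[OF f, of a b]
           absolutely_integrable_on_subinterval[OF fa, of a b]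
        by (intro integral_norm_bound_integral[of f _ "\<lambda>x. \<bar>f x\<bar>", unfolded real_norm_def])
           (auto simp: set_lebesgue_integral_eq_integral(1))
      finally show ?thesis using ab by simp
    qed
    then have "(\<Sum>I\<in>D. \<bar>F (Sup I) - F (Inf I)\<bar>) \<le> (\<Sum>I\<in>D. integral I (\<lambda>x. \<bar>f x\<bar>))"
      by (rule sum_mono)
    moreover have "(\<Sum>I\<in>D. integral I (\<lambda>x. \<bar>f x\<bar>)) = integral t (\<lambda>x. \<bar>f x\<bar>)"
      by (rule integral_combine_division_topdown[symmetric, OF _ D])
        (use set_integrable_subset[OF fa _ t] tm in \<open>auto simp: set_lebesgue_integral_eq_integral(1) fmeasurableD\<close>)
    ultimately show "(\<Sum>I\<in>D. \<bar>F (Sup I) - F (Inf I)\<bar>) < e" by linarith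
  qed
qed

text \<open>Lebesgue's differentiation theorem. The right derivative is \<open>integrable_ccontinuous_explicit\<close>, applied to
  \<open>f\<close>; the left derivative comes from the reflected function.\<close>
lemma primitive_on_has_derivative_ae:
  assumes "primitive_on p q F f"
  obtains N where "negligible N" "\<And>x. x \<in> {p<..<q} - N \<Longrightarrow> (F has_real_derivative f x) (at x)"
proof -
  (* The differentiation theorem asks for integrability on every interval. *)
  let ?g = "\<lambda>x. if x \<in> {p..q} then f x else 0"
  have f: "f absolutely_integrable_on {p..q}" using assms by (simp add: primitive_on_def)
  have "?g absolutely_integrable_on UNIV" using f by (simp only: absolutely_integrable_restrict_UNIV)
  then have g: "?g absolutely_integrable_on S" if "S \<in> sets lebesgue" for S
    using set_integrable_subset that by blast
  have gi: "?g integrable_on cbox a b" for a b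
    using g[of "cbox a b"] by (simp add: set_lebesgue_integral_eq_integral(1))
  have gri: "(\<lambda>x. ?g (- x)) integrable_on cbox a b" for a b
    using integrable_reflect[of ?g "-a" "-b"] gi[of "-b" "-a"] by (simp only: minus_minus)
  obtain N1 where N1: "negligible N1" and
    d1: "\<And>x e. x \<notin> N1 \<Longrightarrow> 0 < e \<Longrightarrow> \<exists>d>0. \<forall>h. 0 < h \<and> h < d \<longrightarrow>
                         norm(integral (cbox x (x + h *\<^sub>R One)) ?g /\<^sub>R h ^ DIM(real) - ?g x) < e"
    using integrable_ccontinuous_explicit[of ?g] gi by blast
  obtain N2 where N2: "negligible N2" and
    d2: "\<And>x e. x \<notin> N2 \<Longrightarrow> 0 < e \<Longrightarrow> \<exists>d>0. \<forall>h. 0 < h \<and> h < d \<longrightarrow>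
                         norm(integral (cbox x (x + h *\<^sub>R One)) (\<lambda>x. ?g (- x)) /\<^sub>R h ^ DIM(real) - ?g (- x)) < e"
    using integrable_ccontinuous_explicit[of "\<lambda>x. ?g (- x)"] gri by blast
  have neg: "negligible (N1 \<union> uminus ` N2)"
    using N1 N2 by (intro negligible_Un) (auto intro!: negligible_differentiable_image_negligible simp: differentiable_on_def)
  show thesis
  proof (rule that[OF neg])
    fix x assume x: "x \<in> {p<..<q} - (N1 \<union> uminus ` N2)"
    then have xN: "x \<notin> N1" "- x \<notin> N2" by force+
    show "(F has_real_derivative f x) (at x)"
      unfolding DERIV_def LIM_def
    proof (intro allI impI)
      fix e :: real assume e: "e > 0"
      obtain d where d: "d > 0" "\<And>h. 0 < h \<Longrightarrow> h < d \<Longrightarrow> \<bar>integral {x..x + h} ?g / h - ?g x\<bar> < e"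
        using d1[OF xN(1) e] by (auto simp: divide_inverse mult.commute cbox_interval)
      obtain d' where d': "d' > 0" "\<And>h. 0 < h \<Longrightarrow> h < d' \<Longrightarrow> \<bar>integral {- x..- x + h} (\<lambda>x. ?g (- x)) / h - ?g x\<bar> < e"
        using d2[OF xN(2) e] by (auto simp: divide_inverse mult.commute cbox_interval cong: if_cong)
      let ?d = "min (min d d') (min (q - x) (x - p))"
      show "\<exists>s>0. \<forall>h. h \<noteq> 0 \<and> dist h 0 < s \<longrightarrow> dist ((F (x + h) - F x) / h) (f x) < e"
      proof (intro exI[of _ ?d] conjI allI impI)
        show "?d > 0" using d d' x by auto
        fix h :: real assume h: "h \<noteq> 0 \<and> dist h 0 < ?d"
        show "dist ((F (x + h) - F x) / h) (f x) < e"
        proof (cases "h > 0")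
          case True
          then have "F (x + h) - F x = integral {x..x+h} f"
            using primitive_on_integral[OF assms, of x "x+h"] x h by (auto simp: dist_real_def)
          also have "\<dots> = integral {x..x+h} ?g"
            using x h True by (intro integral_cong) (auto simp: dist_real_def)
          finally show ?thesis using d(2)[of h] x h True by (auto simp: dist_real_def)
        next
          case False
          then have h0: "h < 0" using h by auto
          then have "F x - F (x + h) = integral {x+h..x} f"
            using primitive_on_integral[OF assms, of "x+h" x] x h by (auto simp: dist_real_def)
          also have "\<dots> = integral {x+h..x} ?g"
            using x h h0 by (intro integral_cong) (auto simp: dist_real_def)
          also have "\<dots> = integral {-x..- x - h} (\<lambda>x. ?g (- x))"
            using Henstock_Kurzweil_Integration.integral_reflect_real[of x "x + h" ?g]
            by (simp only: minus_add_distrib diff_conv_add_uminus)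
          finally have "(F (x + h) - F x) / h = integral {-x..- x - h} (\<lambda>x. ?g (- x)) / (- h)"
            by (simp add: field_simps)
          then show ?thesis using d'(2)[of "- h"] x h h0 by (auto simp: dist_real_def)
        qed
      qed
    qed
  qed
qed

lemma abs_cont_on_subinterval:
  assumes "abs_cont_on F p q" "p \<le> p'" "q' \<le> q"
  shows "abs_cont_on F p' q'"
  unfolding abs_cont_on_def
proof (intro allI impI)
  fix e :: real assume "e > 0"
  then obtain d where "d > 0" and d: "\<And>D t. D division_of t \<and> t \<subseteq> {p..q} \<and> (\<Sum>I\<in>D. Sup I - Inf I) < d \<Longrightarrow>
        (\<Sum>I\<in>D. \<bar>F (Sup I) - F (Inf I)\<bar>) < e"
    using assms(1) unfolding abs_cont_on_def by meson
  show "\<exists>d>0. \<forall>D t. D division_of t \<and> t \<subseteq> {p'..q'} \<and> (\<Sum>I\<in>D. Sup I - Inf I) < d \<longrightarrow>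
        (\<Sum>I\<in>D. \<bar>F (Sup I) - F (Inf I)\<bar>) < e"
    using \<open>d > 0\<close> assms(2,3) by (intro exI[of _ d] conjI allI impI d) (auto simp: subset_iff)
qed

text \<open>A gauge argument. On the null set \<open>N\<close> the integrand may be replaced by \<open>0\<close>; the intervals tagged there
  lie in an open set of small measure, so absolute continuity makes the increments of \<open>F\<close> over them
  small. At all other tags \<open>F\<close> is differentiable, and each increment is close to \<open>f\<close> times the length.\<close>
lemma abs_cont_FTC:
  assumes AC: "abs_cont_on F p q" and pq: "p \<le> q" and N: "negligible N"
    and der: "\<And>x. x \<in> {p<..<q} - N \<Longrightarrow> (F has_real_derivative f x) (at x)"
  shows "(f has_integral (F q - F p)) {p..q}"
proof -
  define N' where "N' = N \<union> {p, q}"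
  define g where "g x = (if x \<in> N' then 0 else f x)" for x
  have N': "negligible N'" unfolding N'_def using N by (auto intro: negligible_Un negligible_finite)
  have "(g has_integral (F q - F p)) {p..q}"
    unfolding has_integral_real
  proof (intro allI impI)
    fix e :: real assume e: "e > 0"
    obtain d where d: "d > 0" and ac: "\<And>D t. D division_of t \<Longrightarrow> t \<subseteq> {p..q} \<Longrightarrow> (\<Sum>I\<in>D. Sup I - Inf I) < d \<Longrightarrow>
        (\<Sum>I\<in>D. \<bar>F (Sup I) - F (Inf I)\<bar>) < e/2"
      using AC e unfolding abs_cont_on_def by (meson half_gt_zero)
    obtain U where U: "open U" "N' \<subseteq> U" "U - N' \<in> lmeasurable" "emeasure lebesgue (U - N') < ennreal d"
      using sets_lebesgue_outer_open[OF _ d, of N'] N' by (metis fmeasurableD negligible_imp_measurable)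
    have Um: "U \<in> lmeasurable" "measure lebesgue U < d"
    proof -
      have eq: "U = (U - N') \<union> N'" using U by auto
      have l: "N' \<in> lmeasurable" "measure lebesgue N' = 0"
        using N' by (auto simp: negligible_iff_measure)
      show "U \<in> lmeasurable" using fmeasurable.Un[OF U(3) l(1)] eq by simp
      have "measure lebesgue (U - N') < d"
        using U(3,4) d by (simp add: emeasure_eq_measure2 ennreal_less_iff)
      moreover have "measure lebesgue ((U - N') \<union> N') \<le> measure lebesgue (U - N') + measure lebesgue N'"
        using U(3) l(1) by (intro measure_Un_le fmeasurableD)
      ultimately show "measure lebesgue U < d" using eq l(2) by simp
    qed
    (* The summand 1 keeps the constant defined for p = q. *)
    let ?c = "e / (2 * (q - p + 1))"
    have c: "?c > 0" using e pq by auto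
    have "\<exists>r>0. (x \<in> N' \<longrightarrow> ball x r \<subseteq> U) \<and>
        (x \<in> {p..q} - N' \<longrightarrow> (\<forall>y\<in>ball x r. \<bar>F y - F x - f x * (y - x)\<bar> \<le> ?c * \<bar>y - x\<bar>))" for x
    proof (cases "x \<in> N'")
      case True
      then show ?thesis using U(1,2) open_contains_ball by (metis DiffE subsetD)
    next
      case False
      show ?thesis
      proof (cases "x \<in> {p..q}")
        case True
        then have "(F has_derivative (\<lambda>h. f x * h)) (at x)"
          using der[of x] False by (auto simp: N'_def has_field_derivative_def)
        then obtain r where "r > 0" "\<And>y. \<bar>y - x\<bar> < r \<Longrightarrow> \<bar>F y - F x - f x * (y - x)\<bar> \<le> ?c * \<bar>y - x\<bar>"
          using c unfolding has_derivative_at_alt by (metis real_norm_def)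
        then show ?thesis using False by (intro exI[of _ r]) (auto simp: dist_real_def abs_minus_commute)
      qed (use False in \<open>auto intro: exI[of _ 1]\<close>)
    qed
    then obtain r where r: "\<And>x. r x > 0" "\<And>x. x \<in> N' \<Longrightarrow> ball x (r x) \<subseteq> U"
      "\<And>x y. x \<in> {p..q} - N' \<Longrightarrow> y \<in> ball x (r x) \<Longrightarrow> \<bar>F y - F x - f x * (y - x)\<bar> \<le> ?c * \<bar>y - x\<bar>"
      by metis
    show "\<exists>\<gamma>. gauge \<gamma> \<and> (\<forall>\<D>. \<D> tagged_division_of {p..q} \<and> \<gamma> fine \<D> \<longrightarrow>
              norm ((\<Sum>(x,k)\<in>\<D>. measure lborel k *\<^sub>R g x) - (F q - F p)) < e)"
    proof (intro exI[of _ "\<lambda>x. ball x (r x)"] conjI allI impI)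
      show "gauge (\<lambda>x. ball x (r x))" using r(1) by (simp add: gauge_def)
      fix \<D> assume "\<D> tagged_division_of {p..q} \<and> (\<lambda>x. ball x (r x)) fine \<D>"
      then have D: "\<D> tagged_division_of {p..q}" and fine: "\<And>x k. (x,k) \<in> \<D> \<Longrightarrow> k \<subseteq> ball x (r x)"
        by (auto simp: fine_def)
      have fin: "finite \<D>" using D by blast
      have dv: "snd ` \<D> division_of {p..q}" by (rule division_of_tagged_division[OF D])
      have I: "k = {Inf k..Sup k} \<and> Inf k \<le> Sup k \<and> x \<in> k \<and> k \<subseteq> {p..q}" if "(x,k) \<in> \<D>" for x k
        using division_of_real_interval[OF dv, of k] tagged_division_ofD(2,3)[OF D that] that by force
      define A where "A = {z \<in> \<D>. fst z \<in> N'}"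
      have A: "A \<subseteq> \<D>" "finite A" using fin by (auto simp: A_def)
      let ?h = "\<lambda>k. \<bar>F (Sup k) - F (Inf k)\<bar>"
      have dvA: "snd ` A division_of (\<Union>(snd ` A))"
        by (rule division_of_subset[of "snd ` \<D>"]) (use dv A division_ofD(6)[OF dv] in auto)
      have AU: "\<Union>(snd ` A) \<subseteq> U" "\<Union>(snd ` A) \<subseteq> {p..q}"
        using fine r(2) I by (fastforce simp: A_def)+
      have "(\<Sum>k\<in>snd ` A. ?h k) < e/2"
      proof (rule ac[OF dvA AU(2)])
        have "(\<Sum>I\<in>snd ` A. Sup I - Inf I) = measure lebesgue (\<Union>(snd ` A))"
          using division_of_real_measure[OF dvA] by simp
        also have "\<dots> \<le> measure lebesgue U"
          using AU(1) Um division_of_real_measure(1)[OF dvA] by (intro measure_mono_fmeasurable) auto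
        finally show "(\<Sum>I\<in>snd ` A. Sup I - Inf I) < d" using Um by simp
      qed
      moreover have "(\<Sum>k\<in>snd ` A. ?h k) = (\<Sum>z\<in>A. ?h (snd z))"
      proof (subst sum.reindex_nontrivial[OF A(2)])
        fix z w assume zw: "z \<in> A" "w \<in> A" "z \<noteq> w" "snd z = snd w"
        then have "(fst z, snd z) \<in> \<D>" "(fst w, snd w) \<in> \<D>" using A by (metis prod.collapse subsetD)+
        then have "interior (snd z) \<inter> interior (snd w) = {}"
          using zw tagged_division_ofD(5)[OF D] by (metis prod.collapse)
        then have "interior {Inf (snd z)..Sup (snd z)} = {}"
          using zw I[of "fst z" "snd z"] \<open>(fst z, snd z) \<in> \<D>\<close> by auto
        then have "Inf (snd z) = Sup (snd z)"
          using I[of "fst z" "snd z"] \<open>(fst z, snd z) \<in> \<D>\<close> by auto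
        then show "?h (snd z) = 0" by simp
      qed auto
      ultimately have sA: "(\<Sum>z\<in>A. ?h (snd z)) < e/2" by simp
      have tel: "F q - F p = (\<Sum>z\<in>\<D>. F (Sup (snd z)) - F (Inf (snd z)))"
        using additive_tagged_division_1[OF pq D, of F] by (simp add: case_prod_beta)
      have sc: "(\<Sum>z\<in>\<D>. Sup (snd z) - Inf (snd z)) = q - p"
        using additive_tagged_division_1[OF pq D, of id] by (simp add: case_prod_beta)
      let ?E = "\<lambda>z. measure lborel (snd z) * g (fst z) - (F (Sup (snd z)) - F (Inf (snd z)))"
      have bA: "\<bar>?E z\<bar> \<le> ?h (snd z)" if "z \<in> A" for z
        using that by (auto simp: A_def g_def)
      have bB: "\<bar>?E z\<bar> \<le> ?c * (Sup (snd z) - Inf (snd z))" if z: "z \<in> \<D> - A" for z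
      proof -
        obtain x k where xk: "z = (x,k)" by (cases z)
        obtain s t where st: "k = {s..t}" "s \<le> t" using I[of x k] z by (auto simp: xk)
        then have k: "k = {s..t}" "s \<le> x" "x \<le> t" "p \<le> s" "t \<le> q" and xN: "x \<notin> N'"
          using I[of x k] z by (auto simp: xk A_def)
        have "s \<in> ball x (r x)" "t \<in> ball x (r x)" using fine[of x k] z k subsetD[of "{s..t}" "ball x (r x)"] by (auto simp: xk simp del: mem_ball)
        then have "\<bar>F s - F x - f x * (s - x)\<bar> \<le> ?c * \<bar>s - x\<bar>" "\<bar>F t - F x - f x * (t - x)\<bar> \<le> ?c * \<bar>t - x\<bar>"
          using r(3)[of x s] r(3)[of x t] k xN by auto
        moreover have "?c * \<bar>s - x\<bar> + ?c * \<bar>t - x\<bar> = ?c * (t - s)"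
          unfolding distrib_left[symmetric] using k by simp
        moreover have "(t - s) * f x - (F t - F s) = (F s - F x - f x * (s - x)) - (F t - F x - f x * (t - x))"
          by (simp add: algebra_simps)
        ultimately have "\<bar>(t - s) * f x - (F t - F s)\<bar> \<le> ?c * (t - s)" by linarith
        then show ?thesis using k xN by (simp add: xk g_def content_real)
      qed
      have "(\<Sum>(x,k)\<in>\<D>. measure lborel k *\<^sub>R g x) - (F q - F p) = (\<Sum>z\<in>\<D>. ?E z)"
        by (simp add: tel sum_subtractf case_prod_beta)
      also have "\<bar>\<dots>\<bar> \<le> (\<Sum>z\<in>\<D>. \<bar>?E z\<bar>)" by (rule sum_abs)
      also have "\<dots> = (\<Sum>z\<in>A. \<bar>?E z\<bar>) + (\<Sum>z\<in>\<D> - A. \<bar>?E z\<bar>)"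
        using sum.subset_diff[OF A(1) fin, of "\<lambda>z. \<bar>?E z\<bar>"] by simp
      also have "\<dots> \<le> (\<Sum>z\<in>A. ?h (snd z)) + (\<Sum>z\<in>\<D> - A. ?c * (Sup (snd z) - Inf (snd z)))"
        by (intro add_mono sum_mono bA bB)
      also have "(\<Sum>z\<in>\<D> - A. ?c * (Sup (snd z) - Inf (snd z))) \<le> (\<Sum>z\<in>\<D>. ?c * (Sup (snd z) - Inf (snd z)))"
      proof (rule sum_mono2[OF fin])
        fix z assume "z \<in> \<D> - (\<D> - A)"
        then have "(fst z, snd z) \<in> \<D>" by auto
        then show "0 \<le> ?c * (Sup (snd z) - Inf (snd z))" using I[of "fst z" "snd z"] c by (intro mult_nonneg_nonneg) auto
      qed auto
      also have "\<dots> = ?c * (q - p)" unfolding sum_distrib_left[symmetric] sc ..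
      also have "\<dots> \<le> e/2" using e pq by (simp add: field_simps)
      finally show "norm ((\<Sum>(x,k)\<in>\<D>. measure lborel k *\<^sub>R g x) - (F q - F p)) < e" using sA by simp
    qed
  qed
  then show ?thesis
    by (rule has_integral_spike[OF N', rotated]) (auto simp: g_def)
qed

lemma primitive_onI_abs_cont:
  assumes AC: "abs_cont_on F p q" and N: "negligible N" and f: "f absolutely_integrable_on {p..q}"
    and der: "\<And>x. x \<in> {p<..<q} - N \<Longrightarrow> (F has_real_derivative f x) (at x)"
  shows "primitive_on p q F f"
  unfolding primitive_on_def
proof (intro conjI ballI f)
  fix x assume x: "x \<in> {p..q}"
  have "(f has_integral (F x - F p)) {p..x}"
    using x by (intro abs_cont_FTC[OF abs_cont_on_subinterval[OF AC] _ N] der) auto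
  then show "F x = F p + integral {p..x} f" by (simp add: integral_unique)
qed

lemma primitive_on_absolutely_integrable: "primitive_on p q F f \<Longrightarrow> f absolutely_integrable_on {p..q}"
  by (simp add: primitive_on_def)

lemma primitive_on_subinterval:
  assumes "primitive_on p q F f" "p \<le> p'" "q' \<le> q"
  shows "primitive_on p' q' F f"
  unfolding primitive_on_def
proof (intro conjI ballI)
  show "f absolutely_integrable_on {p'..q'}"
    using primitive_on_absolutely_integrable[OF assms(1)] assms(2,3)
    by (auto intro: absolutely_integrable_on_subinterval)
  fix x assume "x \<in> {p'..q'}"
  then show "F x = F p' + integral {p'..x} f"
    using primitive_on_integral(1)[OF assms(1), of p' x] assms(2,3) by simp
qed

lemma primitive_on_integrable: "primitive_on p q F f \<Longrightarrow> f integrable_on {p..q}"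
  by (simp add: primitive_on_def set_lebesgue_integral_eq_integral(1))

lemma primitive_on_continuous:
  assumes "primitive_on p q F f"
  shows "continuous_on {p..q} F"
proof -
  have "continuous_on {p..q} (\<lambda>x. F p + integral {p..x} f)"
    by (intro continuous_intros indefinite_integral_continuous_1 primitive_on_integrable[OF assms])
  then show ?thesis
    using assms unfolding primitive_on_def by (metis (no_types, lifting) continuous_on_cong)
qed

lemma primitive_on_indefinite_integral:
  assumes "f absolutely_integrable_on {p..q}"
  shows "primitive_on p q (\<lambda>x. c + integral {p..x} f) f"
  using assms by (auto simp: primitive_on_def)

lemma primitive_on_cong:
  assumes "primitive_on p q F f" "\<And>x. x \<in> {p..q} \<Longrightarrow> F x = G x"
    and N: "negligible N" and fg: "\<And>x. x \<in> {p..q} - N \<Longrightarrow> f x = g x"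
  shows "primitive_on p q G g"
  unfolding primitive_on_def
proof (intro conjI ballI)
  show "g absolutely_integrable_on {p..q}"
    using absolutely_integrable_spike[OF primitive_on_absolutely_integrable[OF assms(1)] N] fg by metis
  fix x assume x: "x \<in> {p..q}"
  have "integral {p..x} f = integral {p..x} g"
    using x fg by (intro integral_spike[OF N]) auto
  then show "G x = G p + integral {p..x} g"
    using primitive_on_integral(1)[OF assms(1), of p x] x assms(2)[of x] assms(2)[of p] by simp
qed

lemma primitive_on_const: "primitive_on p q (\<lambda>_. c) (\<lambda>_. 0)"
  by (simp add: primitive_on_def)

lemma primitive_on_add:
  assumes "primitive_on p q F f" "primitive_on p q G g"
  shows "primitive_on p q (\<lambda>x. F x + G x) (\<lambda>x. f x + g x)"
  unfolding primitive_on_def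
proof (intro conjI ballI)
  show "(\<lambda>x. f x + g x) absolutely_integrable_on {p..q}"
    using assms[THEN primitive_on_absolutely_integrable] by auto
  fix x assume x: "x \<in> {p..q}"
  have "integral {p..x} (\<lambda>x. f x + g x) = integral {p..x} f + integral {p..x} g"
    using x by (intro integral_add primitive_on_integrable[OF primitive_on_subinterval[OF assms(1)]]
        primitive_on_integrable[OF primitive_on_subinterval[OF assms(2)]]) auto
  then show "F x + G x = F p + G p + integral {p..x} (\<lambda>x. f x + g x)"
    using primitive_on_integral(1)[OF assms(1), of p x] primitive_on_integral(1)[OF assms(2), of p x] x by simp
qed

lemma primitive_on_cmult:
  assumes "primitive_on p q F f"
  shows "primitive_on p q (\<lambda>x. c * F x) (\<lambda>x. c * f x)"
  unfolding primitive_on_def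
proof (intro conjI ballI)
  show "(\<lambda>x. c * f x) absolutely_integrable_on {p..q}"
    using primitive_on_absolutely_integrable[OF assms] by auto
  fix x assume x: "x \<in> {p..q}"
  show "c * F x = c * F p + integral {p..x} (\<lambda>x. c * f x)"
    using primitive_on_integral(1)[OF assms(1), of p x] x by (simp add: algebra_simps)
qed

lemma primitive_on_diff:
  assumes "primitive_on p q F f" "primitive_on p q G g"
  shows "primitive_on p q (\<lambda>x. F x - G x) (\<lambda>x. f x - g x)"
  using primitive_on_add[OF assms(1) primitive_on_cmult[OF assms(2), of "-1"]] by simp

lemma primitive_on_bounded:
  assumes "primitive_on p q F f"
  obtains B where "B > 0" "\<And>x. x \<in> {p..q} \<Longrightarrow> \<bar>F x\<bar> \<le> B"
proof -
  have "compact (F ` {p..q})"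
    by (intro compact_continuous_image primitive_on_continuous[OF assms]) auto
  then have "bounded (F ` {p..q})" by (rule compact_imp_bounded)
  then show thesis using that by (auto simp: bounded_pos)
qed

text \<open>The common reason why products and smooth functions of absolutely continuous functions are absolutely
  continuous.\<close>
lemma abs_cont_on_lipschitz_combination:
  assumes F: "abs_cont_on F p q" and G: "abs_cont_on G p q" and B: "B > 0"
    and H: "\<And>x y. x \<in> {p..q} \<Longrightarrow> y \<in> {p..q} \<Longrightarrow> \<bar>H y - H x\<bar> \<le> B * (\<bar>F y - F x\<bar> + \<bar>G y - G x\<bar>)"
  shows "abs_cont_on H p q"
  unfolding abs_cont_on_def
proof (intro allI impI)
  fix e :: real assume e: "e > 0"
  then have e2: "e / (2 * B) > 0" using B by simp
  obtain d1 where d1: "d1 > 0" "\<And>D t. D division_of t \<and> t \<subseteq> {p..q} \<and> (\<Sum>I\<in>D. Sup I - Inf I) < d1 \<Longrightarrow>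
        (\<Sum>I\<in>D. \<bar>F (Sup I) - F (Inf I)\<bar>) < e / (2 * B)"
    using F e2 unfolding abs_cont_on_def by meson
  obtain d2 where d2: "d2 > 0" "\<And>D t. D division_of t \<and> t \<subseteq> {p..q} \<and> (\<Sum>I\<in>D. Sup I - Inf I) < d2 \<Longrightarrow>
        (\<Sum>I\<in>D. \<bar>G (Sup I) - G (Inf I)\<bar>) < e / (2 * B)"
    using G e2 unfolding abs_cont_on_def by meson
  show "\<exists>d>0. \<forall>D t. D division_of t \<and> t \<subseteq> {p..q} \<and> (\<Sum>I\<in>D. Sup I - Inf I) < d \<longrightarrow>
        (\<Sum>I\<in>D. \<bar>H (Sup I) - H (Inf I)\<bar>) < e"
  proof (intro exI[of _ "min d1 d2"] conjI allI impI)
    show "min d1 d2 > 0" using d1 d2 by simp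
    fix D t assume A: "D division_of t \<and> t \<subseteq> {p..q} \<and> (\<Sum>I\<in>D. Sup I - Inf I) < min d1 d2"
    have "(\<Sum>I\<in>D. \<bar>H (Sup I) - H (Inf I)\<bar>)
        \<le> (\<Sum>I\<in>D. B * (\<bar>F (Sup I) - F (Inf I)\<bar> + \<bar>G (Sup I) - G (Inf I)\<bar>))"
    proof (rule sum_mono, rule H)
      fix I assume I: "I \<in> D"
      then obtain a b where "I = {a..b}" "a \<le> b" using A division_of_real_interval by metis
      moreover have "I \<subseteq> {p..q}" using I A by blast
      ultimately show "Inf I \<in> {p..q}" "Sup I \<in> {p..q}" by auto
    qed
    also have "\<dots> = B * ((\<Sum>I\<in>D. \<bar>F (Sup I) - F (Inf I)\<bar>) + (\<Sum>I\<in>D. \<bar>G (Sup I) - G (Inf I)\<bar>))"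
      unfolding sum.distrib[symmetric] sum_distrib_left ..
    also have "\<dots> < B * (e / (2 * B) + e / (2 * B))"
      using A d1(2)[of D t] d2(2)[of D t] B by (intro mult_strict_left_mono add_strict_mono) auto
    also have "\<dots> = e" using B by (simp add: field_simps)
    finally show "(\<Sum>I\<in>D. \<bar>H (Sup I) - H (Inf I)\<bar>) < e" .
  qed
qed

lemma absolutely_integrable_continuous_mult:
  fixes f g :: "real \<Rightarrow> real"
  assumes "f absolutely_integrable_on {p..q}" "continuous_on {p..q} g"
  shows "(\<lambda>x. f x * g x) absolutely_integrable_on {p..q}"
proof -
  have "(\<lambda>x. g x * f x) absolutely_integrable_on {p..q}"
    using assms by (intro absolutely_integrable_bounded_measurable_product_real)
      (auto intro: continuous_imp_measurable_on_sets_lebesgue compact_imp_bounded compact_continuous_image)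
  then show ?thesis by (simp add: mult.commute)
qed

lemma absolutely_integrable_diff_const:
  fixes f :: "real \<Rightarrow> real"
  assumes "f absolutely_integrable_on {p..q}"
  shows "(\<lambda>t. f t - c) absolutely_integrable_on {p..q}"
  by (intro set_integral_diff assms absolutely_integrable_continuous_real continuous_intros)

lemma primitive_on_mult:
  assumes F: "primitive_on p q F f" and G: "primitive_on p q G g"
  shows "primitive_on p q (\<lambda>x. F x * G x) (\<lambda>x. f x * G x + g x * F x)"
proof -
  obtain N1 where N1: "negligible N1" "\<And>x. x \<in> {p<..<q} - N1 \<Longrightarrow> (F has_real_derivative f x) (at x)"
    using primitive_on_has_derivative_ae[OF F] by blast
  obtain N2 where N2: "negligible N2" "\<And>x. x \<in> {p<..<q} - N2 \<Longrightarrow> (G has_real_derivative g x) (at x)"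
    using primitive_on_has_derivative_ae[OF G] by blast
  obtain B1 where B1: "B1 > 0" "\<And>x. x \<in> {p..q} \<Longrightarrow> \<bar>F x\<bar> \<le> B1" using primitive_on_bounded[OF F] by blast
  obtain B2 where B2: "B2 > 0" "\<And>x. x \<in> {p..q} \<Longrightarrow> \<bar>G x\<bar> \<le> B2" using primitive_on_bounded[OF G] by blast
  show ?thesis
  proof (rule primitive_onI_abs_cont[OF _ negligible_Un[OF N1(1) N2(1)]])
    show "abs_cont_on (\<lambda>x. F x * G x) p q"
    proof (rule abs_cont_on_lipschitz_combination[OF indefinite_integral_abs_cont[OF F] indefinite_integral_abs_cont[OF G]])
      show "B1 + B2 > 0" using B1 B2 by simp
      fix x y assume xy: "x \<in> {p..q}" "y \<in> {p..q}"
      have "F y * G y - F x * G x = (F y - F x) * G y + F x * (G y - G x)" by (simp add: algebra_simps)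
      also have "\<bar>\<dots>\<bar> \<le> \<bar>F y - F x\<bar> * \<bar>G y\<bar> + \<bar>F x\<bar> * \<bar>G y - G x\<bar>"
        by (metis abs_mult abs_triangle_ineq)
      also have "\<dots> \<le> \<bar>F y - F x\<bar> * (B1 + B2) + (B1 + B2) * \<bar>G y - G x\<bar>"
        using B1(1) B1(2)[OF xy(1)] B2(1) B2(2)[OF xy(2)]
        by (intro add_mono mult_left_mono mult_right_mono) auto
      finally show "\<bar>F y * G y - F x * G x\<bar> \<le> (B1 + B2) * (\<bar>F y - F x\<bar> + \<bar>G y - G x\<bar>)"
        by (simp add: algebra_simps)
    qed
    show "(\<lambda>x. f x * G x + g x * F x) absolutely_integrable_on {p..q}"
      by (intro set_integral_add absolutely_integrable_continuous_mult primitive_on_continuous[OF F]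
          primitive_on_continuous[OF G] primitive_on_absolutely_integrable[OF F] primitive_on_absolutely_integrable[OF G])
    show "((\<lambda>x. F x * G x) has_real_derivative f x * G x + g x * F x) (at x)"
      if "x \<in> {p<..<q} - (N1 \<union> N2)" for x
      using DERIV_mult[OF N1(2)[of x] N2(2)[of x]] that by (simp add: algebra_simps)
  qed
qed

lemma primitive_on_compose:
  assumes F: "primitive_on p q F f"
    and h: "\<And>y. (h has_real_derivative h' y) (at y)" and h': "continuous_on UNIV h'"
  shows "primitive_on p q (\<lambda>x. h (F x)) (\<lambda>x. f x * h' (F x))"
proof -
  obtain N where N: "negligible N" "\<And>x. x \<in> {p<..<q} - N \<Longrightarrow> (F has_real_derivative f x) (at x)"
    using primitive_on_has_derivative_ae[OF F] by blast
  obtain M where M: "M > 0" "\<And>x. x \<in> {p..q} \<Longrightarrow> \<bar>F x\<bar> \<le> M" using primitive_on_bounded[OF F] by blast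
  have "compact (h' ` {-M..M})"
    by (intro compact_continuous_image continuous_on_subset[OF h']) auto
  then obtain B where B: "B > 0" "\<And>y. y \<in> {-M..M} \<Longrightarrow> \<bar>h' y\<bar> \<le> B"
    using compact_imp_bounded bounded_pos by (metis image_eqI real_norm_def)
  have lip: "\<bar>h y - h z\<bar> \<le> B * \<bar>y - z\<bar>" if "y \<in> {-M..M}" "z \<in> {-M..M}" for y z
    using field_differentiable_bound[of "{-M..M}" h h' B y z] that B h
    by (auto simp: convex_real_interval intro: has_field_derivative_at_within)
  show ?thesis
  proof (rule primitive_onI_abs_cont[OF _ N(1)])
    note AC = indefinite_integral_abs_cont[OF F]
    show "abs_cont_on (\<lambda>x. h (F x)) p q"
    proof (rule abs_cont_on_lipschitz_combination[OF AC AC B(1)])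
      fix x y assume xy: "x \<in> {p..q}" "y \<in> {p..q}"
      have "\<bar>h (F y) - h (F x)\<bar> \<le> B * \<bar>F y - F x\<bar>"
        using M(2)[OF xy(1)] M(2)[OF xy(2)] by (intro lip) auto
      then show "\<bar>h (F y) - h (F x)\<bar> \<le> B * (\<bar>F y - F x\<bar> + \<bar>F y - F x\<bar>)"
        using B(1) by (smt (verit) distrib_left mult_nonneg_nonneg)
    qed
    show "(\<lambda>x. f x * h' (F x)) absolutely_integrable_on {p..q}"
      using primitive_on_absolutely_integrable[OF F]
      by (rule absolutely_integrable_continuous_mult)
        (rule continuous_on_compose2[OF h' primitive_on_continuous[OF F]], simp)
    show "((\<lambda>x. h (F x)) has_real_derivative f x * h' (F x)) (at x)" if "x \<in> {p<..<q} - N" for x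
      using DERIV_chain2[OF h N(2)[OF that]] by (simp add: mult.commute)
  qed
qed

lemma primitive_on_classical:
  assumes der: "\<And>x. x \<in> {p..q} \<Longrightarrow> (F has_real_derivative f x) (at x within {p..q})"
    and cont: "continuous_on {p..q} f"
  shows "primitive_on p q F f"
  unfolding primitive_on_def
proof (intro conjI ballI)
  show "f absolutely_integrable_on {p..q}" by (rule absolutely_integrable_continuous_real[OF cont])
  fix x assume x: "x \<in> {p..q}"
  have "(f has_integral (F x - F p)) {p..x}"
  proof (rule fundamental_theorem_of_calculus)
    show "p \<le> x" using x by simp
    fix y assume "y \<in> {p..x}"
    then have "(F has_real_derivative f y) (at y within {p..x})"
      using x by (intro has_field_derivative_subset[OF der]) auto
    then show "(F has_vector_derivative f y) (at y within {p..x})"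
      by (simp add: has_real_derivative_iff_has_vector_derivative)
  qed
  then show "F x = F p + integral {p..x} f" by (simp add: integral_unique)
qed

lemma primitive_on_derivative_within:
  assumes F: "primitive_on p q F f" and cont: "continuous_on {p..q} f" and x: "x \<in> {p..q}"
  shows "(F has_real_derivative f x) (at x within {p..q})"
proof -
  have "((\<lambda>y. F p + integral {p..y} f) has_real_derivative f x) (at x within {p..q})"
    using DERIV_add[OF DERIV_const[of "F p"] integral_has_real_derivative[OF cont x]] by simp
  then show ?thesis
    by (rule has_field_derivative_transform_within[OF _ zero_less_one x]) (use F in \<open>metis primitive_on_def\<close>)
qed

lemma primitive_on_combine:
  assumes F: "primitive_on p q F f" and G: "primitive_on q r F f" and pqr: "p \<le> q" "q \<le> r"
  shows "primitive_on p r F f"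
  unfolding primitive_on_def
proof (intro conjI ballI)
  show ai: "f absolutely_integrable_on {p..r}"
    using absolutely_integrable_on_combine[OF primitive_on_absolutely_integrable[OF F]
        primitive_on_absolutely_integrable[OF G]] pqr by simp
  fix x assume x: "x \<in> {p..r}"
  show "F x = F p + integral {p..x} f"
  proof (cases "x \<le> q")
    case True
    then show ?thesis using primitive_on_integral(1)[OF F, of p x] x by simp
  next
    case False
    have "integral {p..x} f = integral {p..q} f + integral {q..x} f"
      using x False pqr ai
      by (intro Henstock_Kurzweil_Integration.integral_combine[symmetric])
        (auto intro!: set_lebesgue_integral_eq_integral(1) intro: absolutely_integrable_on_subinterval)
    then show ?thesis
      using primitive_on_integral(1)[OF F, of p q] primitive_on_integral(1)[OF G, of q x] x False pqr by simp
  qed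
qed

lemma primitive_on_shift:
  assumes "primitive_on p q F f"
  shows "primitive_on (p - c) (q - c) (\<lambda>x. F (x + c)) (\<lambda>x. f (x + c))"
proof -
  show ?thesis
    unfolding primitive_on_def
  proof (intro conjI ballI)
    have "f integrable_on {p..q}" "(\<lambda>x. norm (f x)) integrable_on {p..q}"
      using primitive_on_absolutely_integrable[OF assms] by (auto simp: absolutely_integrable_on_def)
    then show "(\<lambda>x. f (x + c)) absolutely_integrable_on {p - c..q - c}"
      unfolding absolutely_integrable_on_def
      using integrable_shift_real_ivl[of f p q c] integrable_shift_real_ivl[of "\<lambda>x. norm (f x)" p q c] by blast
    fix x assume x: "x \<in> {p - c..q - c}"
    have "integral {p..x+c} f = F (x + c) - F p" and i: "f integrable_on {p..x+c}"
      using primitive_on_integral[OF assms, of p "x + c"] x by (auto simp: set_lebesgue_integral_eq_integral(1))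
    then have "(f has_integral (F (x + c) - F p)) {p..x+c}" by (metis integrable_integral)
    then have "((\<lambda>x. f (x + c)) has_integral (F (x + c) - F p)) {p - c..x + c - c}"
      by (rule has_integral_shift_real_ivl)
    then show "F (x + c) = F (p - c + c) + integral {p - c..x} (\<lambda>x. f (x + c))" by (simp add: integral_unique)
  qed
qed

lemma primitive_on_reflect:
  assumes F: "primitive_on p r F f"
  shows "primitive_on p r (\<lambda>t. F (p + r - t)) (\<lambda>t. - f (p + r - t))"
proof -
  have "primitive_on (-r) (-p) (\<lambda>t. F (- t)) (\<lambda>t. - f (- t))"
    unfolding primitive_on_def
  proof (intro conjI ballI)
    show "(\<lambda>t. - f (- t)) absolutely_integrable_on {-r..-p}"
      by (rule iffD2[OF absolutely_integrable_reflect_real[where f="\<lambda>t. - f t"]])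
        (use primitive_on_absolutely_integrable[OF primitive_on_cmult[OF F, of "-1"]] in simp)
    fix x assume x: "x \<in> {-r..-p}"
    have "integral {-r..x} (\<lambda>t. f (- t)) = integral {-x..r} f"
      using Henstock_Kurzweil_Integration.integral_reflect_real[of r "-x" f] by simp
    then show "F (- x) = F (- (- r)) + integral {- r..x} (\<lambda>t. - f (- t))"
      using primitive_on_integral(1)[OF F, of "-x" r] x by simp
  qed
  from primitive_on_shift[OF this, of "- (p + r)"] show ?thesis by (simp add: add.commute[of r p])
qed

lemma negligible_reflect:
  assumes "negligible (N :: real set)"
  shows "negligible {t. c - t \<in> N}"
proof -
  have "negligible ((\<lambda>t. c - t) ` N)"
    by (rule negligible_differentiable_image_negligible[OF order_refl assms]) (auto simp: differentiable_on_def)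
  moreover have "{t. c - t \<in> N} = (\<lambda>t. c - t) ` N" by (auto intro!: image_eqI[where x="c - _"])
  ultimately show ?thesis by simp
qed

lemma negligible_shift:
  assumes "negligible (N :: real set)"
  shows "negligible {t. t + c \<in> N}"
proof -
  have "{t. t + c \<in> N} = {t. - c - t \<in> {s. 0 - s \<in> N}}" by (auto simp: add.commute)
  then show ?thesis using negligible_reflect[OF negligible_reflect[OF assms, of 0], of "- c"] by simp
qed

lemma integral_nonneg_ae:
  fixes f :: "real \<Rightarrow> real"
  assumes "f integrable_on S" "negligible N" "\<And>x. x \<in> S - N \<Longrightarrow> 0 \<le> f x"
  shows "0 \<le> integral S f"
proof -
  let ?g = "\<lambda>x. if x \<in> N then 0 else f x"
  have "integral S ?g = integral S f" by (rule integral_spike[OF assms(2)]) auto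
  moreover have "0 \<le> integral S ?g"
    using assms by (intro integral_nonneg integrable_spike[OF assms(1,2)]) auto
  ultimately show ?thesis by simp
qed

lemma ae_zero_if_integral_zero:
  fixes f :: "real \<Rightarrow> real"
  assumes f: "f absolutely_integrable_on S" and N: "negligible N"
    and nn: "\<And>x. x \<in> S - N \<Longrightarrow> 0 \<le> f x" and 0: "integral S f \<le> 0" and S: "S \<in> sets lebesgue"
  shows "\<exists>N'. negligible N' \<and> (\<forall>x\<in>S - N'. f x = 0)"
proof -
  let ?h = "\<lambda>x. indicator S x *\<^sub>R f x"
  have ae: "AE x in lebesgue. 0 \<le> ?h x"
    unfolding AE_lebesgue_iff_negligible using N nn by (intro exI[of _ N]) (auto simp: indicator_def)
  have int: "integrable lebesgue ?h" using f by (simp add: set_integrable_def)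
  have "integral S f = integral\<^sup>L lebesgue ?h"
    using set_lebesgue_integral_eq_integral(2)[OF f] by (simp add: set_lebesgue_integral_def)
  moreover have "0 \<le> integral\<^sup>L lebesgue ?h" by (rule integral_nonneg_AE[OF ae])
  ultimately have "integral\<^sup>L lebesgue ?h = 0" using 0 by simp
  then have "AE x in lebesgue. ?h x = 0"
    using integral_nonneg_eq_0_iff_AE[OF int ae] by simp
  then show ?thesis unfolding AE_lebesgue_iff_negligible by (fastforce simp: indicator_def)
qed

lemma primitive_on_nonneg:
  assumes F: "primitive_on p q F f" and N: "negligible N" and nn: "\<And>x. x \<in> {p..q} - N \<Longrightarrow> 0 \<le> f x"
    and x: "p \<le> x" "x \<le> y" "y \<le> q"
  shows "F x \<le> F y"
proof -
  have "0 \<le> integral {x..y} f"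
    using primitive_on_integrable[OF primitive_on_subinterval[OF F]] x nn
    by (intro integral_nonneg_ae[OF _ N]) auto
  then show ?thesis using primitive_on_integral(1)[OF F x] by simp
qed

lemma primitive_on_strict_mono:
  assumes F: "primitive_on p q F f" and N: "negligible N" and pos: "\<And>x. x \<in> {p..q} - N \<Longrightarrow> 0 < f x"
    and x: "p \<le> x" "x < y" "y \<le> q"
  shows "F x < F y"
proof (rule ccontr)
  assume "\<not> F x < F y"
  then have "integral {x..y} f \<le> 0" using primitive_on_integral(1)[OF F, of x y] x by simp
  moreover have "f absolutely_integrable_on {x..y}" using primitive_on_integral(2)[OF F, of x y] x by simp
  ultimately obtain N' where N': "negligible N'" "\<forall>t\<in>{x..y} - N'. f t = 0"
    using ae_zero_if_integral_zero[where f=f and S="{x..y}" and N=N] N pos x by (auto simp: less_imp_le)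
  have "t \<in> N \<union> N'" if "t \<in> {x..y}" for t
  proof (rule ccontr)
    assume "t \<notin> N \<union> N'"
    then have "f t = 0" "0 < f t" using N'(2) pos[of t] that x by auto
    then show False by simp
  qed
  then have "negligible {x..y}"
    using negligible_subset[OF negligible_Un[OF N N'(1)], of "{x..y}"] by blast
  then show False using x negligible_interval(1)[of x y] by (simp add: cbox_interval)
qed

lemma primitive_on_unique_zero:
  assumes F: "primitive_on p q F f" and N: "negligible N" and nn: "\<And>x. x \<in> {p..q} - N \<Longrightarrow> f x = 0"
    and x: "x \<in> {p..q}" "y \<in> {p..q}"
  shows "F x = F y"
proof -
  have "F x = F y" if "x \<in> {p..q}" "y \<in> {p..q}" "x \<le> y" for x y
    using primitive_on_nonneg[OF F N, of x y] primitive_on_nonneg[OF primitive_on_cmult[OF F, of "-1"] N, of x y]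
      nn that by auto
  then show ?thesis using x by (metis linear)
qed

section \<open>Scalar linear equations with integrable coefficients\<close>

text \<open>Variation of constants. The difference of two Pruefer angles satisfies an equation of this kind; the sign of
  \<open>e\<close> then gives comparison, and the size of \<open>e\<close> gives continuous dependence.\<close>
lemma linear_equation_solution:
  fixes D c e :: "real \<Rightarrow> real"
  assumes D: "primitive_on p q D (\<lambda>x. c x * D x + e x)" and c: "c absolutely_integrable_on {p..q}"
    and e: "e absolutely_integrable_on {p..q}" and x: "x \<in> {p..q}"
  shows "D x = exp (integral {p..x} c) * (D p + integral {p..x} (\<lambda>t. exp (- integral {p..t} c) * e t))"
    "(\<lambda>t. exp (- integral {p..t} c) * e t) absolutely_integrable_on {p..q}"
proof -
  let ?C = "\<lambda>x. integral {p..x} c"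
  have C: "primitive_on p q ?C c"
    using primitive_on_indefinite_integral[OF c, of 0] by simp
  have E: "primitive_on p q (\<lambda>x. exp (- ?C x)) (\<lambda>x. - c x * exp (- ?C x))"
    using primitive_on_compose[OF primitive_on_cmult[OF C, of "-1"], of exp exp]
    by (simp add: continuous_on_exp)
  have "primitive_on p q (\<lambda>x. D x * exp (- ?C x)) (\<lambda>x. exp (- ?C x) * e x)"
    by (rule primitive_on_cong[OF primitive_on_mult[OF D E] refl negligible_empty]) (simp add: algebra_simps)
  from primitive_on_integral(1)[OF this, of p x] x
  have "D x * exp (- ?C x) = D p + integral {p..x} (\<lambda>t. exp (- ?C t) * e t)" by simp
  then show "D x = exp (?C x) * (D p + integral {p..x} (\<lambda>t. exp (- ?C t) * e t))"
    by (simp add: exp_minus field_simps)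
  have "(\<lambda>x. e x * exp (- ?C x)) absolutely_integrable_on {p..q}"
    by (rule absolutely_integrable_continuous_mult[OF e primitive_on_continuous[OF E]])
  then show "(\<lambda>t. exp (- ?C t) * e t) absolutely_integrable_on {p..q}" by (simp add: mult.commute)
qed

lemma linear_equation_nonneg:
  assumes D: "primitive_on p q D (\<lambda>x. c x * D x + e x)" and c: "c absolutely_integrable_on {p..q}"
    and e: "e absolutely_integrable_on {p..q}" and x: "x \<in> {p..q}"
    and N: "negligible N" and nn: "\<And>x. x \<in> {p..q} - N \<Longrightarrow> 0 \<le> e x" and D0: "0 \<le> D p"
  shows "0 \<le> D x" "0 < D p \<Longrightarrow> 0 < D x"
    "D x \<le> 0 \<Longrightarrow> \<exists>N'. negligible N' \<and> (\<forall>t\<in>{p..x} - N'. e t = 0)"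
proof -
  note sol = linear_equation_solution[OF D c e x]
  let ?f = "\<lambda>t. exp (- integral {p..t} c) * e t"
  have f: "?f absolutely_integrable_on {p..x}"
    using sol(2) x by (auto intro: absolutely_integrable_on_subinterval)
  have i: "0 \<le> integral {p..x} ?f"
    using f nn x by (intro integral_nonneg_ae[OF _ N]) (auto simp: set_lebesgue_integral_eq_integral(1))
  show "0 \<le> D x" "0 < D p \<Longrightarrow> 0 < D x"
    using sol(1) i D0 by auto
  assume "D x \<le> 0"
  then have "integral {p..x} ?f \<le> 0"
    using sol(1) i D0 by (smt (verit, best) exp_gt_zero mult_pos_pos)
  then have "\<exists>N'. negligible N' \<and> (\<forall>t\<in>{p..x} - N'. ?f t = 0)"
    using nn x by (intro ae_zero_if_integral_zero[OF f N]) auto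
  then show "\<exists>N'. negligible N' \<and> (\<forall>t\<in>{p..x} - N'. e t = 0)" by auto
qed

lemma linear_equation_bound:
  assumes D: "primitive_on p q D (\<lambda>x. c x * D x + e x)" and c: "c absolutely_integrable_on {p..q}"
    and e: "e absolutely_integrable_on {p..q}" and x: "x \<in> {p..q}"
  shows "\<bar>D x\<bar> \<le> exp (2 * integral {p..q} (\<lambda>t. \<bar>c t\<bar>)) * (\<bar>D p\<bar> + integral {p..q} (\<lambda>t. \<bar>e t\<bar>))"
proof -
  note sol = linear_equation_solution[OF D c e x]
  let ?K = "integral {p..q} (\<lambda>t. \<bar>c t\<bar>)"
  have ca: "(\<lambda>t. \<bar>c t\<bar>) integrable_on {p..q}" and ea: "(\<lambda>t. \<bar>e t\<bar>) integrable_on {p..q}"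
    using c e by (auto simp: absolutely_integrable_on_def)
  have ci: "c integrable_on {p..q}" using c by (simp add: set_lebesgue_integral_eq_integral(1))
  have C: "\<bar>integral {p..t} c\<bar> \<le> ?K" if "t \<in> {p..q}" for t
  proof -
    have "\<bar>integral {p..t} c\<bar> \<le> integral {p..t} (\<lambda>t. \<bar>c t\<bar>)"
      using that integrable_on_subinterval[OF ci, of p t] integrable_on_subinterval[OF ca, of p t]
      by (intro integral_norm_bound_integral[of c _ "\<lambda>t. \<bar>c t\<bar>", unfolded real_norm_def]) auto
    also have "\<dots> \<le> ?K"
      using that integrable_on_subinterval[OF ca, of p t] ca by (intro integral_subset_le) auto
    finally show ?thesis .
  qed
  let ?f = "\<lambda>t. exp (- integral {p..t} c) * e t"
  have fi: "?f integrable_on {p..x}"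
    using integrable_on_subinterval[OF set_lebesgue_integral_eq_integral(1)[OF sol(2)], of p x] x by auto
  have "\<bar>integral {p..x} ?f\<bar> \<le> integral {p..x} (\<lambda>t. exp ?K * \<bar>e t\<bar>)"
  proof (intro integral_norm_bound_integral[of ?f _ "\<lambda>t. exp ?K * \<bar>e t\<bar>", unfolded real_norm_def] fi)
    show "(\<lambda>t. exp ?K * \<bar>e t\<bar>) integrable_on {p..x}"
      using integrable_on_subinterval[OF ea, of p x] x by auto
    fix t assume "t \<in> {p..x}"
    then show "\<bar>?f t\<bar> \<le> exp ?K * \<bar>e t\<bar>"
      using C[of t] x by (auto simp: abs_mult intro!: mult_right_mono)
  qed
  also have "\<dots> \<le> exp ?K * integral {p..q} (\<lambda>t. \<bar>e t\<bar>)"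
    using x integrable_on_subinterval[OF ea, of p x] ea by (auto intro!: mult_left_mono integral_subset_le)
  finally have I: "\<bar>integral {p..x} ?f\<bar> \<le> exp ?K * integral {p..q} (\<lambda>t. \<bar>e t\<bar>)" .
  have K0: "?K \<ge> 0" using ca by (intro integral_nonneg) auto
  have "\<bar>D x\<bar> = exp (integral {p..x} c) * \<bar>D p + integral {p..x} ?f\<bar>"
    by (simp add: sol(1) abs_mult)
  also have "\<dots> \<le> exp ?K * (exp ?K * \<bar>D p\<bar> + exp ?K * integral {p..q} (\<lambda>t. \<bar>e t\<bar>))"
  proof (intro mult_mono)
    show "exp (integral {p..x} c) \<le> exp ?K" using C[OF x] by simp
    have "\<bar>D p\<bar> \<le> exp ?K * \<bar>D p\<bar>" using K0 by (simp add: mult_le_cancel_right1)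
    then show "\<bar>D p + integral {p..x} ?f\<bar> \<le> exp ?K * \<bar>D p\<bar> + exp ?K * integral {p..q} (\<lambda>t. \<bar>e t\<bar>)"
      using I by linarith
  qed auto
  also have "\<dots> = exp (2 * ?K) * (\<bar>D p\<bar> + integral {p..q} (\<lambda>t. \<bar>e t\<bar>))"
    by (simp only: mult_2 exp_add) (simp add: algebra_simps)
  finally show ?thesis .
qed

section \<open>The Pruefer angle\<close>

lemma sin_square_diff: "(sin a)\<^sup>2 - (sin b)\<^sup>2 = sin (a - b) * sin (a + b)" for a b :: real
proof -
  have "sin (a - b) * sin (a + b) = (sin a)\<^sup>2 * (cos b)\<^sup>2 - (cos a)\<^sup>2 * (sin b)\<^sup>2"
    by (simp add: sin_add sin_diff power2_eq_square algebra_simps)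
  then show ?thesis by (simp add: cos_squared_eq algebra_simps)
qed

text \<open>For \<open>u = r sin \<theta>\<close>, \<open>u' = r cos \<theta>\<close> the equation \<open>u'' + q u = 0\<close> becomes
  \<open>\<theta>' = cos\<^sup>2 \<theta> + q sin\<^sup>2 \<theta>\<close>, an equation for \<open>\<theta>\<close> alone.\<close>
definition prufer_rhs :: "(real \<Rightarrow> real) \<Rightarrow> (real \<Rightarrow> real) \<Rightarrow> real \<Rightarrow> real" where
  "prufer_rhs q \<theta> t = (cos (\<theta> t))\<^sup>2 + q t * (sin (\<theta> t))\<^sup>2"

definition prufer_solution :: "real \<Rightarrow> real \<Rightarrow> (real \<Rightarrow> real) \<Rightarrow> (real \<Rightarrow> real) \<Rightarrow> bool" where
  "prufer_solution p r q \<theta> \<longleftrightarrow> primitive_on p r \<theta> (prufer_rhs q \<theta>)"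

lemma prufer_rhs_absolutely_integrable:
  assumes "q absolutely_integrable_on {p..r}" "continuous_on {p..r} \<theta>"
  shows "prufer_rhs q \<theta> absolutely_integrable_on {p..r}"
  unfolding prufer_rhs_def
  by (intro set_integral_add absolutely_integrable_continuous_mult assms absolutely_integrable_continuous_real continuous_intros)

text \<open>The Lipschitz constant in the angle is an integrable function of \<open>t\<close>; this is all that the Picard
  iteration needs.\<close>
lemma prufer_rhs_lipschitz:
  "\<bar>prufer_rhs q \<theta> t - prufer_rhs q \<psi> t\<bar> \<le> (1 + \<bar>q t\<bar>) * \<bar>\<theta> t - \<psi> t\<bar>"
proof -
  have "prufer_rhs q \<theta> t - prufer_rhs q \<psi> t = (q t - 1) * ((sin (\<theta> t))\<^sup>2 - (sin (\<psi> t))\<^sup>2)"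
    by (simp add: prufer_rhs_def cos_squared_eq algebra_simps)
  also have "\<bar>\<dots>\<bar> = \<bar>q t - 1\<bar> * (\<bar>sin (\<theta> t - \<psi> t)\<bar> * \<bar>sin (\<theta> t + \<psi> t)\<bar>)"
    by (simp add: sin_square_diff abs_mult)
  also have "\<dots> \<le> (1 + \<bar>q t\<bar>) * (\<bar>\<theta> t - \<psi> t\<bar> * 1)"
    by (intro mult_mono abs_sin_x_le_abs_x) auto
  finally show ?thesis by simp
qed

fun picard :: "(real \<Rightarrow> real) \<Rightarrow> real \<Rightarrow> real \<Rightarrow> nat \<Rightarrow> real \<Rightarrow> real" where
  "picard q p c 0 t = c"
| "picard q p c (Suc k) t = c + integral {p..t} (prufer_rhs q (picard q p c k))"

text \<open>Picard iteration. With \<open>P\<close> the integral of the Lipschitz constant \<open>w\<close>, the \<open>k\<close>-th step changes the iterate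
  by at most \<open>P\<^sup>k\<^sup>+\<^sup>1 / (k+1)!\<close>, because \<open>w P\<^sup>k / k!\<close> is the derivative of \<open>P\<^sup>k\<^sup>+\<^sup>1 / (k+1)!\<close>. Hence the iterates
  converge uniformly and the limit solves the integral equation.\<close>
lemma prufer_solution_exists:
  assumes q: "q absolutely_integrable_on {p..r}" and pr: "p \<le> r"
  shows "\<exists>\<theta>. prufer_solution p r q \<theta> \<and> \<theta> p = c"
proof -
  define Y where "Y = picard q p c"
  define w where "w t = 1 + \<bar>q t\<bar>" for t
  define P where "P t = integral {p..t} w" for t
  have w: "w absolutely_integrable_on {p..r}"
    unfolding w_def using absolutely_integrable_abs[OF q] by (intro set_integral_add) auto
  have P: "primitive_on p r P w"
    using primitive_on_indefinite_integral[OF w, of 0] by (simp add: P_def[abs_def])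
  have wi: "w integrable_on {p..t}" if "t \<in> {p..r}" for t
    using primitive_on_integrable[OF primitive_on_subinterval[OF P]] that by auto
  have P0: "P p = 0" by (simp add: P_def)
  have Pmono: "P t \<le> P s" if "p \<le> t" "t \<le> s" "s \<le> r" for t s
    by (rule primitive_on_nonneg[OF P negligible_empty _ that]) (simp add: w_def)
  have Y0: "Y 0 = (\<lambda>_. c)" and YS: "Y (Suc k) = (\<lambda>t. c + integral {p..t} (prufer_rhs q (Y k)))" for k
    by (auto simp: Y_def)
  have cont: "continuous_on {p..r} (Y k)" for k
  proof (induction k)
    case 0 then show ?case by (simp add: Y0)
  next
    case (Suc k)
    show ?case unfolding YS
      by (rule primitive_on_continuous[OF primitive_on_indefinite_integral[OF prufer_rhs_absolutely_integrable[OF q Suc]]])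
  qed
  have ri: "prufer_rhs q \<theta> integrable_on {p..t}" if "continuous_on {p..r} \<theta>" "t \<in> {p..r}" for \<theta> t
    using absolutely_integrable_on_subinterval[OF prufer_rhs_absolutely_integrable[OF q that(1)], of p t] that(2)
    by (auto intro: set_lebesgue_integral_eq_integral(1))
  have step: "\<bar>Y (Suc k) t - Y k t\<bar> \<le> P t ^ Suc k / fact (Suc k)" if "t \<in> {p..r}" for k t
    using that
  proof (induction k arbitrary: t)
    case 0
    have "\<bar>integral {p..t} (prufer_rhs q (Y 0))\<bar> \<le> integral {p..t} w"
    proof (rule integral_norm_bound_integral[of "prufer_rhs q (Y 0)" "{p..t}" w, unfolded real_norm_def])
      show "prufer_rhs q (Y 0) integrable_on {p..t}" by (rule ri[OF cont 0])
      show "w integrable_on {p..t}" by (rule wi[OF 0])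
      fix s
      have "\<bar>q s\<bar> * (sin c)\<^sup>2 \<le> \<bar>q s\<bar> * 1" by (intro mult_left_mono) (auto simp: abs_square_le_1)
      moreover have "(cos c)\<^sup>2 \<le> 1" by (simp add: abs_square_le_1)
      ultimately show "\<bar>prufer_rhs q (Y 0) s\<bar> \<le> w s"
        by (auto simp: prufer_rhs_def w_def Y0 abs_mult intro!: order_trans[OF abs_triangle_ineq] add_mono)
    qed
    then show ?case by (simp only: YS Y0 P_def) simp
  next
    case (Suc k)
    let ?h = "\<lambda>y::real. y ^ (k+2) / fact (k+2)"
    let ?h' = "\<lambda>y::real. y ^ (k+1) / fact (k+1)"
    have "(?h has_real_derivative ?h' y) (at y)" for y
      by (rule derivative_eq_intros refl | simp add: field_simps del: fact_Suc)+ (simp add: field_simps)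
    then have comp: "primitive_on p r (\<lambda>x. ?h (P x)) (\<lambda>x. w x * ?h' (P x))"
      by (intro primitive_on_compose[OF P]) (auto intro!: continuous_intros)
    have "\<bar>Y (Suc (Suc k)) t - Y (Suc k) t\<bar> = \<bar>integral {p..t} (\<lambda>s. prufer_rhs q (Y (Suc k)) s - prufer_rhs q (Y k) s)\<bar>"
      using integral_diff[OF ri[OF cont Suc.prems] ri[OF cont Suc.prems], of "Suc k" k]
        fun_cong[OF YS[of "Suc k"], of t] fun_cong[OF YS[of k], of t] by simp
    also have "\<dots> \<le> integral {p..t} (\<lambda>x. w x * ?h' (P x))"
    proof (intro integral_norm_bound_integral[of "\<lambda>s. prufer_rhs q (Y (Suc k)) s - prufer_rhs q (Y k) s" _ "\<lambda>x. w x * ?h' (P x)", unfolded real_norm_def])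
      show "(\<lambda>s. prufer_rhs q (Y (Suc k)) s - prufer_rhs q (Y k) s) integrable_on {p..t}"
        using Suc.prems by (intro integrable_diff ri cont)
      show "(\<lambda>x. w x * ?h' (P x)) integrable_on {p..t}"
        using primitive_on_integrable[OF primitive_on_subinterval[OF comp]] Suc.prems by auto
      fix s assume s: "s \<in> {p..t}"
      have "\<bar>prufer_rhs q (Y (Suc k)) s - prufer_rhs q (Y k) s\<bar> \<le> w s * \<bar>Y (Suc k) s - Y k s\<bar>"
        unfolding w_def by (rule prufer_rhs_lipschitz)
      also have "\<dots> \<le> w s * ?h' (P s)"
        using Suc.IH[of s] s Suc.prems by (intro mult_left_mono) (auto simp: w_def simp del: fact_Suc)
      finally show "\<bar>prufer_rhs q (Y (Suc k)) s - prufer_rhs q (Y k) s\<bar> \<le> w s * ?h' (P s)" .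
    qed
    also have "\<dots> = ?h (P t) - ?h (P p)"
      using primitive_on_integral(1)[OF comp, of p t] Suc.prems by simp
    finally show ?case by (simp add: P0 del: fact_Suc)
  qed
  have "uniform_limit {p..r} (\<lambda>n t. \<Sum>k<n. (Y (Suc k) t - Y k t)) (\<lambda>t. suminf (\<lambda>k. Y (Suc k) t - Y k t)) sequentially"
  proof (rule Weierstrass_m_test)
    fix k t assume t: "t \<in> {p..r}"
    have "P t ^ Suc k / fact (Suc k) \<le> P r ^ Suc k / fact (Suc k)"
      using Pmono[of p t] Pmono[of t r] t P0 by (intro divide_right_mono power_mono) auto
    then show "norm (Y (Suc k) t - Y k t) \<le> P r ^ Suc k / fact (Suc k)"
      using step[OF t, of k] by simp
  next
    have "summable (\<lambda>k. P r ^ k / fact k)"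
      using summable_exp[of "P r"] by (simp add: divide_inverse mult.commute)
    then show "summable (\<lambda>k. P r ^ Suc k / fact (Suc k))"
      by (subst summable_Suc_iff)
  qed
  moreover have "(\<Sum>k<n. (Y (Suc k) t - Y k t)) = Y n t - c" for n t
    using sum_lessThan_telescope[of "\<lambda>k. Y k t" n] by (simp add: Y0)
  ultimately have "uniform_limit {p..r} (\<lambda>n t. Y n t - c) (\<lambda>t. suminf (\<lambda>k. Y (Suc k) t - Y k t)) sequentially"
    by simp
  from uniform_limit_add[OF this uniform_limit_const[where c="\<lambda>_. c"]]
  have lim: "uniform_limit {p..r} Y (\<lambda>t. suminf (\<lambda>k. Y (Suc k) t - Y k t) + c) sequentially"
    by simp
  define \<theta> where "\<theta> t = suminf (\<lambda>k. Y (Suc k) t - Y k t) + c" for t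
  have lim: "uniform_limit {p..r} Y \<theta> sequentially" using lim by (simp add: \<theta>_def[abs_def])
  have ct: "continuous_on {p..r} \<theta>"
    by (rule uniform_limit_theorem[OF _ lim]) (auto simp: cont)
  have eq: "\<theta> t = c + integral {p..t} (prufer_rhs q \<theta>)" if t: "t \<in> {p..r}" for t
  proof -
    have "(\<lambda>n. Y (Suc n) t) \<longlonglongrightarrow> \<theta> t"
      using tendsto_uniform_limitI[OF lim t] by (rule LIMSEQ_Suc)
    moreover have "(\<lambda>n. Y (Suc n) t) \<longlonglongrightarrow> c + integral {p..t} (prufer_rhs q \<theta>)"
    proof (rule LIMSEQ_I)
      fix e :: real assume e: "e > 0"
      have Pt: "P t \<ge> 0" using Pmono[of p t] P0 t by simp
      have "\<forall>\<^sub>F n in sequentially. \<forall>s\<in>{p..r}. dist (Y n s) (\<theta> s) < e / (P t + 1)"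
        using uniform_limitD[OF lim] e Pt by simp
      then obtain K where K: "\<And>n s. n \<ge> K \<Longrightarrow> s \<in> {p..r} \<Longrightarrow> \<bar>Y n s - \<theta> s\<bar> < e / (P t + 1)"
        unfolding eventually_sequentially dist_real_def by blast
      have "\<bar>Y (Suc n) t - (c + integral {p..t} (prufer_rhs q \<theta>))\<bar> < e" if "n \<ge> K" for n
      proof -
        have "\<bar>Y (Suc n) t - (c + integral {p..t} (prufer_rhs q \<theta>))\<bar>
          = \<bar>integral {p..t} (\<lambda>s. prufer_rhs q (Y n) s - prufer_rhs q \<theta> s)\<bar>"
          using integral_diff[OF ri[OF cont t] ri[OF ct t], of n] fun_cong[OF YS[of n], of t] by simp
        also have "\<dots> \<le> integral {p..t} (\<lambda>s. (e / (P t + 1)) * w s)"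
        proof (intro integral_norm_bound_integral[of "\<lambda>s. prufer_rhs q (Y n) s - prufer_rhs q \<theta> s" _ "\<lambda>s. (e / (P t + 1)) * w s", unfolded real_norm_def])
          show "(\<lambda>s. prufer_rhs q (Y n) s - prufer_rhs q \<theta> s) integrable_on {p..t}"
            using t by (intro integrable_diff ri cont ct)
          show "(\<lambda>s. (e / (P t + 1)) * w s) integrable_on {p..t}"
            using integrable_cmul[OF wi[OF t], of "e / (P t + 1)"] by simp
          fix s assume s: "s \<in> {p..t}"
          have "\<bar>prufer_rhs q (Y n) s - prufer_rhs q \<theta> s\<bar> \<le> w s * \<bar>Y n s - \<theta> s\<bar>"
            unfolding w_def by (rule prufer_rhs_lipschitz)
          also have "\<dots> \<le> w s * (e / (P t + 1))"
            using K[OF that, of s] s t by (intro mult_left_mono) (auto simp: w_def)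
          finally show "\<bar>prufer_rhs q (Y n) s - prufer_rhs q \<theta> s\<bar> \<le> e / (P t + 1) * w s" by (simp only: mult.commute)
        qed
        also have "\<dots> = e * P t / (P t + 1)" by (simp add: P_def)
        also have "\<dots> < e" using e Pt by (simp add: field_simps)
        finally show ?thesis .
      qed
      then show "\<exists>no. \<forall>n\<ge>no. norm (Y (Suc n) t - (c + integral {p..t} (prufer_rhs q \<theta>))) < e"
        by (auto intro!: exI[of _ K])
    qed
    ultimately show ?thesis by (rule LIMSEQ_unique)
  qed
  have "\<theta> p = c" using eq[of p] pr by simp
  moreover have "prufer_solution p r q \<theta>"
    unfolding prufer_solution_def primitive_on_def
    using prufer_rhs_absolutely_integrable[OF q ct] eq \<open>\<theta> p = c\<close> by blast
  ultimately show ?thesis by blast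
qed

text \<open>The value \<open>1\<close> at \<open>0\<close> makes \<open>sinc\<close> continuous and \<open>sin x = sinc x * x\<close> valid everywhere, so that a
  difference of sines is an integrable coefficient times the difference of the angles.\<close>
definition sinc :: "real \<Rightarrow> real" where
  "sinc x = (if x = 0 then 1 else sin x / x)"

lemma sin_eq_sinc: "sin x = sinc x * x"
  by (simp add: sinc_def)

lemma abs_sinc_le: "\<bar>sinc x\<bar> \<le> 1"
  using abs_sin_x_le_abs_x[of x] by (auto simp: sinc_def field_simps)

lemma continuous_sinc: "continuous_on A sinc"
proof -
  have "isCont sinc x" for x
  proof (cases "x = 0")
    case True
    have "(\<lambda>h. (sin (0 + h) - sin 0) / h) \<midarrow>0\<rightarrow> cos (0::real)"
      using DERIV_sin[of "0::real"] unfolding DERIV_def .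
    then have "(\<lambda>h::real. sin h / h) \<midarrow>0\<rightarrow> 1" by simp
    then have "sinc \<midarrow>0\<rightarrow> 1"
      by (rule Lim_transform_eventually) (auto simp: sinc_def eventually_at_filter)
    then show ?thesis using True by (simp add: isCont_def sinc_def)
  next
    case False
    have "isCont (\<lambda>x. sin x / x) x" using False by (intro continuous_intros) auto
    moreover have "\<forall>\<^sub>F y in nhds x. sin y / y = sinc y"
      using t1_space_nhds[OF False] by eventually_elim (simp add: sinc_def)
    ultimately show ?thesis by (simp add: isCont_cong)
  qed
  then show ?thesis by (simp add: continuous_at_imp_continuous_on)
qed

lemma prufer_continuous: "prufer_solution p r q \<theta> \<Longrightarrow> continuous_on {p..r} \<theta>"
  unfolding prufer_solution_def by (rule primitive_on_continuous)

lemma prufer_subinterval: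
  "prufer_solution p r q \<theta> \<Longrightarrow> p \<le> p' \<Longrightarrow> r' \<le> r \<Longrightarrow> prufer_solution p' r' q \<theta>"
  unfolding prufer_solution_def by (rule primitive_on_subinterval)

text \<open>By \<open>sin\<^sup>2 a - sin\<^sup>2 b = sin (a - b) sin (a + b)\<close> the difference of two angles solves a linear
  equation whose inhomogeneity has the sign of \<open>q2 - q1\<close>.\<close>
lemma prufer_difference:
  assumes t1: "prufer_solution p r q1 \<theta>1" and t2: "prufer_solution p r q2 \<theta>2"
    and q1: "q1 absolutely_integrable_on {p..r}" and q2: "q2 absolutely_integrable_on {p..r}"
  obtains c where "c absolutely_integrable_on {p..r}"
    "\<And>t. \<bar>c t\<bar> \<le> 1 + \<bar>q2 t\<bar>"
    "primitive_on p r (\<lambda>t. \<theta>2 t - \<theta>1 t) (\<lambda>t. c t * (\<theta>2 t - \<theta>1 t) + (q2 t - q1 t) * (sin (\<theta>1 t))\<^sup>2)"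
    "(\<lambda>t. (q2 t - q1 t) * (sin (\<theta>1 t))\<^sup>2) absolutely_integrable_on {p..r}"
proof
  let ?c = "\<lambda>t. (q2 t - 1) * (sinc (\<theta>2 t - \<theta>1 t) * sin (\<theta>2 t + \<theta>1 t))"
  note c1 = prufer_continuous[OF t1] and c2 = prufer_continuous[OF t2]
  show "?c absolutely_integrable_on {p..r}"
    by (intro absolutely_integrable_continuous_mult set_integral_diff q2 absolutely_integrable_continuous_real
       continuous_intros c1 c2 continuous_on_compose2[OF continuous_sinc[of UNIV]]) auto
  show "(\<lambda>t. (q2 t - q1 t) * (sin (\<theta>1 t))\<^sup>2) absolutely_integrable_on {p..r}"
    by (intro absolutely_integrable_continuous_mult set_integral_diff q2 q1 continuous_intros c1)
  show "\<bar>?c t\<bar> \<le> 1 + \<bar>q2 t\<bar>" for t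
  proof -
    have "\<bar>?c t\<bar> = \<bar>q2 t - 1\<bar> * (\<bar>sinc (\<theta>2 t - \<theta>1 t)\<bar> * \<bar>sin (\<theta>2 t + \<theta>1 t)\<bar>)" by (simp add: abs_mult)
    also have "\<dots> \<le> (1 + \<bar>q2 t\<bar>) * (1 * 1)" by (intro mult_mono abs_sinc_le) auto
    finally show ?thesis by simp
  qed
  have rhs: "prufer_rhs q2 \<theta>2 t - prufer_rhs q1 \<theta>1 t = ?c t * (\<theta>2 t - \<theta>1 t) + (q2 t - q1 t) * (sin (\<theta>1 t))\<^sup>2" for t
  proof -
    have "prufer_rhs q2 \<theta>2 t - prufer_rhs q1 \<theta>1 t
        = (q2 t - 1) * ((sin (\<theta>2 t))\<^sup>2 - (sin (\<theta>1 t))\<^sup>2) + (q2 t - q1 t) * (sin (\<theta>1 t))\<^sup>2"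
      by (simp add: prufer_rhs_def cos_squared_eq algebra_simps)
    also have "(sin (\<theta>2 t))\<^sup>2 - (sin (\<theta>1 t))\<^sup>2 = sinc (\<theta>2 t - \<theta>1 t) * (\<theta>2 t - \<theta>1 t) * sin (\<theta>2 t + \<theta>1 t)"
      by (simp only: sin_square_diff sin_eq_sinc[of "\<theta>2 t - \<theta>1 t"])
    finally show ?thesis by (simp add: algebra_simps)
  qed
  show "primitive_on p r (\<lambda>t. \<theta>2 t - \<theta>1 t) (\<lambda>t. ?c t * (\<theta>2 t - \<theta>1 t) + (q2 t - q1 t) * (sin (\<theta>1 t))\<^sup>2)"
    using primitive_on_diff[OF t2[unfolded prufer_solution_def] t1[unfolded prufer_solution_def]]
    unfolding rhs .
qed

text \<open>Sturm comparison. The last part describes the case of equality: then the inhomogeneity of the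
  linear equation for the difference vanishes.\<close>
lemma prufer_comparison:
  assumes t1: "prufer_solution p r q1 \<theta>1" and t2: "prufer_solution p r q2 \<theta>2"
    and q1: "q1 absolutely_integrable_on {p..r}" and q2: "q2 absolutely_integrable_on {p..r}"
    and N: "negligible N" and le: "\<And>t. t \<in> {p..r} - N \<Longrightarrow> q1 t \<le> q2 t"
    and init: "\<theta>1 p \<le> \<theta>2 p" and x: "x \<in> {p..r}"
  shows "\<theta>1 x \<le> \<theta>2 x" "\<theta>1 p < \<theta>2 p \<Longrightarrow> \<theta>1 x < \<theta>2 x"
    "\<theta>2 x \<le> \<theta>1 x \<Longrightarrow> \<exists>N'. negligible N' \<and> (\<forall>t\<in>{p..x} - N'. q1 t = q2 t \<or> sin (\<theta>1 t) = 0)"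
proof -
  obtain c where c: "c absolutely_integrable_on {p..r}" and "\<And>t. \<bar>c t\<bar> \<le> 1 + \<bar>q2 t\<bar>"
    and D: "primitive_on p r (\<lambda>t. \<theta>2 t - \<theta>1 t) (\<lambda>t. c t * (\<theta>2 t - \<theta>1 t) + (q2 t - q1 t) * (sin (\<theta>1 t))\<^sup>2)"
    and e: "(\<lambda>t. (q2 t - q1 t) * (sin (\<theta>1 t))\<^sup>2) absolutely_integrable_on {p..r}"
    by (rule prufer_difference[OF t1 t2 q1 q2]) (rule that)
  have nn: "0 \<le> (q2 t - q1 t) * (sin (\<theta>1 t))\<^sup>2" if "t \<in> {p..r} - N" for t
    using le[OF that] by simp
  have D0: "0 \<le> \<theta>2 p - \<theta>1 p" using init by simp
  note L = linear_equation_nonneg[OF D c e x N nn D0]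
  show "\<theta>1 x \<le> \<theta>2 x" "\<theta>1 p < \<theta>2 p \<Longrightarrow> \<theta>1 x < \<theta>2 x" using L(1,2) by auto
  assume "\<theta>2 x \<le> \<theta>1 x"
  then have "\<exists>N'. negligible N' \<and> (\<forall>t\<in>{p..x} - N'. (q2 t - q1 t) * (sin (\<theta>1 t))\<^sup>2 = 0)" using L(3) by simp
  then show "\<exists>N'. negligible N' \<and> (\<forall>t\<in>{p..x} - N'. q1 t = q2 t \<or> sin (\<theta>1 t) = 0)" by force
qed

lemma prufer_dependence:
  assumes t1: "prufer_solution p r q1 \<theta>1" and t2: "prufer_solution p r q2 \<theta>2"
    and q1: "q1 absolutely_integrable_on {p..r}" and q2: "q2 absolutely_integrable_on {p..r}"
    and x: "x \<in> {p..r}"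
  shows "\<bar>\<theta>2 x - \<theta>1 x\<bar> \<le> exp (2 * integral {p..r} (\<lambda>t. 1 + \<bar>q2 t\<bar>))
            * (\<bar>\<theta>2 p - \<theta>1 p\<bar> + integral {p..r} (\<lambda>t. \<bar>q2 t - q1 t\<bar>))"
proof -
  obtain c where c: "c absolutely_integrable_on {p..r}" and cb: "\<And>t. \<bar>c t\<bar> \<le> 1 + \<bar>q2 t\<bar>"
    and D: "primitive_on p r (\<lambda>t. \<theta>2 t - \<theta>1 t) (\<lambda>t. c t * (\<theta>2 t - \<theta>1 t) + (q2 t - q1 t) * (sin (\<theta>1 t))\<^sup>2)"
    and e: "(\<lambda>t. (q2 t - q1 t) * (sin (\<theta>1 t))\<^sup>2) absolutely_integrable_on {p..r}"
    by (rule prufer_difference[OF t1 t2 q1 q2]) (rule that)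
  have ia: "(\<lambda>t. \<bar>c t\<bar>) integrable_on {p..r}" "(\<lambda>t. 1 + \<bar>q2 t\<bar>) integrable_on {p..r}"
     "(\<lambda>t. \<bar>q2 t - q1 t\<bar>) integrable_on {p..r}" "(\<lambda>t. \<bar>(q2 t - q1 t) * (sin (\<theta>1 t))\<^sup>2\<bar>) integrable_on {p..r}"
    using c q2 set_integral_diff(1)[OF q2 q1] e
    by (auto simp: absolutely_integrable_on_def intro!: integrable_add)
  have "\<bar>\<theta>2 x - \<theta>1 x\<bar> \<le> exp (2 * integral {p..r} (\<lambda>t. \<bar>c t\<bar>))
      * (\<bar>\<theta>2 p - \<theta>1 p\<bar> + integral {p..r} (\<lambda>t. \<bar>(q2 t - q1 t) * (sin (\<theta>1 t))\<^sup>2\<bar>))"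
    by (rule linear_equation_bound[OF D c e x])
  also have "\<dots> \<le> exp (2 * integral {p..r} (\<lambda>t. 1 + \<bar>q2 t\<bar>))
            * (\<bar>\<theta>2 p - \<theta>1 p\<bar> + integral {p..r} (\<lambda>t. \<bar>q2 t - q1 t\<bar>))"
  proof (rule mult_mono)
    show "exp (2 * integral {p..r} (\<lambda>t. \<bar>c t\<bar>)) \<le> exp (2 * integral {p..r} (\<lambda>t. 1 + \<bar>q2 t\<bar>))"
      using integral_le[OF ia(1,2) cb] by simp
    have "\<bar>(q2 t - q1 t) * (sin (\<theta>1 t))\<^sup>2\<bar> \<le> \<bar>q2 t - q1 t\<bar>" for t
      unfolding abs_mult by (intro mult_left_le) (auto simp: abs_square_le_1)
    from integral_le[OF ia(4,3) this] show "\<bar>\<theta>2 p - \<theta>1 p\<bar> + integral {p..r} (\<lambda>t. \<bar>(q2 t - q1 t) * (sin (\<theta>1 t))\<^sup>2\<bar>)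
      \<le> \<bar>\<theta>2 p - \<theta>1 p\<bar> + integral {p..r} (\<lambda>t. \<bar>q2 t - q1 t\<bar>)" by simp
    show "0 \<le> \<bar>\<theta>2 p - \<theta>1 p\<bar> + integral {p..r} (\<lambda>t. \<bar>(q2 t - q1 t) * (sin (\<theta>1 t))\<^sup>2\<bar>)"
      by (intro add_nonneg_nonneg integral_nonneg ia) auto
  qed auto
  finally show ?thesis .
qed

lemma prufer_unique:
  assumes "prufer_solution p r q \<theta>1" "prufer_solution p r q \<theta>2" "q absolutely_integrable_on {p..r}"
    and "\<theta>1 p = \<theta>2 p" "x \<in> {p..r}"
  shows "\<theta>1 x = \<theta>2 x"
  using prufer_dependence[OF assms(1,2,3,3,5)] assms(4) by simp

lemma cos_sin_add_of_int_pi: "(cos (x + of_int k * pi))\<^sup>2 = (cos x)\<^sup>2" "(sin (x + of_int k * pi))\<^sup>2 = (sin x)\<^sup>2" for x :: real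
proof -
  have s: "sin (of_int k * pi) = 0" by (simp add: sin_zero_iff_int2)
  have c: "(cos (of_int k * pi))\<^sup>2 = (1::real)" using s by (simp add: cos_squared_eq)
  show "(cos (x + of_int k * pi))\<^sup>2 = (cos x)\<^sup>2" "(sin (x + of_int k * pi))\<^sup>2 = (sin x)\<^sup>2"
    by (simp_all add: cos_add sin_add s power_mult_distrib c)
qed

lemma prufer_add_of_int_pi:
  assumes "prufer_solution p r q \<theta>"
  shows "prufer_solution p r q (\<lambda>t. \<theta> t + of_int k * pi)"
proof -
  have "prufer_rhs q (\<lambda>t. \<theta> t + of_int k * pi) = prufer_rhs q \<theta>"
    by (simp add: prufer_rhs_def fun_eq_iff cos_sin_add_of_int_pi)
  then show ?thesis
    using primitive_on_add[OF assms[unfolded prufer_solution_def] primitive_on_const[of p r "of_int k * pi"]]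
    by (simp add: prufer_solution_def)
qed

text \<open>At a multiple of \<open>\<pi>\<close> the right-hand side is \<open>1\<close> whatever \<open>q\<close> is: the difference of \<open>\<theta>\<close> and \<open>k \<pi>\<close> solves
  \<open>D' = c D + 1\<close>.\<close>
lemma prufer_crosses_upward:
  assumes \<theta>: "prufer_solution p r q \<theta>" and q: "q absolutely_integrable_on {p..r}"
    and s: "p \<le> s" "s < x" "x \<le> r" and ge: "\<theta> s \<ge> of_int k * pi"
  shows "\<theta> x > of_int k * pi"
proof -
  define \<psi> where "\<psi> t = \<theta> t + of_int (- k) * pi" for t
  have \<psi>: "prufer_solution s r q \<psi>"
    unfolding \<psi>_def[abs_def] using s by (intro prufer_add_of_int_pi prufer_subinterval[OF \<theta>]) auto
  have q': "q absolutely_integrable_on {s..r}" using q s by (auto intro: absolutely_integrable_on_subinterval)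
  define c where "c t = (q t - 1) * (sinc (\<psi> t) * sin (\<psi> t))" for t
  note cp = prufer_continuous[OF \<psi>]
  have c: "c absolutely_integrable_on {s..r}"
    unfolding c_def by (intro absolutely_integrable_continuous_mult set_integral_diff q' absolutely_integrable_continuous_real
       continuous_intros cp continuous_on_compose2[OF continuous_sinc[of UNIV]]) auto
  have "prufer_rhs q \<psi> = (\<lambda>t. c t * \<psi> t + 1)"
  proof
    fix t
    have "prufer_rhs q \<psi> t = (q t - 1) * (sin (\<psi> t) * sin (\<psi> t)) + 1"
      by (simp add: prufer_rhs_def cos_squared_eq algebra_simps power2_eq_square)
    also have "\<dots> = (q t - 1) * (sinc (\<psi> t) * \<psi> t * sin (\<psi> t)) + 1" by (simp only: sin_eq_sinc[of "\<psi> t"])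
    finally show "prufer_rhs q \<psi> t = c t * \<psi> t + 1" by (simp add: c_def algebra_simps)
  qed
  then have D: "primitive_on s r \<psi> (\<lambda>t. c t * \<psi> t + 1)"
    using \<psi> by (simp add: prufer_solution_def)
  have "\<not> \<psi> x \<le> 0"
  proof
    assume "\<psi> x \<le> 0"
    then have "\<exists>N'. negligible N' \<and> (\<forall>t\<in>{s..x} - N'. (1::real) = 0)"
      using s ge linear_equation_nonneg(3)[OF D c _ _ negligible_empty, of x] by (auto simp: \<psi>_def)
    then have "negligible {s..x}" by (metis DiffI negligible_subset subsetI zero_neq_one)
    then show False using s negligible_interval(1)[of s x] by (simp add: cbox_interval)
  qed
  then show ?thesis by (simp add: \<psi>_def)
qed

text \<open>Each level \<open>k \<pi>\<close> is taken at most once, so the set is countable.\<close>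
lemma prufer_zeros_negligible:
  assumes \<theta>: "prufer_solution p r q \<theta>" and q: "q absolutely_integrable_on {p..r}"
  shows "negligible {t \<in> {p..r}. sin (\<theta> t) = 0}"
proof -
  have "{t \<in> {p..r}. sin (\<theta> t) = 0} \<subseteq> (\<Union>k::int. {t \<in> {p..r}. \<theta> t = of_int k * pi})"
    by (auto simp: sin_zero_iff_int2)
  moreover have "countable {t \<in> {p..r}. \<theta> t = of_int k * pi}" for k
  proof -
    have "t = t'" if "t \<in> {p..r}" "t' \<in> {p..r}" "\<theta> t = of_int k * pi" "\<theta> t' = of_int k * pi" for t t'
      using prufer_crosses_upward[OF \<theta> q, of t t' k] prufer_crosses_upward[OF \<theta> q, of t' t k] that
      by (cases t t' rule: linorder_cases) auto
    then have "{t \<in> {p..r}. \<theta> t = of_int k * pi} = {} \<or> (\<exists>t. {t \<in> {p..r}. \<theta> t = of_int k * pi} = {t})" by blast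
    then show ?thesis by (metis countable_empty countable_insert)
  qed
  ultimately have "countable {t \<in> {p..r}. sin (\<theta> t) = 0}"
    by (meson countable_UN countable_subset countableI_type)
  then show ?thesis by (simp add: negligible_iff_null_sets countable_imp_null_set_lborel null_sets_completionI)
qed

text \<open>Equality at the end would force \<open>(q2 - q1) sin\<^sup>2 \<theta>1 = 0\<close> almost everywhere, while \<open>sin \<theta>1\<close> vanishes only on
  a null set.\<close>
lemma prufer_strict_comparison:
  assumes t1: "prufer_solution p r q1 \<theta>1" and t2: "prufer_solution p r q2 \<theta>2"
    and q1: "q1 absolutely_integrable_on {p..r}" and q2: "q2 absolutely_integrable_on {p..r}"
    and N: "negligible N" and le: "\<And>t. t \<in> {p..r} - N \<Longrightarrow> q1 t \<le> q2 t"
    and lt: "\<not> negligible {t \<in> {p..r}. q1 t \<noteq> q2 t}"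
    and init: "\<theta>1 p \<le> \<theta>2 p" and pr: "p \<le> r"
  shows "\<theta>1 r < \<theta>2 r"
proof (rule ccontr)
  assume "\<not> \<theta>1 r < \<theta>2 r"
  then obtain N' where N': "negligible N'" "\<forall>t\<in>{p..r} - N'. q1 t = q2 t \<or> sin (\<theta>1 t) = 0"
    using prufer_comparison(3)[OF t1 t2 q1 q2 N le init, of r] pr by auto
  then have "{t \<in> {p..r}. q1 t \<noteq> q2 t} \<subseteq> N' \<union> {t \<in> {p..r}. sin (\<theta>1 t) = 0}" by auto
  then have "negligible {t \<in> {p..r}. q1 t \<noteq> q2 t}"
    using negligible_Un[OF N'(1) prufer_zeros_negligible[OF t1 q1]] negligible_subset by blast
  with lt show False by simp
qed

section \<open>The linear equation in polar coordinates\<close>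

definition solves :: "real \<Rightarrow> real \<Rightarrow> (real \<Rightarrow> real) \<Rightarrow> (real \<Rightarrow> real) \<Rightarrow> (real \<Rightarrow> real) \<Rightarrow> bool" where
  "solves p r q u v \<longleftrightarrow> primitive_on p r u v \<and> primitive_on p r v (\<lambda>t. - q t * u t)"

lemma antiper_solution_iff_solves:
  assumes q: "q absolutely_integrable_on {0..T}"
  shows "antiper_solution T q u v \<longleftrightarrow> solves 0 T q u v \<and> u 0 + u T = 0 \<and> v 0 + v T = 0"
proof
  assume A: "antiper_solution T q u v"
  then have der: "\<And>x. x \<in> {0..T} \<Longrightarrow> (u has_real_derivative v x) (at x within {0..T})"
    and ac: "abs_cont_on v 0 T" and bc: "u 0 + u T = 0 \<and> v 0 + v T = 0"
    and "AE x in lebesgue. x \<in> {0<..<T} \<longrightarrow> (\<exists>w. (v has_real_derivative w) (at x) \<and> w + q x * u x = 0)"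
    by (auto simp: antiper_solution_def)
  then obtain N where N: "negligible N"
    "\<And>x. x \<notin> N \<Longrightarrow> x \<in> {0<..<T} \<Longrightarrow> (\<exists>w. (v has_real_derivative w) (at x) \<and> w + q x * u x = 0)"
    unfolding AE_lebesgue_iff_negligible by blast
  have uc: "continuous_on {0..T} u"
    using der by (meson DERIV_continuous continuous_on_eq_continuous_within)
  have v: "primitive_on 0 T v (\<lambda>t. - q t * u t)"
  proof (rule primitive_onI_abs_cont[OF ac N(1)])
    show "(\<lambda>t. - q t * u t) absolutely_integrable_on {0..T}"
      using absolutely_integrable_continuous_mult[OF q continuous_on_minus[OF uc]] by simp
    fix x assume "x \<in> {0<..<T} - N"
    then obtain w where "(v has_real_derivative w) (at x)" "w + q x * u x = 0" using N(2) by blast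
    moreover from this have "w = - q x * u x" by simp
    ultimately show "(v has_real_derivative - q x * u x) (at x)" by simp
  qed
  have "primitive_on 0 T u v" by (rule primitive_on_classical[OF der primitive_on_continuous[OF v]])
  with v bc show "solves 0 T q u v \<and> u 0 + u T = 0 \<and> v 0 + v T = 0" by (simp add: solves_def)
next
  assume A: "solves 0 T q u v \<and> u 0 + u T = 0 \<and> v 0 + v T = 0"
  then have u: "primitive_on 0 T u v" and v: "primitive_on 0 T v (\<lambda>t. - q t * u t)" by (auto simp: solves_def)
  obtain N where N: "negligible N" "\<And>x. x \<in> {0<..<T} - N \<Longrightarrow> (v has_real_derivative (- q x * u x)) (at x)"
    using primitive_on_has_derivative_ae[OF v] by blast
  have "AE x in lebesgue. x \<in> {0<..<T} \<longrightarrow> (\<exists>w. (v has_real_derivative w) (at x) \<and> w + q x * u x = 0)"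
    unfolding AE_lebesgue_iff_negligible using N by (intro exI[of _ N]) force
  then show "antiper_solution T q u v"
    using A primitive_on_derivative_within[OF u primitive_on_continuous[OF v]] indefinite_integral_abs_cont[OF v]
    by (auto simp: antiper_solution_def)
qed

lemma solves_subinterval: "solves p r q u v \<Longrightarrow> p \<le> p' \<Longrightarrow> r' \<le> r \<Longrightarrow> solves p' r' q u v"
  unfolding solves_def using primitive_on_subinterval by blast

lemma solves_continuous: "solves p r q u v \<Longrightarrow> continuous_on {p..r} u" "solves p r q u v \<Longrightarrow> continuous_on {p..r} v"
  unfolding solves_def using primitive_on_continuous by blast+

lemma solves_cmult:
  assumes "solves p r q u v" shows "solves p r q (\<lambda>t. c * u t) (\<lambda>t. c * v t)"
  using assms primitive_on_cmult[of p r u v c] primitive_on_cmult[of p r v "\<lambda>t. - q t * u t" c]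
  by (simp add: solves_def mult.left_commute)

lemma solves_add:
  assumes "solves p r q u v" "solves p r q u' v'"
  shows "solves p r q (\<lambda>t. u t + u' t) (\<lambda>t. v t + v' t)"
  using assms primitive_on_add[of p r u v u' v'] primitive_on_add[of p r v "\<lambda>t. - q t * u t" v' "\<lambda>t. - q t * u' t"]
  by (simp add: solves_def algebra_simps)

lemma solves_cong:
  assumes "solves p r q u v" "\<And>t. t \<in> {p..r} \<Longrightarrow> u t = u' t" "\<And>t. t \<in> {p..r} \<Longrightarrow> v t = v' t"
    and N: "negligible N" and "\<And>t. t \<in> {p..r} - N \<Longrightarrow> q t = q' t"
  shows "solves p r q' u' v'"
  unfolding solves_def
proof
  show "primitive_on p r u' v'"
    by (rule primitive_on_cong[OF _ assms(2) negligible_empty assms(3)]) (use assms in \<open>auto simp: solves_def\<close>)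
  show "primitive_on p r v' (\<lambda>t. - q' t * u' t)"
    by (rule primitive_on_cong[of p r v "\<lambda>t. - q t * u t", OF _ assms(3) N])
      (use assms in \<open>auto simp: solves_def\<close>)
qed

lemma solves_combine:
  assumes "solves p q a u v" "solves q r a u v" "p \<le> q" "q \<le> r"
  shows "solves p r a u v"
  using assms primitive_on_combine unfolding solves_def by blast

lemma solves_sinusoid:
  "solves p r (\<lambda>_. k\<^sup>2) (\<lambda>t. A * sin (k * (t - c))) (\<lambda>t. A * k * cos (k * (t - c)))"
  unfolding solves_def
  by (intro conjI primitive_on_classical)
    (auto intro!: derivative_eq_intros continuous_intros simp: field_simps power2_eq_square)

lemma solves_cosinusoid:
  "solves p r (\<lambda>_. k\<^sup>2) (\<lambda>t. A * cos (k * (t - c))) (\<lambda>t. - A * k * sin (k * (t - c)))"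
  unfolding solves_def
  by (intro conjI primitive_on_classical)
    (auto intro!: derivative_eq_intros continuous_intros simp: field_simps power2_eq_square)

text \<open>This identity for two different coefficients carries the comparison with \<open>sin (w t)\<close>; for equal
  coefficients it says that the Wronskian is constant.\<close>
lemma wronskian_primitive:
  assumes "solves p r q u v" "solves p r q' w z"
  shows "primitive_on p r (\<lambda>t. u t * z t - v t * w t) (\<lambda>t. (q t - q' t) * (u t * w t))"
proof -
  have A: "primitive_on p r (\<lambda>t. u t * z t) (\<lambda>t. v t * z t + (- q' t * w t) * u t)"
    using assms by (intro primitive_on_mult) (auto simp: solves_def)
  have B: "primitive_on p r (\<lambda>t. v t * w t) (\<lambda>t. (- q t * u t) * w t + z t * v t)"
    using assms by (intro primitive_on_mult) (auto simp: solves_def)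
  show ?thesis
    by (rule primitive_on_cong[OF primitive_on_diff[OF A B] refl negligible_empty]) (simp add: algebra_simps)
qed

lemma wronskian_constant:
  assumes "solves p r q u v" "solves p r q w z" "x \<in> {p..r}"
  shows "u x * z x - v x * w x = u p * z p - v p * w p"
  using primitive_on_unique_zero[OF wronskian_primitive[OF assms(1,2)] negligible_empty, of x p] assms(3) by auto

definition amplitude :: "real \<Rightarrow> (real \<Rightarrow> real) \<Rightarrow> (real \<Rightarrow> real) \<Rightarrow> real \<Rightarrow> real" where
  "amplitude p q \<theta> t = exp (integral {p..t} (\<lambda>s. (1 - q s) * (sin (\<theta> s) * cos (\<theta> s))))"

lemma amplitude_pos: "amplitude p q \<theta> t > 0"
  by (simp add: amplitude_def)

lemma amplitude_start: "amplitude p q \<theta> p = 1"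
  by (simp add: amplitude_def)

text \<open>With the amplitude \<open>r\<close> determined by \<open>r' = (1 - q) r sin \<theta> cos \<theta>\<close>, the Pruefer angle provides the solutions
  of the linear equation, so that no separate existence theorem is needed.\<close>
lemma prufer_solves:
  assumes \<theta>: "prufer_solution p r q \<theta>" and q: "q absolutely_integrable_on {p..r}"
  shows "solves p r q (\<lambda>t. amplitude p q \<theta> t * sin (\<theta> t)) (\<lambda>t. amplitude p q \<theta> t * cos (\<theta> t))"
proof -
  let ?g = "\<lambda>s. (1 - q s) * (sin (\<theta> s) * cos (\<theta> s))"
  let ?A = "amplitude p q \<theta>"
  note c = prufer_continuous[OF \<theta>]
  have g: "?g absolutely_integrable_on {p..r}"
    by (intro absolutely_integrable_continuous_mult set_integral_diff q absolutely_integrable_continuous_real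
       continuous_intros c)
  have "primitive_on p r (\<lambda>t. integral {p..t} ?g) ?g"
    using primitive_on_indefinite_integral[OF g, of 0] by simp
  then have A: "primitive_on p r ?A (\<lambda>t. ?g t * ?A t)"
    unfolding amplitude_def[abs_def] by (rule primitive_on_compose) (auto simp: DERIV_exp continuous_on_exp)
  have S: "primitive_on p r (\<lambda>t. sin (\<theta> t)) (\<lambda>t. prufer_rhs q \<theta> t * cos (\<theta> t))"
    by (rule primitive_on_compose[OF \<theta>[unfolded prufer_solution_def]]) (auto intro!: continuous_intros)
  have C: "primitive_on p r (\<lambda>t. cos (\<theta> t)) (\<lambda>t. prufer_rhs q \<theta> t * - sin (\<theta> t))"
    by (rule primitive_on_compose[OF \<theta>[unfolded prufer_solution_def]]) (auto intro!: continuous_intros)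
  have id1: "(1 - Q) * (s * c) * A * s + (c\<^sup>2 + Q * s\<^sup>2) * c * A = A * c * (s\<^sup>2 + c\<^sup>2)"
    and id2: "(1 - Q) * (s * c) * A * c + (c\<^sup>2 + Q * s\<^sup>2) * - s * A = - Q * (A * s) * (s\<^sup>2 + c\<^sup>2)" for Q A s c :: real
    by algebra+
  have 1: "?g t * ?A t * sin (\<theta> t) + prufer_rhs q \<theta> t * cos (\<theta> t) * ?A t = ?A t * cos (\<theta> t)" for t
  proof -
    have "?g t * ?A t * sin (\<theta> t) + prufer_rhs q \<theta> t * cos (\<theta> t) * ?A t
      = ?A t * cos (\<theta> t) * ((sin (\<theta> t))\<^sup>2 + (cos (\<theta> t))\<^sup>2)"
      unfolding prufer_rhs_def by (rule id1)
    then show ?thesis by simp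
  qed
  have 2: "?g t * ?A t * cos (\<theta> t) + prufer_rhs q \<theta> t * - sin (\<theta> t) * ?A t = - q t * (?A t * sin (\<theta> t))" for t
  proof -
    have "?g t * ?A t * cos (\<theta> t) + prufer_rhs q \<theta> t * - sin (\<theta> t) * ?A t
      = - q t * (?A t * sin (\<theta> t)) * ((sin (\<theta> t))\<^sup>2 + (cos (\<theta> t))\<^sup>2)"
      unfolding prufer_rhs_def by (rule id2)
    then show ?thesis by simp
  qed
  show ?thesis
    unfolding solves_def
    using primitive_on_cong[OF primitive_on_mult[OF A S] refl negligible_empty 1]
      primitive_on_cong[OF primitive_on_mult[OF A C] refl negligible_empty 2] by blast
qed

text \<open>The Wronskians with two independent Pruefer solutions vanish.\<close>
lemma solves_zero:
  assumes S: "solves p r q u v" and q: "q absolutely_integrable_on {p..r}"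
    and 0: "u p = 0" "v p = 0" and x: "x \<in> {p..r}"
  shows "u x = 0" "v x = 0"
proof -
  have pr: "p \<le> r" using x by simp
  obtain \<theta> where \<theta>: "prufer_solution p r q \<theta>" "\<theta> p = 0" using prufer_solution_exists[OF q pr] by blast
  obtain \<psi> where \<psi>: "prufer_solution p r q \<psi>" "\<psi> p = pi/2" using prufer_solution_exists[OF q pr] by blast
  define a b where "a = amplitude p q \<theta> x" and "b = amplitude p q \<psi> x"
  note s1 = prufer_solves[OF \<theta>(1) q] and s2 = prufer_solves[OF \<psi>(1) q]
  have "u x * (a * cos (\<theta> x)) - v x * (a * sin (\<theta> x)) = 0"
    using wronskian_constant[OF S s1 x] 0 by (simp add: a_def)
  moreover have "u x * (b * cos (\<psi> x)) - v x * (b * sin (\<psi> x)) = 0"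
    using wronskian_constant[OF S s2 x] 0 by (simp add: b_def)
  moreover have "(a * sin (\<theta> x)) * (b * cos (\<psi> x)) - (a * cos (\<theta> x)) * (b * sin (\<psi> x)) = -1"
    using wronskian_constant[OF s1 s2 x] \<theta>(2) \<psi>(2) by (simp add: a_def b_def amplitude_start)
  ultimately show "u x = 0" "v x = 0" by algebra+
qed

lemma solves_unique:
  assumes "solves p r q u v" "solves p r q u' v'" and q: "q absolutely_integrable_on {p..r}"
    and "u p = u' p" "v p = v' p" and x: "x \<in> {p..r}"
  shows "u x = u' x" "v x = v' x"
  using solves_zero[OF solves_add[OF assms(1) solves_cmult[OF assms(2), of "-1"]] q] assms(4-) by auto

lemma solves_polar:
  assumes S: "solves p r q u v" and q: "q absolutely_integrable_on {p..r}"
    and \<theta>: "prufer_solution p r q \<theta>" and init: "u p = \<rho> * sin (\<theta> p)" "v p = \<rho> * cos (\<theta> p)" and x: "x \<in> {p..r}"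
  shows "u x = \<rho> * amplitude p q \<theta> x * sin (\<theta> x)" "v x = \<rho> * amplitude p q \<theta> x * cos (\<theta> x)"
  using solves_unique[OF S solves_cmult[OF prufer_solves[OF \<theta> q], of \<rho>] q _ _ x] init
  by (auto simp: amplitude_start)

section \<open>The turn of the angle over a period\<close>

definition prufer_angle :: "real \<Rightarrow> (real \<Rightarrow> real) \<Rightarrow> real \<Rightarrow> real \<Rightarrow> real" where
  "prufer_angle T q c = (SOME \<theta>. prufer_solution 0 T q \<theta> \<and> \<theta> 0 = c)"

definition turn :: "real \<Rightarrow> (real \<Rightarrow> real) \<Rightarrow> real \<Rightarrow> real" where
  "turn T q c = prufer_angle T q c T - c"

definition growth :: "real \<Rightarrow> (real \<Rightarrow> real) \<Rightarrow> real \<Rightarrow> real" where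
  "growth T q c = amplitude 0 q (prufer_angle T q c) T"

locale coefficient =
  fixes T :: real and q :: "real \<Rightarrow> real"
  assumes T: "T > 0" and q: "q absolutely_integrable_on {0..T}"
begin

lemma angle: "prufer_solution 0 T q (prufer_angle T q c)" "prufer_angle T q c 0 = c"
  using someI_ex[OF prufer_solution_exists[OF q, of c]] T unfolding prufer_angle_def by auto

lemma turn_eqI:
  assumes "prufer_solution 0 T q \<theta>"
  shows "turn T q (\<theta> 0) = \<theta> T - \<theta> 0"
  using prufer_unique[OF angle(1) assms q, of "\<theta> 0" T] T by (simp add: turn_def angle)

lemma turn_add_of_int_pi: "turn T q (c + of_int k * pi) = turn T q c"
  using turn_eqI[OF prufer_add_of_int_pi[OF angle(1)[of c], of k]] by (simp add: angle turn_def)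

lemma turn_strict_mono: "c < d \<Longrightarrow> c + turn T q c < d + turn T q d"
  using prufer_comparison(2)[OF angle(1) angle(1) q q negligible_empty, of c d T] T
  by (simp add: angle turn_def)

text \<open>The map from initial to final angle is increasing and commutes with the shift by \<open>\<pi>\<close>.\<close>
lemma turn_close: "\<bar>turn T q c - turn T q d\<bar> < pi"
proof -
  have *: "\<bar>turn T q c - turn T q d\<bar> < pi" if "c \<le> d" "d < c + pi" for c d
  proof (cases "c = d")
    case False
    then have "c + turn T q c < d + turn T q d" "d + turn T q d < (c + pi) + turn T q (c + pi)"
      using that turn_strict_mono by auto
    moreover have "turn T q (c + pi) = turn T q c" using turn_add_of_int_pi[of c 1] by simp
    ultimately show ?thesis using that by auto
  qed simp
  define k where "k = \<lfloor>(d - c) / pi\<rfloor>"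
  have "of_int k \<le> (d - c) / pi" "(d - c) / pi < of_int k + 1" by (auto simp: k_def)
  then have "c + of_int k * pi \<le> d" "d < c + of_int k * pi + pi" by (auto simp: field_simps)
  from *[OF this] show ?thesis by (simp add: turn_add_of_int_pi)
qed

lemma growth_pos: "growth T q c > 0"
  by (simp add: growth_def amplitude_pos)

lemma turn_gt: "turn T q c > - pi"
proof -
  have "turn T q 0 > 0"
    using prufer_crosses_upward[OF angle(1) q, of 0 T 0 0] T by (simp add: angle turn_def)
  then show ?thesis using turn_close[of c 0] by simp
qed

lemma endpoint_polar:
  assumes "solves 0 T q u v" "u 0 = \<rho> * sin c" "v 0 = \<rho> * cos c"
  shows "u T = \<rho> * growth T q c * sin (c + turn T q c)" "v T = \<rho> * growth T q c * cos (c + turn T q c)"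
  using solves_polar[OF assms(1) q angle(1)[of c], of \<rho> T] assms(2,3) T by (auto simp: angle turn_def growth_def)

text \<open>The linear structure in polar form: the solution with initial angle \<open>c + y\<close> is \<open>cos y\<close> times the
  one with initial angle \<open>c\<close> plus \<open>sin y\<close> times the one with initial angle \<open>c + \<pi>/2\<close>.\<close>
lemma superposition:
  shows "growth T q (c + y) * sin (c + y + turn T q (c + y))
      = cos y * (growth T q c * sin (c + turn T q c))
        + sin y * (growth T q (c + pi/2) * sin (c + pi/2 + turn T q (c + pi/2)))" (is ?s)
    "growth T q (c + y) * cos (c + y + turn T q (c + y))
      = cos y * (growth T q c * cos (c + turn T q c))
        + sin y * (growth T q (c + pi/2) * cos (c + pi/2 + turn T q (c + pi/2)))" (is ?c)
proof -
  let ?U = "\<lambda>c t. amplitude 0 q (prufer_angle T q c) t * sin (prufer_angle T q c t)"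
  let ?V = "\<lambda>c t. amplitude 0 q (prufer_angle T q c) t * cos (prufer_angle T q c t)"
  have S: "solves 0 T q (\<lambda>t. cos y * ?U c t + sin y * ?U (c + pi/2) t) (\<lambda>t. cos y * ?V c t + sin y * ?V (c + pi/2) t)"
    by (intro solves_add solves_cmult prufer_solves angle q)
  have "?U (c + y) T = cos y * ?U c T + sin y * ?U (c + pi/2) T \<and> ?V (c + y) T = cos y * ?V c T + sin y * ?V (c + pi/2) T"
    using solves_unique[OF prufer_solves[OF angle(1)[of "c + y"] q] S q, of T] T
    by (simp add: angle amplitude_start sin_add cos_add algebra_simps)
  then show ?s ?c by (auto simp: growth_def turn_def)
qed

lemma wronskian_growth:
  "growth T q c * growth T q d * sin (c + turn T q c - (d + turn T q d)) = sin (c - d)"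
  using wronskian_constant[OF prufer_solves[OF angle(1)[of c] q] prufer_solves[OF angle(1)[of d] q], of T] T
  by (simp add: angle amplitude_start sin_diff growth_def turn_def algebra_simps)

end

section \<open>Extremal turns and antiperiodic directions\<close>

definition odd_pi :: "real \<Rightarrow> bool" where
  "odd_pi x \<longleftrightarrow> (\<exists>k::int. x = (2 * of_int k + 1) * pi)"

lemma odd_pi_iff_cos: "odd_pi x \<longleftrightarrow> cos x = -1"
  unfolding odd_pi_def cos_eq_minus1 by (simp add: mult.commute algebra_simps)

lemma odd_pi_sin_cos:
  assumes "odd_pi w"
  shows "sin (x + w) = - sin x" "cos (x + w) = - cos x"
proof -
  have c: "cos w = -1" using assms by (simp add: odd_pi_iff_cos)
  then have "sin w = 0" using sin_cos_squared_add[of w] by simp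
  then show "sin (x + w) = - sin x" "cos (x + w) = - cos x" using c by (simp_all add: sin_add cos_add)
qed

lemma odd_pi_close:
  assumes "odd_pi x" "odd_pi y" "\<bar>x - y\<bar> < 2 * pi"
  shows "x = y"
proof -
  obtain j k :: int where "x = (2 * of_int j + 1) * pi" "y = (2 * of_int k + 1) * pi"
    using assms(1,2) by (auto simp: odd_pi_def)
  then have eq: "x - y = of_int (j - k) * (2 * pi)" by (simp add: algebra_simps)
  then have "\<bar>real_of_int (j - k)\<bar> * (2 * pi) < 1 * (2 * pi)" using assms(3) by (simp add: abs_mult)
  then have "\<bar>real_of_int (j - k)\<bar> < 1" by (subst (asm) mult_less_cancel_right) auto
  then have "j = k" by linarith
  then show ?thesis using eq by simp
qed

text \<open>In polar coordinates, antiperiodicity is a condition on the turn together with one on the amplitude.\<close>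
lemma antiperiodic_direction:
  fixes R d \<tau> :: real
  assumes "R > 0" "R * sin (d + \<tau>) = - sin d" "R * cos (d + \<tau>) = - cos d"
  shows "R = 1" "odd_pi \<tau>"
proof -
  have "R\<^sup>2 * ((sin (d + \<tau>))\<^sup>2 + (cos (d + \<tau>))\<^sup>2) = (R * sin (d + \<tau>))\<^sup>2 + (R * cos (d + \<tau>))\<^sup>2"
    by (simp only: power_mult_distrib distrib_left)
  also have "\<dots> = (sin d)\<^sup>2 + (cos d)\<^sup>2" using assms by simp
  finally have "R\<^sup>2 = 1" by simp
  then show R: "R = 1" using assms(1) by (simp add: power2_eq_1_iff)
  have s: "sin (d + \<tau>) = - sin d" and c: "cos (d + \<tau>) = - cos d" using assms(2,3) R by simp_all
  have "cos ((d + \<tau>) - d) = cos (d + \<tau>) * cos d + sin (d + \<tau>) * sin d" by (rule cos_diff)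
  also have "\<dots> = - ((cos d)\<^sup>2 + (sin d)\<^sup>2)" using s c by algebra
  finally have "cos \<tau> = -1" by simp
  then show "odd_pi \<tau>" by (simp add: odd_pi_iff_cos)
qed

definition max_turn :: "real \<Rightarrow> (real \<Rightarrow> real) \<Rightarrow> real" where
  "max_turn T q = Sup (turn T q ` {0..pi})"

definition min_turn :: "real \<Rightarrow> (real \<Rightarrow> real) \<Rightarrow> real" where
  "min_turn T q = Inf (turn T q ` {0..pi})"

context coefficient
begin

lemma dependence_bound_ex:
  obtains K where "K > 0" "\<And>c d t. t \<in> {0..T} \<Longrightarrow> \<bar>prufer_angle T q c t - prufer_angle T q d t\<bar> \<le> K * \<bar>c - d\<bar>"
proof
  show "exp (2 * integral {0..T} (\<lambda>t. 1 + \<bar>q t\<bar>)) > 0" by simp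
  show "\<bar>prufer_angle T q c t - prufer_angle T q d t\<bar> \<le> exp (2 * integral {0..T} (\<lambda>t. 1 + \<bar>q t\<bar>)) * \<bar>c - d\<bar>"
    if "t \<in> {0..T}" for c d t
    using prufer_dependence[OF angle(1)[of d] angle(1)[of c] q q that] by (simp add: angle)
qed

lemma continuous_turn: "continuous_on A (turn T q)"
proof -
  obtain K where K: "K > 0" "\<And>c d t. t \<in> {0..T} \<Longrightarrow> \<bar>prufer_angle T q c t - prufer_angle T q d t\<bar> \<le> K * \<bar>c - d\<bar>"
    using dependence_bound_ex by blast
  have "(K + 1)-lipschitz_on A (turn T q)"
    using K(1) K(2)[of T] T by (intro lipschitz_onI) (auto simp: turn_def dist_real_def algebra_simps intro: order_trans[OF abs_triangle_ineq4] add_mono, smt (verit))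
  then show ?thesis by (rule lipschitz_on_continuous_on)
qed

lemma turn_reduce: "\<exists>d\<in>{0..pi}. turn T q c = turn T q d"
proof
  let ?k = "- \<lfloor>c / pi\<rfloor>"
  have "of_int \<lfloor>c / pi\<rfloor> * pi \<le> c / pi * pi" "c / pi * pi < (of_int \<lfloor>c / pi\<rfloor> + 1) * pi"
    by (intro mult_right_mono mult_strict_right_mono; linarith?; simp)+
  then have "of_int \<lfloor>c / pi\<rfloor> * pi \<le> c" "c < of_int \<lfloor>c / pi\<rfloor> * pi + pi"
    by (simp_all add: distrib_right)
  then show "c + of_int ?k * pi \<in> {0..pi}" by auto
  show "turn T q c = turn T q (c + of_int ?k * pi)" by (rule turn_add_of_int_pi[symmetric])
qed

lemma max_turn: obtains c where "turn T q c = max_turn T q" "\<And>d. turn T q d \<le> turn T q c"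
proof -
  obtain c where c: "c \<in> {0..pi}" "\<And>d. d \<in> {0..pi} \<Longrightarrow> turn T q d \<le> turn T q c"
    using continuous_attains_sup[of "{0..pi}" "turn T q"] continuous_turn by auto
  have "max_turn T q = turn T q c"
    unfolding max_turn_def using c by (intro cSup_eq_maximum) auto
  moreover have "turn T q d \<le> turn T q c" for d using turn_reduce[of d] c(2) by auto
  ultimately show thesis using that by metis
qed

lemma min_turn: obtains c where "turn T q c = min_turn T q" "\<And>d. turn T q c \<le> turn T q d"
proof -
  obtain c where c: "c \<in> {0..pi}" "\<And>d. d \<in> {0..pi} \<Longrightarrow> turn T q c \<le> turn T q d"
    using continuous_attains_inf[of "{0..pi}" "turn T q"] continuous_turn by auto
  have "min_turn T q = turn T q c"
    unfolding min_turn_def using c by (intro cInf_eq_minimum) auto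
  moreover have "turn T q c \<le> turn T q d" for d using turn_reduce[of d] c(2) by auto
  ultimately show thesis using that by metis
qed

lemma turn_le_max: "turn T q c \<le> max_turn T q" by (metis max_turn)
lemma min_le_turn: "min_turn T q \<le> turn T q c" by (metis min_turn)

lemma max_min_close: "min_turn T q \<le> max_turn T q" "max_turn T q - min_turn T q < pi" "min_turn T q > - pi"
proof -
  obtain c d where c: "turn T q c = max_turn T q" and d: "turn T q d = min_turn T q"
    using max_turn min_turn by metis
  show "min_turn T q \<le> max_turn T q" by (rule order_trans[OF min_le_turn turn_le_max])
  show "max_turn T q - min_turn T q < pi" using turn_close[of c d] c d by auto
  show "min_turn T q > - pi" using turn_gt[of d] d by simp
qed

text \<open>The monodromy matrix seen from a direction \<open>c\<close> that it maps to a negative multiple of itself. In the basis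
  of the directions \<open>c\<close> and \<open>c + \<pi>/2\<close> it is triangular with eigenvalues \<open>- R\<close> and \<open>- 1 / R\<close>, where \<open>R\<close> is
  the growth at \<open>c\<close>, since its determinant is \<open>1\<close> by constancy of the Wronskian; \<open>\<alpha>\<close> is the
  off-diagonal entry.\<close>
lemma turn_near_odd_pi:
  assumes w: "odd_pi (turn T q c)"
  obtains \<alpha> where "\<And>y. growth T q (c + y) * sin (turn T q (c + y) - turn T q c)
      = sin y * ((1 / growth T q c - growth T q c) * cos y + \<alpha> * sin y)"
proof -
  define R where "R = growth T q c"
  define A1 where "A1 = growth T q (c + pi/2) * sin (c + pi/2 + turn T q (c + pi/2))"
  define B1 where "B1 = growth T q (c + pi/2) * cos (c + pi/2 + turn T q (c + pi/2))"
  have R: "R > 0" by (simp add: R_def growth_pos)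
  have e: "sin (c + turn T q c) = - sin c" "cos (c + turn T q c) = - cos c"
    by (rule odd_pi_sin_cos[OF w])+
  have "growth T q c * growth T q (c + pi/2) * sin (c + turn T q c - (c + pi/2 + turn T q (c + pi/2))) = -1"
    using wronskian_growth[of c "c + pi/2"] by simp
  then have W: "R * (sin c * B1 - cos c * A1) = 1"
    by (simp only: sin_diff e) (simp add: R_def A1_def B1_def algebra_simps)
  have "growth T q (c + y) * sin (turn T q (c + y) - turn T q c)
      = sin y * ((1 / R - R) * cos y + (A1 * sin c + B1 * cos c) * sin y)" for y
  proof -
    let ?t = "turn T q (c + y)" and ?g = "growth T q (c + y)"
    have A: "?g * sin (c + y + ?t) = cos y * (R * - sin c) + sin y * A1"
      and B: "?g * cos (c + y + ?t) = cos y * (R * - cos c) + sin y * B1"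
      using superposition[of c y] unfolding e R_def A1_def B1_def by simp_all
    have "sin (?t - turn T q c) = - sin (?t - turn T q c + turn T q c)"
      using odd_pi_sin_cos(1)[OF w, of "?t - turn T q c"] by simp
    also have "\<dots> = - sin ((c + y + ?t) - (c + y))" by simp
    also have "\<dots> = cos (c + y + ?t) * sin (c + y) - sin (c + y + ?t) * cos (c + y)"
      by (simp only: sin_diff)
    finally have sd: "sin (?t - turn T q c) = cos (c + y + ?t) * sin (c + y) - sin (c + y + ?t) * cos (c + y)" .
    have "?g * sin (?t - turn T q c) = (?g * cos (c + y + ?t)) * sin (c + y) - (?g * sin (c + y + ?t)) * cos (c + y)"
      unfolding sd by (simp only: right_diff_distrib mult.assoc)
    also have "\<dots> = (cos y * (R * - cos c) + sin y * B1) * (sin c * cos y + cos c * sin y)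
        - (cos y * (R * - sin c) + sin y * A1) * (cos c * cos y - sin c * sin y)"
      unfolding A B sin_add[of c y] cos_add[of c y] ..
    also have "\<dots> = sin y * (- R * ((sin c)\<^sup>2 + (cos c)\<^sup>2) * cos y + (sin c * B1 - cos c * A1) * cos y + (A1 * sin c + B1 * cos c) * sin y)"
      by algebra
    also have "sin c * B1 - cos c * A1 = 1 / R" using W R by (simp add: field_simps)
    finally show ?thesis by (simp add: algebra_simps)
  qed
  then show thesis using that[of "A1 * sin c + B1 * cos c"] by (simp add: R_def)
qed

lemma sin_sign_turn_diff:
  "0 \<le> sin (turn T q c - turn T q d) \<longleftrightarrow> turn T q d \<le> turn T q c"
  "sin (turn T q c - turn T q d) = 0 \<longleftrightarrow> turn T q d = turn T q c"
proof -
  have "\<bar>turn T q c - turn T q d\<bar> < pi" by (rule turn_close)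
  moreover have "0 \<le> sin x \<longleftrightarrow> 0 \<le> x" "sin x = 0 \<longleftrightarrow> x = 0" if "\<bar>x\<bar> < pi" for x
    using sin_gt_zero[of x] sin_gt_zero[of "-x"] that by (cases x "0::real" rule: linorder_cases; force)+
  ultimately show "0 \<le> sin (turn T q c - turn T q d) \<longleftrightarrow> turn T q d \<le> turn T q c"
    "sin (turn T q c - turn T q d) = 0 \<longleftrightarrow> turn T q d = turn T q c" by auto
qed

text \<open>If \<open>R \<noteq> 1\<close>, the right-hand side of the previous formula changes sign with \<open>y\<close> at \<open>0\<close>, so that the turn
  takes larger and smaller values near \<open>c\<close>.\<close>
lemma growth_at_extremum:
  assumes w: "odd_pi (turn T q c)"
    and ext: "(\<forall>d. turn T q d \<le> turn T q c) \<or> (\<forall>d. turn T q c \<le> turn T q d)"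
  shows "growth T q c = 1"
proof -
  define R where "R = growth T q c"
  have R: "R > 0" by (simp add: R_def growth_pos)
  obtain \<alpha> where f: "\<And>y. growth T q (c + y) * sin (turn T q (c + y) - turn T q c) = sin y * ((1 / R - R) * cos y + \<alpha> * sin y)"
    using turn_near_odd_pi[OF w] unfolding R_def by blast
  define f where "f y = (1 / R - R) * cos y + \<alpha> * sin y" for y
  have f: "growth T q (c + y) * sin (turn T q (c + y) - turn T q c) = sin y * f y" for y
    using f[of y] by (simp only: f_def)
  have "f 0 = 0"
  proof (rule ccontr)
    assume "f 0 \<noteq> 0"
    then have pos: "0 < f 0 * f 0" by (metis not_real_square_gt_zero)
    have "((\<lambda>y. f 0 * f y) \<longlongrightarrow> f 0 * f 0) (at 0)"
      unfolding f_def by (intro tendsto_intros)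
    from order_tendstoD(1)[OF this pos] have "\<forall>\<^sub>F y in at 0. f 0 * f y > 0" .
    then obtain e where e: "e > 0" "\<And>y. y \<noteq> 0 \<Longrightarrow> \<bar>y\<bar> < e \<Longrightarrow> f 0 * f y > 0"
      unfolding eventually_at by (auto simp: dist_real_def)
    (* The bound 1 < \<pi> keeps sin y positive. *)
    define y where "y = min (e/2) 1"
    have y: "0 < y" "y < e" "y < pi" using e(1) pi_gt3 by (auto simp: y_def)
    then have s: "sin y > 0" by (intro sin_gt_zero)
    have "f 0 * f y > 0" "f 0 * f (-y) > 0" using e(2)[of y] e(2)[of "-y"] y by auto
    then have opp: "f y * f (-y) > 0" by (auto simp: zero_less_mult_iff)
    have "sgn (sin (turn T q (c + y) - turn T q c)) = sgn (f y)"
      "sgn (sin (turn T q (c + - y) - turn T q c)) = - sgn (f (-y))"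
      using arg_cong[OF f[of y], of sgn] arg_cong[OF f[of "-y"], of sgn] s growth_pos
      by (auto simp: sgn_mult sgn_1_pos sgn_minus)
    moreover have "(0 \<le> sin (turn T q (c + y) - turn T q c) \<and> 0 \<le> sin (turn T q (c + - y) - turn T q c))
      \<or> (sin (turn T q (c + y) - turn T q c) \<le> 0 \<and> sin (turn T q (c + - y) - turn T q c) \<le> 0)"
      using ext sin_sign_turn_diff(1)[of "c + y" c] sin_sign_turn_diff(1)[of "c + - y" c]
        sin_sign_turn_diff(1)[of c "c + y"] sin_sign_turn_diff(1)[of c "c + - y"]
        sin_minus[of "turn T q (c + y) - turn T q c"] sin_minus[of "turn T q (c + - y) - turn T q c"]
      by (auto simp: minus_diff_eq)
    ultimately show False using opp by (auto simp: zero_less_mult_iff sgn_if split: if_splits)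
  qed
  then have "R * R = 1" using R by (simp add: f_def field_simps)
  then show ?thesis using R by (simp add: R_def power2_eq_1_iff flip: power2_eq_square)
qed

lemma turn_near_eigendirection:
  assumes w: "odd_pi (turn T q c)" and g: "growth T q c = 1"
  obtains \<alpha> where "\<And>y. growth T q (c + y) * sin (turn T q (c + y) - turn T q c) = \<alpha> * (sin y)\<^sup>2"
  using turn_near_odd_pi[OF w] g by (auto simp: power2_eq_square) (metis mult.left_commute)

text \<open>For growth \<open>1\<close> the formula reduces to \<open>\<alpha> sin\<^sup>2 y\<close>, which does not change sign.\<close>
lemma eigendirection_extremal:
  assumes w: "odd_pi (turn T q c)" and g: "growth T q c = 1"
  shows "turn T q c = max_turn T q \<or> turn T q c = min_turn T q"
proof -
  obtain \<alpha> where f: "\<And>y. growth T q (c + y) * sin (turn T q (c + y) - turn T q c) = \<alpha> * (sin y)\<^sup>2"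
    using turn_near_eigendirection[OF w g] by blast
  show ?thesis
  proof (cases "\<alpha> \<ge> 0")
    case True
    have "turn T q c \<le> turn T q d" for d
    proof -
      have "0 \<le> growth T q d * sin (turn T q d - turn T q c)"
        using f[of "d - c"] True by simp
      then show ?thesis using growth_pos[of d] sin_sign_turn_diff(1)[of d c] by (simp add: zero_le_mult_iff)
    qed
    then have "turn T q c = min_turn T q" by (metis min_turn min_le_turn order_antisym)
    then show ?thesis ..
  next
    case False
    have "turn T q d \<le> turn T q c" for d
    proof -
      have "growth T q d * sin (turn T q d - turn T q c) \<le> 0"
        using f[of "d - c"] False by (simp add: mult_le_0_iff)
      then have "0 \<le> sin (turn T q c - turn T q d)"
        using growth_pos[of d] sin_minus[of "turn T q d - turn T q c"] by (simp add: mult_le_0_iff)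
      then show ?thesis using sin_sign_turn_diff(1)[of c d] by simp
    qed
    then have "turn T q c = max_turn T q" by (metis max_turn turn_le_max order_antisym)
    then show ?thesis ..
  qed
qed

text \<open>A second antiperiodic direction forces \<open>\<alpha> = 0\<close>; then the monodromy matrix is minus the identity.\<close>
lemma two_eigendirections:
  assumes w: "odd_pi (turn T q c)" and g: "growth T q c = 1"
    and d: "turn T q d = turn T q c" "sin (d - c) \<noteq> 0"
  shows "max_turn T q = min_turn T q"
proof -
  obtain \<alpha> where f: "\<And>y. growth T q (c + y) * sin (turn T q (c + y) - turn T q c) = \<alpha> * (sin y)\<^sup>2"
    using turn_near_eigendirection[OF w g] by blast
  have "\<alpha> = 0" using f[of "d - c"] d by simp
  then have "turn T q e = turn T q c" for e
    using f[of "e - c"] growth_pos[of e] sin_sign_turn_diff(2)[of e c] by simp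
  then show ?thesis by (metis max_turn min_turn)
qed

end

section \<open>Dependence of the extremal turns on the coefficient\<close>

lemma turn_mono_coefficient:
  assumes c1: "coefficient T q1" and c2: "coefficient T q2"
    and N: "negligible N" and le: "\<And>t. t \<in> {0..T} - N \<Longrightarrow> q1 t \<le> q2 t"
  shows "turn T q1 c \<le> turn T q2 c"
    "\<not> negligible {t \<in> {0..T}. q1 t \<noteq> q2 t} \<Longrightarrow> turn T q1 c < turn T q2 c"
proof -
  interpret c1: coefficient T q1 by (rule c1)
  interpret c2: coefficient T q2 by (rule c2)
  note th = c1.angle(1)[of c] c2.angle(1)[of c] c1.q c2.q N le
  show "turn T q1 c \<le> turn T q2 c"
    using prufer_comparison(1)[OF th, of T] c1.T by (simp add: c1.angle c2.angle turn_def)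
  show "turn T q1 c < turn T q2 c" if "\<not> negligible {t \<in> {0..T}. q1 t \<noteq> q2 t}"
    using prufer_strict_comparison[OF th that] c1.T by (simp add: c1.angle c2.angle turn_def)
qed

lemma extremal_turn_mono:
  assumes c1: "coefficient T q1" and c2: "coefficient T q2"
    and N: "negligible N" and le: "\<And>t. t \<in> {0..T} - N \<Longrightarrow> q1 t \<le> q2 t"
  shows "max_turn T q1 \<le> max_turn T q2" "min_turn T q1 \<le> min_turn T q2"
    "\<not> negligible {t \<in> {0..T}. q1 t \<noteq> q2 t} \<Longrightarrow> max_turn T q1 < max_turn T q2"
    "\<not> negligible {t \<in> {0..T}. q1 t \<noteq> q2 t} \<Longrightarrow> min_turn T q1 < min_turn T q2"
proof -
  interpret c1: coefficient T q1 by (rule c1)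
  interpret c2: coefficient T q2 by (rule c2)
  obtain c where c: "turn T q1 c = max_turn T q1" using c1.max_turn by metis
  obtain d where d: "turn T q2 d = min_turn T q2" using c2.min_turn by metis
  note m = turn_mono_coefficient[OF c1 c2 N le]
  show "max_turn T q1 \<le> max_turn T q2" using m(1)[of c] c2.turn_le_max[of c] c by simp
  show "min_turn T q1 \<le> min_turn T q2" using m(1)[of d] c1.min_le_turn[of d] d by simp
  assume "\<not> negligible {t \<in> {0..T}. q1 t \<noteq> q2 t}"
  then show "max_turn T q1 < max_turn T q2" "min_turn T q1 < min_turn T q2"
    using m(2)[of c] c2.turn_le_max[of c] c m(2)[of d] c1.min_le_turn[of d] d by simp_all
qed

lemma extremal_turn_dependence:
  assumes c1: "coefficient T q1" and c2: "coefficient T q2"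
  shows "\<bar>max_turn T q2 - max_turn T q1\<bar> \<le> exp (2 * integral {0..T} (\<lambda>t. 1 + \<bar>q2 t\<bar>)) * integral {0..T} (\<lambda>t. \<bar>q2 t - q1 t\<bar>)"
    "\<bar>min_turn T q2 - min_turn T q1\<bar> \<le> exp (2 * integral {0..T} (\<lambda>t. 1 + \<bar>q2 t\<bar>)) * integral {0..T} (\<lambda>t. \<bar>q2 t - q1 t\<bar>)"
proof -
  interpret c1: coefficient T q1 by (rule c1)
  interpret c2: coefficient T q2 by (rule c2)
  define B where "B = exp (2 * integral {0..T} (\<lambda>t. 1 + \<bar>q2 t\<bar>)) * integral {0..T} (\<lambda>t. \<bar>q2 t - q1 t\<bar>)"
  have b: "\<bar>turn T q2 c - turn T q1 c\<bar> \<le> B" for c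
    using prufer_dependence[OF c1.angle(1)[of c] c2.angle(1)[of c] c1.q c2.q, of T] c1.T
    by (simp add: c1.angle c2.angle turn_def B_def)
  obtain c where c: "turn T q1 c = max_turn T q1" using c1.max_turn by metis
  obtain d where d: "turn T q1 d = min_turn T q1" using c1.min_turn by metis
  obtain c' where c': "turn T q2 c' = max_turn T q2" using c2.max_turn by metis
  obtain d' where d': "turn T q2 d' = min_turn T q2" using c2.min_turn by metis
  have "\<bar>max_turn T q2 - max_turn T q1\<bar> \<le> B"
    using b[of c] b[of c'] c c' c1.turn_le_max[of c'] c2.turn_le_max[of c] by linarith
  moreover have "\<bar>min_turn T q2 - min_turn T q1\<bar> \<le> B"
    using b[of d] b[of d'] d d' c1.min_le_turn[of d'] c2.min_le_turn[of d] by linarith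
  ultimately show "\<bar>max_turn T q2 - max_turn T q1\<bar> \<le> exp (2 * integral {0..T} (\<lambda>t. 1 + \<bar>q2 t\<bar>)) * integral {0..T} (\<lambda>t. \<bar>q2 t - q1 t\<bar>)"
    "\<bar>min_turn T q2 - min_turn T q1\<bar> \<le> exp (2 * integral {0..T} (\<lambda>t. 1 + \<bar>q2 t\<bar>)) * integral {0..T} (\<lambda>t. \<bar>q2 t - q1 t\<bar>)"
    by (simp_all add: B_def)
qed

section \<open>Multiplicity of an antiperiodic eigenvalue\<close>

text \<open>Extended by \<open>0\<close> outside \<open>{0..T}\<close>, as the members of the eigenspaces are.\<close>
definition eigenfunction :: "real \<Rightarrow> (real \<Rightarrow> real) \<Rightarrow> real \<Rightarrow> real \<Rightarrow> real" where
  "eigenfunction T q c t =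
     (if t \<in> {0..T} then amplitude 0 q (prufer_angle T q c) t * sin (prufer_angle T q c t) else 0)"

context coefficient
begin

lemma eigenfunction_antiperiodic:
  assumes "odd_pi (turn T q c)" "growth T q c = 1"
  shows "\<exists>v. antiper_solution T q (eigenfunction T q c) v"
proof
  let ?v = "\<lambda>t. amplitude 0 q (prufer_angle T q c) t * cos (prufer_angle T q c t)"
  have S: "solves 0 T q (eigenfunction T q c) ?v"
    by (rule solves_cong[OF prufer_solves[OF angle(1)[of c] q] _ _ negligible_empty]) (auto simp: eigenfunction_def)
  have "eigenfunction T q c 0 = 1 * sin c" "?v 0 = 1 * cos c"
    using T by (auto simp: eigenfunction_def amplitude_start angle)
  from endpoint_polar[OF S this] this show "antiper_solution T q (eigenfunction T q c) ?v"
    unfolding antiper_solution_iff_solves[OF q] using S assms odd_pi_sin_cos[OF assms(1)] by auto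
qed

lemma eigenfunction_superposition:
  "eigenfunction T q (c + y) t = cos y * eigenfunction T q c t + sin y * eigenfunction T q (c + pi/2) t"
proof (cases "t \<in> {0..T}")
  case True
  let ?U = "\<lambda>c t. amplitude 0 q (prufer_angle T q c) t * sin (prufer_angle T q c t)"
  let ?V = "\<lambda>c t. amplitude 0 q (prufer_angle T q c) t * cos (prufer_angle T q c t)"
  have S: "solves 0 T q (\<lambda>t. cos y * ?U c t + sin y * ?U (c + pi/2) t) (\<lambda>t. cos y * ?V c t + sin y * ?V (c + pi/2) t)"
    by (intro solves_add solves_cmult prufer_solves angle q)
  have "?U (c + y) t = cos y * ?U c t + sin y * ?U (c + pi/2) t"
    using solves_unique(1)[OF prufer_solves[OF angle(1)[of "c + y"] q] S q, of t] True
    by (simp add: angle amplitude_start sin_add cos_add algebra_simps)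
  then show ?thesis using True by (simp add: eigenfunction_def)
next
  case False
  then have "(t \<in> {0..T}) = False" by simp
  then show ?thesis by (simp only: eigenfunction_def if_False mult_zero_right add_0)
qed

lemma nontrivial_eigenfunction: "nontrivial T (eigenfunction T q c)"
proof (rule ccontr)
  assume "\<not> nontrivial T (eigenfunction T q c)"
  then have "{0..T} \<subseteq> {t \<in> {0..T}. sin (prufer_angle T q c t) = 0}"
    using amplitude_pos[of 0 q "prufer_angle T q c"] by (auto simp: nontrivial_def eigenfunction_def less_le)
  then have "negligible {0..T}" using prufer_zeros_negligible[OF angle(1) q] negligible_subset by blast
  then show False using T negligible_interval(1)[of 0 T] by (simp add: cbox_interval)
qed

lemma antiperiodic_solution_cases:
  assumes "antiper_solution T q u v"
  obtains \<rho> c where "u 0 = \<rho> * sin c" "v 0 = \<rho> * cos c" "\<And>t. t \<in> {0..T} \<Longrightarrow> u t = \<rho> * eigenfunction T q c t"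
    "\<rho> \<noteq> 0 \<Longrightarrow> odd_pi (turn T q c)" "\<rho> \<noteq> 0 \<Longrightarrow> growth T q c = 1"
proof -
  have S: "solves 0 T q u v" and bc: "u 0 + u T = 0" "v 0 + v T = 0"
    using assms antiper_solution_iff_solves[OF q] by auto
  obtain \<rho> c where p: "v 0 = \<rho> * cos c" "u 0 = \<rho> * sin c" using polar_Ex[of "v 0" "u 0"] by blast
  have t: "u t = \<rho> * eigenfunction T q c t" if "t \<in> {0..T}" for t
    using solves_polar(1)[OF S q angle(1)[of c], of \<rho> t] p that by (simp add: angle eigenfunction_def)
  have "odd_pi (turn T q c) \<and> growth T q c = 1" if "\<rho> \<noteq> 0"
  proof -
    have "\<rho> * (growth T q c * sin (c + turn T q c)) = \<rho> * (- sin c)"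
      "\<rho> * (growth T q c * cos (c + turn T q c)) = \<rho> * (- cos c)"
      using endpoint_polar[OF S p(2,1)] bc p by (simp_all add: mult.assoc)
    then have "growth T q c * sin (c + turn T q c) = - sin c" "growth T q c * cos (c + turn T q c) = - cos c"
      using that by (simp_all only: mult_cancel_left)  simp_all
    then show ?thesis using antiperiodic_direction[OF growth_pos[of c], of c "turn T q c"] by simp
  qed
  then show thesis using that p t by metis
qed

lemma antiper_eigenvalue_iff_extremal:
  "(\<exists>u v. antiper_solution T q u v \<and> nontrivial T u) \<longleftrightarrow> odd_pi (max_turn T q) \<or> odd_pi (min_turn T q)"
proof
  assume "\<exists>u v. antiper_solution T q u v \<and> nontrivial T u"
  then obtain u v where A: "antiper_solution T q u v" and nt: "nontrivial T u" by blast
  obtain \<rho> c where 1: "u 0 = \<rho> * sin c" "v 0 = \<rho> * cos c" "\<And>t. t \<in> {0..T} \<Longrightarrow> u t = \<rho> * eigenfunction T q c t"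
    and 2: "\<rho> \<noteq> 0 \<Longrightarrow> odd_pi (turn T q c)" "\<rho> \<noteq> 0 \<Longrightarrow> growth T q c = 1"
    using antiperiodic_solution_cases[OF A] by blast
  have "\<rho> \<noteq> 0" using nt 1(3) by (auto simp: nontrivial_def)
  then show "odd_pi (max_turn T q) \<or> odd_pi (min_turn T q)"
    using 2 eigendirection_extremal[of c] by auto
next
  assume A: "odd_pi (max_turn T q) \<or> odd_pi (min_turn T q)"
  obtain c where c: "odd_pi (turn T q c)" "growth T q c = 1"
    using A max_turn min_turn growth_at_extremum by metis
  then show "\<exists>u v. antiper_solution T q u v \<and> nontrivial T u"
    using eigenfunction_antiperiodic nontrivial_eigenfunction by blast
qed

end

text \<open>If both extremal turns are odd multiples of \<open>\<pi>\<close>, they coincide because they differ by less than \<open>\<pi>\<close>, every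
  direction is antiperiodic and the eigenspace has dimension \<open>2\<close>. If exactly one is, there is exactly one
  antiperiodic direction.\<close>
lemma antiper_mult_eq:
  assumes "coefficient T (\<lambda>x. \<mu> + a x)"
  shows "antiper_mult T a \<mu> = of_bool (odd_pi (max_turn T (\<lambda>x. \<mu> + a x))) + of_bool (odd_pi (min_turn T (\<lambda>x. \<mu> + a x)))"
proof -
  define q where "q = (\<lambda>x. \<mu> + a x)"
  interpret coefficient T q using assms by (simp add: q_def)
  interpret fs: vector_space "\<lambda>(c::real) (f::real \<Rightarrow> real) x. c * f x" by (rule vector_space_real_fun)
  define E where "E = antiper_eigenspace T a \<mu>"
  let ?e = "eigenfunction T q"
  have E: "E = {u. (\<forall>x. x \<notin> {0..T} \<longrightarrow> u x = 0) \<and> (\<exists>v. antiper_solution T q u v)}"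
    by (simp add: E_def antiper_eigenspace_def q_def)
  have rep: "\<exists>\<rho> c. u = (\<lambda>t. \<rho> * ?e c t) \<and> (\<rho> \<noteq> 0 \<longrightarrow> odd_pi (turn T q c) \<and> growth T q c = 1)" if u: "u \<in> E" for u
  proof -
    obtain v where v: "antiper_solution T q u v" using u E by auto
    obtain \<rho> c where 1: "u 0 = \<rho> * sin c" "v 0 = \<rho> * cos c" "\<And>t. t \<in> {0..T} \<Longrightarrow> u t = \<rho> * eigenfunction T q c t"
      and 2: "\<rho> \<noteq> 0 \<Longrightarrow> odd_pi (turn T q c)" "\<rho> \<noteq> 0 \<Longrightarrow> growth T q c = 1"
      using antiperiodic_solution_cases[OF v] by blast
    have "u t = \<rho> * ?e c t" for t
      using u 1(3)[of t] by (cases "t \<in> {0..T}") (auto simp: E eigenfunction_def)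
    then show ?thesis using 2 by (intro exI[of _ \<rho>] exI[of _ c]) auto
  qed
  have mem: "?e c \<in> E" if "odd_pi (turn T q c)" "growth T q c = 1" for c
    using eigenfunction_antiperiodic[OF that] by (auto simp: E eigenfunction_def)
  have nz: "?e c \<noteq> 0" for c
    using nontrivial_eigenfunction[of c] by (auto simp: nontrivial_def)
  have ind1: "fs.independent {?e c}" for c
    using nz[of c] by simp
  have zero: "0 \<in> fs.span B" for B by (rule fs.span_zero)
  have mx: "odd_pi (max_turn T q) \<Longrightarrow> \<exists>c. turn T q c = max_turn T q \<and> odd_pi (turn T q c) \<and> growth T q c = 1"
    and mn: "odd_pi (min_turn T q) \<Longrightarrow> \<exists>c. turn T q c = min_turn T q \<and> odd_pi (turn T q c) \<and> growth T q c = 1"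
    using max_turn min_turn growth_at_extremum by metis+
  have one: "fs.dim E = 1" if c: "odd_pi (turn T q c)" "growth T q c = 1"
    and ne: "\<not> (odd_pi (max_turn T q) \<and> odd_pi (min_turn T q))" for c
  proof (rule fs.dim_unique)
    show "{?e c} \<subseteq> E" using mem[OF c] by simp
    show "E \<subseteq> fs.span {?e c}"
    proof
      fix u assume "u \<in> E"
      then obtain \<rho> d where u: "u = (\<lambda>t. \<rho> * ?e d t)" and d: "\<rho> \<noteq> 0 \<longrightarrow> odd_pi (turn T q d) \<and> growth T q d = 1"
        using rep by blast
      show "u \<in> fs.span {?e c}"
      proof (cases "\<rho> = 0")
        case True then show ?thesis using zero u by (simp add: zero_fun_def)
      next
        case False
        have dc: "turn T q d = turn T q c"
          using odd_pi_close[of "turn T q d" "turn T q c"] d False c turn_close[of d c] pi_gt_zero by auto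
        have "sin (d - c) = 0"
        proof (rule ccontr)
          assume "sin (d - c) \<noteq> 0"
          from two_eigendirections[OF c dc this] show False
            using ne eigendirection_extremal[OF c] c(1) by auto
        qed
        then have sup: "?e d t = cos (d - c) * ?e c t" for t
          using eigenfunction_superposition[of c "d - c" t] by simp
        have "u = (\<lambda>x. (\<rho> * cos (d - c)) * ?e c x)" unfolding u sup mult.assoc ..
        then show ?thesis unfolding fs.span_singleton by (rule image_eqI) simp
      qed
    qed
    show "fs.independent {?e c}" by (rule ind1)
  qed simp
  have "fs.dim E = of_bool (odd_pi (max_turn T q)) + of_bool (odd_pi (min_turn T q))"
  proof (cases "odd_pi (max_turn T q)"; cases "odd_pi (min_turn T q)")
    assume mm: "odd_pi (max_turn T q)" "odd_pi (min_turn T q)"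
    have eq: "max_turn T q = min_turn T q"
      using odd_pi_close[OF mm] max_min_close pi_gt_zero by auto
    have tc: "turn T q c = max_turn T q" for c
      using eq turn_le_max[of c] min_le_turn[of c] by simp
    have gc: "growth T q c = 1" for c by (rule growth_at_extremum) (simp_all add: tc mm)
    have "fs.dim E = 2"
    proof (rule fs.dim_unique)
      show "{?e 0, ?e (pi/2)} \<subseteq> E" using mem gc tc mm by auto
      show "E \<subseteq> fs.span {?e 0, ?e (pi/2)}"
      proof
        fix u assume "u \<in> E"
        then obtain \<rho> d where u: "u = (\<lambda>t. \<rho> * ?e d t)" using rep by blast
        have sup: "?e d t = cos d * ?e 0 t + sin d * ?e (pi/2) t" for t
          using eigenfunction_superposition[of 0 d t] by simp
        have "u = (\<lambda>x. (\<rho> * cos d) * ?e 0 x) + (\<lambda>x. (\<rho> * sin d) * ?e (pi/2) x)"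
          unfolding u plus_fun_def sup by (simp only: distrib_left mult.assoc)
        then show "u \<in> fs.span {?e 0, ?e (pi/2)}"
          by (metis fs.span_add fs.span_scale fs.span_base insertI1 insertI2)
      qed
      have no: "?e 0 \<notin> fs.span {?e (pi/2)}"
      proof
        assume "?e 0 \<in> fs.span {?e (pi/2)}"
        then obtain k where k: "?e 0 = (\<lambda>x. k * ?e (pi/2) x)" by (auto simp: fs.span_singleton)
        have "?e 0 0 = 0" "?e (pi/2) 0 = 1" using T by (auto simp: eigenfunction_def angle amplitude_start)
        then have "k = 0" using fun_cong[OF k, of 0] by simp
        then show False using k nz[of 0] by (simp add: zero_fun_def)
      qed
      then show "fs.independent {?e 0, ?e (pi/2)}"
        using ind1[of "pi/2"] by (simp add: fs.independent_insert)
      have "?e 0 \<noteq> ?e (pi/2)" using no fs.span_base by auto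
      then show "card {?e 0, ?e (pi/2)} = 2" by simp
    qed
    then show ?thesis using mm by simp
  next
    assume mm: "odd_pi (max_turn T q)" "\<not> odd_pi (min_turn T q)"
    then show ?thesis using mx one by auto
  next
    assume mm: "\<not> odd_pi (max_turn T q)" "odd_pi (min_turn T q)"
    then show ?thesis using mn one by auto
  next
    assume mm: "\<not> odd_pi (max_turn T q)" "\<not> odd_pi (min_turn T q)"
    have "u = 0" if "u \<in> E" for u
    proof -
      obtain \<rho> d where u: "u = (\<lambda>t. \<rho> * ?e d t)" and d: "\<rho> \<noteq> 0 \<longrightarrow> odd_pi (turn T q d) \<and> growth T q d = 1"
        using rep[OF \<open>u \<in> E\<close>] by blast
      have "\<rho> = 0" using d eigendirection_extremal[of d] mm by auto
      then show ?thesis by (simp add: u zero_fun_def)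
    qed
    then have "E \<subseteq> fs.span {}" by auto
    then have "fs.dim E = 0" using fs.dim_unique[of "{}" E 0] by (simp add: fs.independent_empty)
    then show ?thesis using mm by simp
  qed
  then show ?thesis by (simp add: antiper_mult_def E_def q_def)
qed

section \<open>The sequence of antiperiodic eigenvalues\<close>

lemma coefficient_add_mult:
  assumes "coefficient T a" "coefficient T b"
  shows "coefficient T (\<lambda>x. a x + s * b x)"
  using assms unfolding coefficient_def by (auto intro!: set_integral_add)

lemma coefficient_const: "T > 0 \<Longrightarrow> coefficient T (\<lambda>x. c)"
  by (simp add: coefficient_def absolutely_integrable_continuous_real)

lemma coefficient_shift: "coefficient T a \<Longrightarrow> coefficient T (\<lambda>x. \<mu> + a x)"
  using coefficient_add_mult[OF coefficient_const, of T a \<mu> 1] by (simp add: coefficient_def)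

lemma extremal_turn_continuous:
  assumes a: "coefficient T a" and b: "coefficient T b"
  shows "continuous_on A (\<lambda>s. max_turn T (\<lambda>x. a x + s * b x))" "continuous_on A (\<lambda>s. min_turn T (\<lambda>x. a x + s * b x))"
proof -
  let ?q = "\<lambda>s x. a x + s * b x"
  have "\<exists>d>0. \<forall>s'. dist s' s < d \<longrightarrow> dist (max_turn T (?q s')) (max_turn T (?q s)) < e \<and>
      dist (min_turn T (?q s')) (min_turn T (?q s)) < e" if e: "e > 0" for s e
  proof -
    define C where "C = exp (2 * integral {0..T} (\<lambda>t. 1 + \<bar>?q s t\<bar>)) * integral {0..T} (\<lambda>t. \<bar>b t\<bar>)"
    have "(\<lambda>t. \<bar>b t\<bar>) integrable_on {0..T}" using b by (auto simp: coefficient_def absolutely_integrable_on_def)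
    then have C: "C \<ge> 0" unfolding C_def by (intro mult_nonneg_nonneg integral_nonneg) auto
    have bd: "\<bar>max_turn T (?q s) - max_turn T (?q s')\<bar> \<le> \<bar>s - s'\<bar> * C"
      "\<bar>min_turn T (?q s) - min_turn T (?q s')\<bar> \<le> \<bar>s - s'\<bar> * C" for s'
    proof -
      have "(\<lambda>t. \<bar>?q s t - ?q s' t\<bar>) = (\<lambda>t. \<bar>s - s'\<bar> * \<bar>b t\<bar>)"
        by (simp add: abs_mult[symmetric] left_diff_distrib)
      then have i: "integral {0..T} (\<lambda>t. \<bar>?q s t - ?q s' t\<bar>) = \<bar>s - s'\<bar> * integral {0..T} (\<lambda>t. \<bar>b t\<bar>)" by simp
      show "\<bar>max_turn T (?q s) - max_turn T (?q s')\<bar> \<le> \<bar>s - s'\<bar> * C"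
        "\<bar>min_turn T (?q s) - min_turn T (?q s')\<bar> \<le> \<bar>s - s'\<bar> * C"
        using extremal_turn_dependence[OF coefficient_add_mult[OF a b, of s'] coefficient_add_mult[OF a b, of s]]
        unfolding i C_def by (simp_all only: mult.left_commute)
    qed
    have "\<bar>s - s'\<bar> * C < e" if "dist s' s < e / (C + 1)" for s'
    proof -
      have "\<bar>s - s'\<bar> * C \<le> \<bar>s - s'\<bar> * (C + 1)" by (intro mult_left_mono) auto
      also have "\<dots> < e" using that C by (simp add: dist_real_def abs_minus_commute pos_less_divide_eq)
      finally show ?thesis .
    qed
    then show ?thesis
      using e C bd by (intro exI[of _ "e / (C + 1)"]) (smt (verit) dist_real_def divide_pos_pos)
  qed
  then show "continuous_on A (\<lambda>s. max_turn T (?q s))" "continuous_on A (\<lambda>s. min_turn T (?q s))"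
    unfolding continuous_on_iff by meson+
qed

text \<open>This bounds the eigenvalues from below without any bound on \<open>a\<close> from above. With \<open>m\<close> the mean of \<open>a\<close>, the
  function \<open>h x = m x - \<integral>\<^sub>0\<^sup>x a\<close> vanishes at \<open>0\<close> and \<open>T\<close>, and \<open>\<pi>/2 - arctan h\<close>, the angle of the positive function
  \<open>exp (\<integral> h)\<close>, is a Pruefer angle for the coefficient \<open>a - m - h\<^sup>2\<close>. Its turn is \<open>0\<close>, hence all turns for this
  coefficient are below \<open>\<pi>\<close>, and \<open>\<mu> + a\<close> is smaller for very negative \<open>\<mu>\<close>.\<close>
lemma exists_small_max_turn:
  assumes "coefficient T a"
  shows "\<exists>\<mu>. max_turn T (\<lambda>x. \<mu> + a x) < pi"
proof -
  interpret coefficient T a by fact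
  define m where "m = integral {0..T} a / T"
  define h where "h x = x * m - integral {0..x} a" for x
  have "primitive_on 0 T (\<lambda>x. x * m) (\<lambda>x. m)"
    by (rule primitive_on_classical) (auto intro!: derivative_eq_intros)
  from primitive_on_diff[OF this primitive_on_indefinite_integral[OF q, of 0]]
  have h: "primitive_on 0 T h (\<lambda>x. m - a x)" by (simp add: h_def[abs_def])
  define \<theta> where "\<theta> x = pi/2 - arctan (h x)" for x
  have "primitive_on 0 T (\<lambda>x. arctan (h x)) (\<lambda>x. (m - a x) * inverse (1 + (h x)\<^sup>2))"
  proof (rule primitive_on_compose[OF h DERIV_arctan])
    have "1 + y\<^sup>2 \<noteq> 0" for y :: real by (metis add_pos_nonneg less_irrefl zero_le_power2 zero_less_one)
    then show "continuous_on UNIV (\<lambda>y::real. inverse (1 + y\<^sup>2))" by (intro continuous_intros) auto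
  qed
  from primitive_on_diff[OF primitive_on_const[of 0 T "pi/2"] this]
  have th: "primitive_on 0 T \<theta> (\<lambda>x. 0 - (m - a x) * inverse (1 + (h x)\<^sup>2))" by (simp add: \<theta>_def[abs_def])
  (* The coefficient for which \<theta> is a Pruefer angle. *)
  define w where "w x = a x + (- m - (h x)\<^sup>2)" for x
  have w: "coefficient T w"
    unfolding w_def coefficient_def
    by (intro conjI T set_integral_add q absolutely_integrable_continuous_real continuous_intros primitive_on_continuous[OF h])
  have rhs: "prufer_rhs w \<theta> x = 0 - (m - a x) * inverse (1 + (h x)\<^sup>2)" for x
  proof -
    have "cos (\<theta> x) = sin (arctan (h x))" "sin (\<theta> x) = cos (arctan (h x))"
      by (simp_all add: \<theta>_def cos_diff sin_diff)
    moreover have r: "1 + (h x)\<^sup>2 > 0" by (simp add: add_pos_nonneg)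
    ultimately have "(cos (\<theta> x))\<^sup>2 = (h x)\<^sup>2 / (1 + (h x)\<^sup>2)" "(sin (\<theta> x))\<^sup>2 = 1 / (1 + (h x)\<^sup>2)"
      by (simp_all add: sin_arctan cos_arctan power_divide)
    then have "prufer_rhs w \<theta> x = (h x)\<^sup>2 / (1 + (h x)\<^sup>2) + w x * (1 / (1 + (h x)\<^sup>2))"
      by (simp only: prufer_rhs_def)
    also have "\<dots> = ((h x)\<^sup>2 + w x) / (1 + (h x)\<^sup>2)" by (simp add: add_divide_distrib)
    finally show ?thesis by (simp add: w_def divide_inverse algebra_simps)
  qed
  then have "prufer_rhs w \<theta> = (\<lambda>x. 0 - (m - a x) * inverse (1 + (h x)\<^sup>2))" by (rule ext)
  then have "prufer_solution 0 T w \<theta>" using th by (simp add: prufer_solution_def)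
  moreover have "h 0 = 0" "h T = 0" using T by (simp_all add: h_def m_def)
  ultimately have "turn T w (pi/2) = 0"
    using coefficient.turn_eqI[OF w, of \<theta>] by (simp add: \<theta>_def[of 0] \<theta>_def[of T])
  then have "max_turn T w < pi"
    using coefficient.max_turn[OF w] coefficient.turn_close[OF w] by (metis abs_less_iff diff_zero)
  moreover obtain B where B: "\<And>x. x \<in> {0..T} \<Longrightarrow> \<bar>h x\<bar> \<le> B" using primitive_on_bounded[OF h] by blast
  have "(- m - B\<^sup>2) + a x \<le> w x" if "x \<in> {0..T} - {}" for x
    using B[of x] that by (simp add: w_def abs_le_square_iff[symmetric] order_trans[OF _ abs_ge_self])
  from extremal_turn_mono(1)[OF coefficient_shift[OF assms] w negligible_empty this]
  have "max_turn T (\<lambda>x. (- m - B\<^sup>2) + a x) \<le> max_turn T w" .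
  ultimately show ?thesis by (intro exI[of _ "- m - B\<^sup>2"]) simp
qed

text \<open>The solutions are multiples of \<open>sin (w t + c)\<close>. The Pruefer angle and \<open>w t + c\<close> point into the same quadrant
  for all \<open>t\<close>, or into opposite ones for all \<open>t\<close>, so that their difference \<open>\<delta>\<close> never meets a zero of the cosine and stays in an interval of length \<open>\<pi>\<close>. As both
  increments over \<open>[0, T]\<close> are odd multiples of \<open>\<pi>\<close>, they agree.\<close>
lemma turn_constant_coefficient:
  assumes w: "w > 0" and T: "T > 0" and wT: "w * T = (2 * real n + 1) * pi"
  shows "turn T (\<lambda>_. w\<^sup>2) d = (2 * real n + 1) * pi"
proof -
  interpret coefficient T "\<lambda>_. w\<^sup>2" using T by (rule coefficient_const)
  obtain s c where sc: "cos d = s * cos c" "w * sin d = s * sin c"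
    using polar_Ex[of "cos d" "w * sin d"] by blast
  have s0: "s \<noteq> 0" using sc w sin_cos_squared_add[of d] by auto
  define u where "u t = s / w * sin (w * t + c)" for t
  define v where "v t = s * cos (w * t + c)" for t
  have S: "solves 0 T (\<lambda>_. w\<^sup>2) u v"
    unfolding solves_def u_def v_def using w
    by (intro conjI primitive_on_classical)
      (auto intro!: derivative_eq_intros continuous_intros simp: field_simps power2_eq_square)
  have 0: "u 0 = 1 * sin d" "v 0 = 1 * cos d" using sc w by (auto simp: u_def v_def field_simps)
  have odd: "odd_pi (w * T)" unfolding odd_pi_def wT by (intro exI[of _ "int n"]) simp
  have "u T = - u 0" "v T = - v 0"
    using odd_pi_sin_cos[OF odd, of c] by (simp_all add: u_def v_def add.commute)
  then have odt: "odd_pi (turn T (\<lambda>_. w\<^sup>2) d)"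
    using antiperiodic_direction[OF growth_pos[of d], of d "turn T (\<lambda>_. w\<^sup>2) d"] endpoint_polar[OF S 0] 0 by simp
  let ?th = "prufer_angle T (\<lambda>_. w\<^sup>2) d"
  define \<delta> where "\<delta> t = ?th t - (w * t + c)" for t
  have dc: "continuous_on {0..T} \<delta>"
    unfolding \<delta>_def by (intro continuous_intros prufer_continuous[OF angle(1)])
  have nz: "cos (\<delta> t) \<noteq> 0" if t: "t \<in> {0..T}" for t
  proof
    assume "cos (\<delta> t) = 0"
    define A where "A = amplitude 0 (\<lambda>_. w\<^sup>2) ?th t"
    have A: "A > 0" by (simp add: A_def amplitude_pos)
    have p: "u t = A * sin (?th t)" "v t = A * cos (?th t)"
      using solves_polar[OF S q angle(1)[of d], of 1 t] 0 t by (auto simp: angle A_def)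
    have "A * cos (\<delta> t) = v t * cos (w * t + c) + u t * sin (w * t + c)"
      by (simp add: \<delta>_def cos_diff p algebra_simps)
    also have "\<dots> = s * ((cos (w * t + c))\<^sup>2 + (sin (w * t + c))\<^sup>2 / w)"
      by (simp add: u_def v_def power2_eq_square algebra_simps)
    finally have "(cos (w * t + c))\<^sup>2 + (sin (w * t + c))\<^sup>2 / w = 0"
      using \<open>cos (\<delta> t) = 0\<close> s0 by simp
    moreover have "(cos (w * t + c))\<^sup>2 \<ge> 0" "(sin (w * t + c))\<^sup>2 / w \<ge> 0" using w by auto
    ultimately have "(cos (w * t + c))\<^sup>2 = 0" "(sin (w * t + c))\<^sup>2 / w = 0" by linarith+
    then show False using w sin_cos_squared_add[of "w * t + c"] by auto
  qed
  have "\<bar>\<delta> T - \<delta> 0\<bar> < pi"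
  proof (rule ccontr)
    assume far: "\<not> \<bar>\<delta> T - \<delta> 0\<bar> < pi"
    define lo where "lo = min (\<delta> 0) (\<delta> T)"
    have l: "lo + pi \<le> max (\<delta> 0) (\<delta> T)" using far by (auto simp: lo_def)
    (* (k + 1/2) \<pi> is the first zero of the cosine at or after lo. *)
    define k where "k = \<lceil>lo / pi - 1/2\<rceil>"
    have "lo / pi - 1/2 \<le> of_int k" "of_int k < lo / pi - 1/2 + 1" unfolding k_def by linarith+
    then have "lo \<le> (of_int k + 1/2) * pi" "(of_int k + 1/2) * pi \<le> lo + pi"
      by (simp_all add: field_simps)
    then have z: "min (\<delta> 0) (\<delta> T) \<le> (of_int k + 1/2) * pi" "(of_int k + 1/2) * pi \<le> max (\<delta> 0) (\<delta> T)"
      using l by (auto simp: lo_def)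
    obtain t where t: "t \<in> {0..T}" "\<delta> t = (of_int k + 1/2) * pi"
      using z IVT'[of \<delta> 0 "(of_int k + 1/2) * pi" T] IVT2'[of \<delta> T "(of_int k + 1/2) * pi" 0] dc T
      by (cases "\<delta> 0 \<le> \<delta> T") auto
    have "cos (\<delta> t) = 0" unfolding t cos_zero_iff_int2 by (intro exI[of _ k]) (simp add: algebra_simps)
    then show False using nz[OF t(1)] by simp
  qed
  then have "\<bar>turn T (\<lambda>_. w\<^sup>2) d - w * T\<bar> < 2 * pi"
    using pi_gt_zero by (simp add: \<delta>_def turn_def angle)
  from odd_pi_close[OF odt odd this] show ?thesis by (simp add: wT)
qed

lemma extremal_turn_constant_coefficient:
  assumes "w > 0" "T > 0" "w * T = (2 * real n + 1) * pi"
  shows "max_turn T (\<lambda>_. w\<^sup>2) = (2 * real n + 1) * pi" "min_turn T (\<lambda>_. w\<^sup>2) = (2 * real n + 1) * pi"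
proof -
  have c: "coefficient T (\<lambda>_. w\<^sup>2)" using assms(2) by (rule coefficient_const)
  show "max_turn T (\<lambda>_. w\<^sup>2) = (2 * real n + 1) * pi" "min_turn T (\<lambda>_. w\<^sup>2) = (2 * real n + 1) * pi"
    using coefficient.max_turn[OF c] coefficient.min_turn[OF c] turn_constant_coefficient[OF assms] by metis+
qed

text \<open>A lower bound for the coefficient makes the turns of \<open>\<mu> + a\<close> unbounded as \<open>\<mu>\<close> grows, by comparison with
  constants.\<close>
locale bounded_below_coefficient = coefficient T a for T a +
  fixes b :: real and N :: "real set"
  assumes N: "negligible N" and below: "\<And>t. t \<in> {0..T} - N \<Longrightarrow> b \<le> a t"
begin

abbreviation "Mx \<mu> \<equiv> max_turn T (\<lambda>x. \<mu> + a x)"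
abbreviation "Mn \<mu> \<equiv> min_turn T (\<lambda>x. \<mu> + a x)"

lemma shifted: "coefficient T (\<lambda>x. \<mu> + a x)"
  by (rule coefficient_shift) unfold_locales

lemma extremal_strict_mono: "\<mu> < \<nu> \<Longrightarrow> Mx \<mu> < Mx \<nu>" "\<mu> < \<nu> \<Longrightarrow> Mn \<mu> < Mn \<nu>"
proof -
  assume l: "\<mu> < \<nu>"
  have "\<not> negligible {t \<in> {0..T}. \<mu> + a t \<noteq> \<nu> + a t}"
    using l T negligible_interval(1)[of 0 T] by (simp add: cbox_interval atLeastAtMost_def atLeast_def atMost_def Int_def)
  then show "Mx \<mu> < Mx \<nu>" "Mn \<mu> < Mn \<nu>"
    using extremal_turn_mono(3,4)[OF shifted[of \<mu>] shifted[of \<nu>] negligible_empty] l by simp_all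
qed

lemma extremal_less_iff: "Mx \<mu> < Mx \<nu> \<longleftrightarrow> \<mu> < \<nu>" "Mn \<mu> < Mn \<nu> \<longleftrightarrow> \<mu> < \<nu>"
  using extremal_strict_mono by (metis linorder_neqE_linordered_idom order_less_asym)+

lemma extremal_surjective: "\<exists>\<mu>. Mx \<mu> = (2 * real k + 1) * pi" "\<exists>\<mu>. Mn \<mu> = (2 * real k + 1) * pi"
proof -
  define w where "w = (2 * real k + 1) * pi / T"
  have w: "w > 0" "w * T = (2 * real k + 1) * pi" using T by (auto simp: w_def intro!: divide_pos_pos mult_pos_pos)
  obtain lo where lo: "Mx lo < pi" using exists_small_max_turn[OF shifted[of 0]] by auto
  have lo': "Mn lo \<le> Mx lo" by (rule coefficient.max_min_close(1)[OF shifted])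
  define hi where "hi = w\<^sup>2 - b"
  have "min_turn T (\<lambda>_. w\<^sup>2) \<le> Mn hi"
    by (rule extremal_turn_mono(2)[OF coefficient_const[OF T] shifted N]) (use below in \<open>auto simp: hi_def\<close>)
  then have hi: "(2 * real k + 1) * pi \<le> Mn hi" using extremal_turn_constant_coefficient(2)[OF w(1) T w(2)] by simp
  have hi': "Mn hi \<le> Mx hi" by (rule coefficient.max_min_close(1)[OF shifted])
  have "pi \<le> (2 * real k + 1) * pi" by simp
  then have b: "Mx lo \<le> (2 * real k + 1) * pi" "Mn lo \<le> (2 * real k + 1) * pi" using lo lo' by linarith+
  have "lo < hi" using extremal_less_iff(1)[of lo hi] lo hi hi' \<open>pi \<le> _\<close> by linarith
  have "continuous_on {lo..hi} Mx" "continuous_on {lo..hi} Mn"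
    using extremal_turn_continuous[of T a "\<lambda>_. 1"] coefficient_const[OF T] coefficient_axioms by (simp_all add: add.commute)
  then show "\<exists>\<mu>. Mx \<mu> = (2 * real k + 1) * pi" "\<exists>\<mu>. Mn \<mu> = (2 * real k + 1) * pi"
    using IVT'[of Mx lo _ hi] IVT'[of Mn lo _ hi] b hi hi' \<open>lo < hi\<close> by (meson less_imp_le order_trans)+
qed

text \<open>The extremal turns of \<open>\<mu> + a\<close> are continuous and strictly increasing in \<open>\<mu>\<close>, and take all values
  \<open>\<pi>, 3\<pi>, 5\<pi>, \<dots>\<close>. By the formula for the multiplicity the values of \<open>\<mu>\<close> where this happens, taken alternately
  for the maximum and the minimum, list the eigenvalues.\<close>
lemma antiper_eigenvalue_extremal:
  "Mx \<mu> = (2 * real k + 1) * pi \<Longrightarrow> antiper_eigenvalue T a (2 * k + 1) = \<mu>"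
  "Mn \<mu> = (2 * real k + 1) * pi \<Longrightarrow> antiper_eigenvalue T a (2 * k + 2) = \<mu>"
proof -
  obtain eM where eM: "\<And>k. Mx (eM k) = (2 * real k + 1) * pi" using extremal_surjective(1) by metis
  obtain em where em: "\<And>k. Mn (em k) = (2 * real k + 1) * pi" using extremal_surjective(2) by metis
  (* Odd numbers list the values for the maximal turn, even ones those for the minimal turn. *)
  define l where "l i = (if odd i then eM (i div 2) else em (i div 2 - 1))" for i :: nat
  have lo: "l (2 * k + 1) = eM k" and le: "l (2 * k + 2) = em k" for k by (auto simp: l_def)
  have eM_iff: "eM k = \<mu> \<longleftrightarrow> Mx \<mu> = (2 * real k + 1) * pi" and em_iff: "em k = \<mu> \<longleftrightarrow> Mn \<mu> = (2 * real k + 1) * pi" for k \<mu>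
    using eM[of k] em[of k] extremal_less_iff by (metis less_irrefl linorder_neqE_linordered_idom)+
  have step: "l (Suc i) \<le> l (Suc (Suc i))" for i
  proof (cases "even i")
    case True
    then obtain k where k: "i = 2 * k" by blast
    have "Mx (eM k) \<le> Mx (em k)" using coefficient.max_min_close(1)[OF shifted[of "em k"]] eM[of k] em[of k] by simp
    then have "eM k \<le> em k" using extremal_less_iff(1)[of "em k" "eM k"] by linarith
    then show ?thesis using lo[of k] le[of k] k by simp
  next
    case False
    then obtain k where k: "i = 2 * k + 1" by (rule oddE)
    have "Mx (eM (Suc k)) - Mn (eM (Suc k)) < pi" by (rule coefficient.max_min_close(2)[OF shifted])
    moreover have "Mx (eM (Suc k)) = Mn (em k) + 2 * pi" using eM[of "Suc k"] em[of k] by (simp add: algebra_simps)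
    ultimately have "Mn (em k) < Mn (eM (Suc k))" using pi_gt_zero by linarith
    then have "em k \<le> eM (Suc k)" using extremal_less_iff(2) by (metis less_imp_le)
    then show ?thesis using lo[of "Suc k"] le[of k] k by simp
  qed
  have mono: "l i \<le> l j" if "1 \<le> i" "i \<le> j" for i j
    using lift_Suc_mono_le[of "\<lambda>i. l (Suc i)" "i - 1" "j - 1"] step that by simp
  have cnt: "finite {k::nat. x = (2 * real k + 1) * pi}" "card {k::nat. x = (2 * real k + 1) * pi} = of_bool (odd_pi x)"
    if x: "x > - pi" for x
  proof -
    have "{k::nat. x = (2 * real k + 1) * pi} = (if odd_pi x then {THE k. x = (2 * real k + 1) * pi} else {})"
    proof (cases "odd_pi x")
      case True
      then obtain j :: int where j: "x = (2 * of_int j + 1) * pi" by (auto simp: odd_pi_def)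
      then have "(- 1) * pi < (2 * of_int j + 1) * pi" using x by simp
      then have "-1 < 2 * real_of_int j + 1" by (subst (asm) mult_less_cancel_right) auto
      then have "j \<ge> 0" by linarith
      then have "x = (2 * real (nat j) + 1) * pi" using j by simp
      moreover have "k = nat j" if "x = (2 * real k + 1) * pi" for k using that calculation by simp
      ultimately have "\<exists>!k. x = (2 * real k + 1) * pi" by blast
      then show ?thesis using True theI' by (auto dest: the1_equality)
    next
      case False
      have "x \<noteq> (2 * real k + 1) * pi" for k :: nat
        using False unfolding odd_pi_def by (metis of_int_of_nat_eq)
      then show ?thesis using False by auto
    qed
    then show "finite {k::nat. x = (2 * real k + 1) * pi}" "card {k::nat. x = (2 * real k + 1) * pi} = of_bool (odd_pi x)" by simp_all
  qed
  have set: "{i. 1 \<le> i \<and> l i = \<mu>} = (\<lambda>k. 2 * k + 1) ` {k. Mx \<mu> = (2 * real k + 1) * pi} \<union> (\<lambda>k. 2 * k + 2) ` {k. Mn \<mu> = (2 * real k + 1) * pi}" for \<mu>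
  proof (intro set_eqI iffI)
    fix i assume i: "i \<in> {i. 1 \<le> i \<and> l i = \<mu>}"
    show "i \<in> (\<lambda>k. 2 * k + 1) ` {k. Mx \<mu> = (2 * real k + 1) * pi} \<union> (\<lambda>k. 2 * k + 2) ` {k. Mn \<mu> = (2 * real k + 1) * pi}"
    proof (cases "even i")
      case False
      then obtain k where "i = 2 * k + 1" by (rule oddE)
      then show ?thesis using i lo[of k] eM_iff by auto
    next
      case True
      then obtain k' where "i = 2 * k'" by blast
      moreover from this i obtain k where "k' = Suc k" by (cases k') auto
      ultimately have "i = 2 * k + 2" by simp
      then show ?thesis using i le[of k] em_iff by auto
    qed
  next
    fix i assume "i \<in> (\<lambda>k. 2 * k + 1) ` {k. Mx \<mu> = (2 * real k + 1) * pi} \<union> (\<lambda>k. 2 * k + 2) ` {k. Mn \<mu> = (2 * real k + 1) * pi}"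
    then show "i \<in> {i. 1 \<le> i \<and> l i = \<mu>}" using lo le eM_iff em_iff by auto
  qed
  have gt: "Mx \<mu> > - pi" "Mn \<mu> > - pi" for \<mu>
    using coefficient.max_min_close[OF shifted[of \<mu>]] by linarith+
  have fin: "finite {i. 1 \<le> i \<and> l i = \<mu>}" for \<mu>
    unfolding set using cnt(1)[OF gt(1)[of \<mu>]] cnt(1)[OF gt(2)[of \<mu>]] by simp
  have card: "card {i. 1 \<le> i \<and> l i = \<mu>} = antiper_mult T a \<mu>" for \<mu>
  proof -
    have "card {i. 1 \<le> i \<and> l i = \<mu>} = card ((\<lambda>k. 2 * k + 1) ` {k::nat. Mx \<mu> = (2 * real k + 1) * pi})
        + card ((\<lambda>k. 2 * k + 2) ` {k::nat. Mn \<mu> = (2 * real k + 1) * pi})"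
      unfolding set using cnt(1)[OF gt(1)[of \<mu>]] cnt(1)[OF gt(2)[of \<mu>]]
      by (intro card_Un_disjoint finite_imageI) (auto, presburger)
    also have "\<dots> = of_bool (odd_pi (Mx \<mu>)) + of_bool (odd_pi (Mn \<mu>))"
      using cnt(2)[OF gt(1)[of \<mu>]] cnt(2)[OF gt(2)[of \<mu>]]
      by (simp add: card_image inj_on_def)
    finally show ?thesis using antiper_mult_eq[OF shifted] by simp
  qed
  have ev: "antiper_eigenvalue T a k = l k" if "1 \<le> k" for k
    by (rule antiper_eigenvalue_eqI[OF mono fin card that])
  show "antiper_eigenvalue T a (2 * k + 1) = \<mu>" if "Mx \<mu> = (2 * real k + 1) * pi"
    using ev[of "2 * k + 1"] lo[of k] eM_iff[of k \<mu>] that by simp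
  show "antiper_eigenvalue T a (2 * k + 2) = \<mu>" if "Mn \<mu> = (2 * real k + 1) * pi"
    using ev[of "2 * k + 2"] le[of k] em_iff[of k \<mu>] that by simp
qed

lemma antiper_eigenvalue_neg_iff: "antiper_eigenvalue T a (2 * k + 2) < 0 \<longleftrightarrow> (2 * real k + 1) * pi < min_turn T a"
proof -
  obtain \<mu> where \<mu>: "Mn \<mu> = (2 * real k + 1) * pi" using extremal_surjective(2) by blast
  then show ?thesis
    using antiper_eigenvalue_extremal(2)[OF \<mu>] extremal_less_iff(2)[of \<mu> 0] by simp
qed

lemma antiper_eigenvalue_pos_iff: "0 < antiper_eigenvalue T a (2 * k + 1) \<longleftrightarrow> max_turn T a < (2 * real k + 1) * pi"
proof -
  obtain \<mu> where \<mu>: "Mx \<mu> = (2 * real k + 1) * pi" using extremal_surjective(1) by blast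
  then show ?thesis
    using antiper_eigenvalue_extremal(1)[OF \<mu>] extremal_less_iff(1)[of 0 \<mu>] by simp
qed

end

lemma antiper_eigenvalue_zero_potential:
  assumes T: "T > 0" and n: "n \<ge> 1"
  shows "antiper_eigenvalue T (\<lambda>_. 0) (2 * n - 1) = ((2 * real n - 1) * pi / T)\<^sup>2"
proof -
  interpret bounded_below_coefficient T "\<lambda>_. 0" 0 "{}"
    using coefficient_const[OF T] by (auto simp: bounded_below_coefficient_def bounded_below_coefficient_axioms_def)
  define k where "k = n - 1"
  have k: "2 * n - 1 = 2 * k + 1" "2 * real n - 1 = 2 * real k + 1" using n by (auto simp: k_def)
  define w where "w = (2 * real k + 1) * pi / T"
  have w: "w > 0" "w * T = (2 * real k + 1) * pi" using T by (auto simp: w_def intro!: divide_pos_pos mult_pos_pos)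
  show ?thesis
    using antiper_eigenvalue_extremal(1)[of "w\<^sup>2" k] extremal_turn_constant_coefficient(1)[OF w(1) T w(2)]
    unfolding k w_def by simp
qed

section \<open>Quarter waves\<close>

lemma solves_reflect:
  assumes "solves p r q u v"
  shows "solves p r (\<lambda>t. q (p + r - t)) (\<lambda>t. u (p + r - t)) (\<lambda>t. - v (p + r - t))"
  using primitive_on_reflect[of p r u v] primitive_on_cmult[OF primitive_on_reflect[of p r v "\<lambda>t. - q t * u t"], of "-1"] assms
  by (simp add: solves_def)

lemma integral_reflect_interval:
  fixes f :: "real \<Rightarrow> real"
  shows "integral {p..r} (\<lambda>t. f (p + r - t)) = integral {p..r} f"
proof -
  have "integral {p..r} f = integral {-r..-p} (\<lambda>t. f (- t))"
    by (rule Henstock_Kurzweil_Integration.integral_reflect_real[symmetric])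
  also have "\<dots> = integral {-r - -(p + r)..-p - -(p + r)} (\<lambda>t. f (- (t + -(p + r))))"
    by (rule integral_shift_real_ivl[symmetric, where f="\<lambda>t. f (- t)" and c="- (p + r)"])
  finally show ?thesis by (simp add: algebra_simps)
qed

text \<open>Between a zero of \<open>u\<close> and the next zero of \<open>u'\<close>, compare with \<open>s t = sin (w (t - p))\<close> by the Wronskian \<open>G\<close>, whose
  derivative is \<open>(a - w\<^sup>2) u s\<close>. If the interval were longer than a quarter period of \<open>s\<close>, then \<open>G\<close> would become
  negative, although it increases from \<open>0\<close>. At the right end \<open>G = w u cos (w (r - p))\<close>; as \<open>u s\<close> is at
  most its value \<open>M\<close> at \<open>r\<close>, the excess \<open>\<integral> (a - w\<^sup>2)\<close> is at least \<open>w cot (w (r - p))\<close>. The function \<open>D\<close> is the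
  loss in this estimate; it is positive wherever \<open>a > w\<^sup>2\<close> inside the interval.\<close>
lemma quarter_wave:
  fixes a u v :: "real \<Rightarrow> real"
  assumes a: "a absolutely_integrable_on {p..r}" and S: "solves p r a u v" and pr: "p < r" and w: "w > 0"
    and N: "negligible N" and le: "\<And>t. t \<in> {p..r} - N \<Longrightarrow> w\<^sup>2 \<le> a t"
    and up: "u p = 0" and vr: "v r = 0" and u: "\<And>t. t \<in> {p<..r} \<Longrightarrow> u t > 0" and v: "\<And>t. t \<in> {p..r} \<Longrightarrow> v t \<ge> 0"
  shows "w * (r - p) \<le> pi / 2"
    "w * cot (w * (r - p)) \<le> integral {p..r} (\<lambda>t. a t - w\<^sup>2)"
    "w * (r - p) = pi / 2 \<Longrightarrow> integral {p..r} (\<lambda>t. a t - w\<^sup>2) = 0"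
    "w * (r - p) < pi / 2 \<Longrightarrow> w * cot (w * (r - p)) < integral {p..r} (\<lambda>t. a t - w\<^sup>2)"
proof -
  define s where "s t = sin (w * (t - p))" for t
  define c where "c t = w * cos (w * (t - p))" for t
  define G where "G t = u t * c t - v t * s t" for t
  have s: "solves p r (\<lambda>_. w\<^sup>2) s c"
    unfolding solves_def s_def c_def
    by (intro conjI primitive_on_classical)
      (auto intro!: derivative_eq_intros continuous_intros simp: field_simps power2_eq_square)
  have G: "primitive_on p r G (\<lambda>t. (a t - w\<^sup>2) * (u t * s t))"
    using wronskian_primitive[OF S s] by (simp add: G_def[abs_def])
  have Gp: "G p = 0" by (simp add: G_def up s_def)
  have u0: "u t \<ge> 0" if "t \<in> {p..r}" for t
    using u[of t] up that by (cases "t = p") auto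
  show len: "w * (r - p) \<le> pi / 2"
  proof (rule ccontr)
    assume A: "\<not> w * (r - p) \<le> pi / 2"
    (* Stop before the sine becomes negative. *)
    define t where "t = min r (p + pi / w)"
    have t: "p < t" "t \<le> r" "w * (t - p) \<le> pi" "w * (t - p) > pi / 2"
      using pr w A by (auto simp: t_def min_def field_simps)
    have s0: "s x \<ge> 0" if "x \<in> {p..t}" for x
    proof -
      have "w * (x - p) \<le> w * (t - p)" using that w by (intro mult_left_mono) auto
      then have "w * (x - p) \<le> pi" using t(3) by linarith
      then show ?thesis unfolding s_def using that w by (intro sin_ge_zero) auto
    qed
    have "G p \<le> G t"
    proof (rule primitive_on_nonneg[OF primitive_on_subinterval[OF G order_refl t(2)] N])
      show "0 \<le> (a x - w\<^sup>2) * (u x * s x)" if "x \<in> {p..t} - N" for x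
        using le[of x] u0[of x] s0[of x] that t by (intro mult_nonneg_nonneg) auto
    qed (use t in auto)
    moreover have "c t < 0"
    proof -
      have "cos (w * (t - p)) < 0" using t(3,4) by (intro cos_lt_zero_pi) auto
      then show ?thesis using w by (simp add: c_def mult_pos_neg)
    qed
    then have "u t * c t < 0" using u[of t] t by (simp add: mult_pos_neg)
    moreover have "v t * s t \<ge> 0" using v[of t] s0[of t] t by simp
    ultimately show False by (simp add: Gp) (simp add: G_def)
  qed
  have L: "0 < w * (r - p)" using w pr by simp
  have sr: "s r > 0" unfolding s_def using L len by (intro sin_gt_zero) auto
  have ur: "u r > 0" using u pr by simp
  define M where "M = u r * s r"
  have M: "M > 0" using ur sr by (simp add: M_def)
  have smono: "0 \<le> s t" "s t \<le> s r" "t < r \<Longrightarrow> s t < s r" "p < t \<Longrightarrow> 0 < s t" if "t \<in> {p..r}" for t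
  proof -
    have "w * (t - p) \<le> w * (r - p)" using that w by (intro mult_left_mono) auto
    then have b: "0 \<le> w * (t - p)" "w * (t - p) \<le> w * (r - p)" "w * (r - p) \<le> pi/2" using that w len by auto
    show "0 \<le> s t" unfolding s_def using b by (intro sin_ge_zero) auto
    show "s t \<le> s r" unfolding s_def using b by (intro sin_monotone_2pi_le) auto
    show "s t < s r" if "t < r"
    proof -
      have "w * (t - p) < w * (r - p)" using that w by simp
      then show ?thesis unfolding s_def using b by (intro sin_monotone_2pi) auto
    qed
    have "w * (t - p) < pi" using b pi_gt_zero by linarith
    then show "0 < s t" if "p < t" unfolding s_def using that w by (intro sin_gt_zero) auto
  qed
  have umono: "u t \<le> u r" if "t \<in> {p..r}" for t
    by (rule primitive_on_nonneg[of p r u v "{}"]) (use S v that in \<open>auto simp: solves_def\<close>)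
  have Gr: "integral {p..r} (\<lambda>t. (a t - w\<^sup>2) * (u t * s t)) = u r * c r"
    using primitive_on_integral(1)[OF G, of p r] pr Gp by (simp add: G_def vr)
  have ai: "(\<lambda>t. a t - w\<^sup>2) absolutely_integrable_on {p..r}"
    by (intro set_integral_diff a absolutely_integrable_continuous_real continuous_intros)
  have usM: "u t * s t \<le> M" if "t \<in> {p..r}" for t
    unfolding M_def using umono[OF that] smono[OF that] u0[OF that] ur by (intro mult_mono) auto
  define D where "D t = M * (a t - w\<^sup>2) - (a t - w\<^sup>2) * (u t * s t)" for t
  have Da: "D absolutely_integrable_on {p..r}"
    unfolding D_def by (intro set_integral_diff primitive_on_absolutely_integrable[OF G] set_integrable_mult_right ai)
  have D0: "0 \<le> D t" if "t \<in> {p..r} - N" for t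
  proof -
    have "0 \<le> (a t - w\<^sup>2) * (M - u t * s t)" using le[of t] usM[of t] that by (intro mult_nonneg_nonneg) auto
    then show ?thesis by (simp add: D_def algebra_simps)
  qed
  have "integral {p..r} D = M * integral {p..r} (\<lambda>t. a t - w\<^sup>2) - u r * c r"
    unfolding D_def using ai primitive_on_integrable[OF G] Gr
    by (subst integral_diff) (auto simp: set_lebesgue_integral_eq_integral(1))
  moreover have "u r * c r = M * (w * cot (w * (r - p)))"
    using sr by (simp add: M_def c_def s_def cot_def)
  ultimately have ID: "integral {p..r} D = M * (integral {p..r} (\<lambda>t. a t - w\<^sup>2) - w * cot (w * (r - p)))"
    by (simp add: right_diff_distrib)
  have "0 \<le> integral {p..r} D"
    by (rule integral_nonneg_ae[OF _ N D0]) (use Da in \<open>auto simp: set_lebesgue_integral_eq_integral(1)\<close>)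
  then show ge: "w * cot (w * (r - p)) \<le> integral {p..r} (\<lambda>t. a t - w\<^sup>2)"
    using M by (simp add: ID zero_le_mult_iff)
  have zero: "integral {p..r} (\<lambda>t. a t - w\<^sup>2) = 0"
    if "negligible N'" "\<And>t. t \<in> {p..r} - N' \<Longrightarrow> a t - w\<^sup>2 = 0" for N'
    using integral_spike[OF that(1), of "{p..r}" "\<lambda>_. 0" "\<lambda>t. a t - w\<^sup>2"] that(2) by simp
  show "integral {p..r} (\<lambda>t. a t - w\<^sup>2) = 0" if eq: "w * (r - p) = pi / 2"
  proof -
    have "c r = 0" by (simp add: c_def eq)
    then have "integral {p..r} (\<lambda>t. (a t - w\<^sup>2) * (u t * s t)) \<le> 0" using Gr by simp
    then obtain N' where N': "negligible N'" "\<forall>t\<in>{p..r} - N'. (a t - w\<^sup>2) * (u t * s t) = 0"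
      using ae_zero_if_integral_zero[OF primitive_on_absolutely_integrable[OF G] N] le u0 smono(1) by fastforce
    show ?thesis
    proof (rule zero)
      show "negligible (N' \<union> {p})" using N'(1) by (intro negligible_Un) auto
      fix t assume t: "t \<in> {p..r} - (N' \<union> {p})"
      then have "u t * s t > 0" using u[of t] smono(4)[of t] by auto
      then show "a t - w\<^sup>2 = 0" using N'(2) t by auto
    qed
  qed
  show "w * cot (w * (r - p)) < integral {p..r} (\<lambda>t. a t - w\<^sup>2)" if lt: "w * (r - p) < pi / 2"
  proof (rule ccontr)
    assume "\<not> ?thesis"
    then have "integral {p..r} D \<le> 0" using ge by (simp add: ID)
    then obtain N' where N': "negligible N'" "\<forall>t\<in>{p..r} - N'. D t = 0"
      using ae_zero_if_integral_zero[OF Da N D0] by auto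
    have "integral {p..r} (\<lambda>t. a t - w\<^sup>2) = 0"
    proof (rule zero)
      show "negligible (N' \<union> {r})" using N'(1) by (intro negligible_Un) auto
      fix t assume t: "t \<in> {p..r} - (N' \<union> {r})"
      have "u t * s t < M"
      proof -
        have "u t * s t \<le> u r * s t" using umono[of t] smono(1)[of t] t by (intro mult_right_mono) auto
        also have "\<dots> < u r * s r" using smono(3)[of t] ur t by (intro mult_strict_left_mono) auto
        finally show ?thesis by (simp add: M_def)
      qed
      moreover have "(a t - w\<^sup>2) * (M - u t * s t) = 0" using N'(2) t by (auto simp: D_def algebra_simps)
      ultimately show "a t - w\<^sup>2 = 0" by simp
    qed
    moreover have "cot (w * (r - p)) > 0" using L lt by (intro cot_gt_zero)
    ultimately show False using ge mult_pos_pos[OF w] by fastforce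
  qed
qed

lemma quarter_wave_descending:
  fixes a u v :: "real \<Rightarrow> real"
  assumes a: "a absolutely_integrable_on {p..r}" and S: "solves p r a u v" and pr: "p < r" and w: "w > 0"
    and N: "negligible N" and le: "\<And>t. t \<in> {p..r} - N \<Longrightarrow> w\<^sup>2 \<le> a t"
    and vp: "v p = 0" and ur: "u r = 0" and u: "\<And>t. t \<in> {p..<r} \<Longrightarrow> u t > 0" and v: "\<And>t. t \<in> {p..r} \<Longrightarrow> v t \<le> 0"
  shows "w * (r - p) \<le> pi / 2"
    "w * cot (w * (r - p)) \<le> integral {p..r} (\<lambda>t. a t - w\<^sup>2)"
    "w * (r - p) = pi / 2 \<Longrightarrow> integral {p..r} (\<lambda>t. a t - w\<^sup>2) = 0"
    "w * (r - p) < pi / 2 \<Longrightarrow> w * cot (w * (r - p)) < integral {p..r} (\<lambda>t. a t - w\<^sup>2)"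
proof -
  have "primitive_on p r (\<lambda>t. integral {p..t} a) a"
    using primitive_on_indefinite_integral[OF a, of 0] by simp
  from primitive_on_absolutely_integrable[OF primitive_on_cmult[OF primitive_on_reflect[OF this], of "-1"]]
  have a': "(\<lambda>t. a (p + r - t)) absolutely_integrable_on {p..r}" by simp
  note Q = quarter_wave[OF a' solves_reflect[OF S] pr w negligible_reflect[OF N, of "p + r"]]
  have *: "w\<^sup>2 \<le> a (p + r - t)" if "t \<in> {p..r} - {t. p + r - t \<in> N}" for t using le[of "p + r - t"] that by auto
  note Q = Q[OF *, unfolded integral_reflect_interval[of p r "\<lambda>t. a t - w\<^sup>2"]]
  show "w * (r - p) \<le> pi / 2"
    "w * cot (w * (r - p)) \<le> integral {p..r} (\<lambda>t. a t - w\<^sup>2)"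
    "w * (r - p) = pi / 2 \<Longrightarrow> integral {p..r} (\<lambda>t. a t - w\<^sup>2) = 0"
    "w * (r - p) < pi / 2 \<Longrightarrow> w * cot (w * (r - p)) < integral {p..r} (\<lambda>t. a t - w\<^sup>2)"
    by (rule Q; use vp ur u v pr in auto)+
qed

lemma L1_norm_eq_integral:
  assumes f: "f absolutely_integrable_on {p..q}" and N: "negligible N" and nn: "\<And>t. t \<in> {p..q} - N \<Longrightarrow> 0 \<le> f t"
  shows "L1_norm p q f = integral {p..q} f"
proof -
  have "(\<lambda>x. \<bar>f x\<bar>) absolutely_integrable_on {p..q}" using absolutely_integrable_abs[OF f] by simp
  then have "L1_norm p q f = integral {p..q} (\<lambda>x. \<bar>f x\<bar>)"
    unfolding L1_norm_def by (rule set_lebesgue_integral_eq_integral(2))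
  also have "\<dots> = integral {p..q} f"
    by (rule integral_spike[OF N]) (use nn in auto)
  finally show ?thesis .
qed

text \<open>Convexity of the cotangent, proved by the mean value theorem.\<close>
lemma cot_tangent_line:
  fixes y y0 :: real
  assumes y: "0 < y" "y \<le> pi / 2" and y0: "0 < y0" "y0 < pi / 2"
  shows "cot y0 - (y - y0) * inverse ((sin y0)\<^sup>2) \<le> cot y"
proof -
  have sin_pos: "0 < sin z" if "min y y0 \<le> z" "z \<le> max y y0" for z
    using that y y0 pi_gt_zero by (intro sin_gt_zero) auto
  have der: "(cot has_real_derivative - inverse ((sin z)\<^sup>2)) (at z)" if "min y y0 \<le> z" "z \<le> max y y0" for z
    using DERIV_cot[of z] sin_pos[OF that] by simp
  have sin_le: "sin z \<le> sin z'" if "z \<le> z'" "0 < z" "z' \<le> pi/2" for z z'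
    using that by (intro sin_monotone_2pi_le) auto
  consider "y = y0" | "y < y0" | "y0 < y" by linarith
  then show ?thesis
  proof cases
    case 2
    then obtain z where z: "y < z" "z < y0" "cot y0 - cot y = (y0 - y) * - inverse ((sin z)\<^sup>2)"
      using MVT2[of y y0 cot "\<lambda>z. - inverse ((sin z)\<^sup>2)"] der by auto
    have "inverse ((sin y0)\<^sup>2) \<le> inverse ((sin z)\<^sup>2)"
      using sin_le[of z y0] sin_pos[of z] z y y0 by (intro le_imp_inverse_le power_mono) auto
    then have "(y0 - y) * inverse ((sin y0)\<^sup>2) \<le> (y0 - y) * inverse ((sin z)\<^sup>2)"
      using 2 by (intro mult_left_mono) auto
    then show ?thesis using z(3) by (simp add: algebra_simps)
  next
    case 3
    then obtain z where z: "y0 < z" "z < y" "cot y - cot y0 = (y - y0) * - inverse ((sin z)\<^sup>2)"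
      using MVT2[of y0 y cot "\<lambda>z. - inverse ((sin z)\<^sup>2)"] der by auto
    have "inverse ((sin z)\<^sup>2) \<le> inverse ((sin y0)\<^sup>2)"
      using sin_le[of y0 z] sin_pos[of y0] z y y0 by (intro le_imp_inverse_le power_mono) auto
    then have "(y - y0) * inverse ((sin z)\<^sup>2) \<le> (y - y0) * inverse ((sin y0)\<^sup>2)"
      using 3 by (intro mult_left_mono) auto
    then show ?thesis using z(3) by (simp add: algebra_simps)
  qed simp
qed

section \<open>Zeros of an antiperiodic solution\<close>

text \<open>An antiperiodic solution that vanishes at the end points, for a coefficient above \<open>w\<^sup>2\<close>, where \<open>w\<^sup>2\<close> is
  the double eigenvalue \<open>(2n-1)\<^sup>2 \<pi>\<^sup>2 / T\<^sup>2\<close> of the zero potential.\<close>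
locale resonant_solution =
  fixes T :: real and n :: nat and a :: "real \<Rightarrow> real" and w :: real and N :: "real set" and u v :: "real \<Rightarrow> real"
  assumes T: "T > 0" and n: "n \<ge> 1" and w_def: "w = (2 * real n - 1) * pi / T"
    and a: "a absolutely_integrable_on {0..T}"
    and N: "negligible N" and above: "\<And>t. t \<in> {0..T} - N \<Longrightarrow> w\<^sup>2 \<le> a t"
    and excess: "0 < integral {0..T} (\<lambda>t. a t - w\<^sup>2)"
    and sol: "solves 0 T a u v" and u0: "u 0 = 0" and uT: "u T = 0" and vT: "v 0 + v T = 0"
    and nontriv: "nontrivial T u"
begin

sublocale coefficient T a
  using T a by unfold_locales

lemma w_pos: "w > 0" and wT: "w * T = (2 * real n - 1) * pi"
  using T n by (auto simp: w_def intro!: divide_pos_pos mult_pos_pos)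

definition \<theta> where "\<theta> = prufer_angle T a 0"

lemma theta: "prufer_solution 0 T a \<theta>" "\<theta> 0 = 0"
  using angle[of 0] by (simp_all add: \<theta>_def)

lemma polar:
  assumes "t \<in> {0..T}"
  shows "u t = v 0 * amplitude 0 a \<theta> t * sin (\<theta> t)" "v t = v 0 * amplitude 0 a \<theta> t * cos (\<theta> t)"
  using solves_polar[OF sol a theta(1), of "v 0" t] assms by (auto simp: theta u0)

lemma v0: "v 0 \<noteq> 0"
  using nontriv polar(1) by (auto simp: nontrivial_def)

lemma u_zero_iff: "t \<in> {0..T} \<Longrightarrow> u t = 0 \<longleftrightarrow> sin (\<theta> t) = 0"
  and v_zero_iff: "t \<in> {0..T} \<Longrightarrow> v t = 0 \<longleftrightarrow> cos (\<theta> t) = 0"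
  using polar[of t] v0 amplitude_pos[of 0 a \<theta> t] by auto

text \<open>As the coefficient is positive, the angle increases everywhere and not only at multiples of \<open>\<pi>\<close>.
  The zeros of \<open>u\<close> and \<open>u'\<close> are therefore the points where it passes the multiples of \<open>\<pi>/2\<close>, and they alternate.\<close>
lemma theta_strict_mono: "0 \<le> s \<Longrightarrow> s < t \<Longrightarrow> t \<le> T \<Longrightarrow> \<theta> s < \<theta> t"
proof (rule primitive_on_strict_mono[OF theta(1)[unfolded prufer_solution_def] N])
  fix x assume x: "x \<in> {0..T} - N"
  have "0 < a x" using above[OF x] w_pos by (smt (verit) zero_less_power)
  then show "0 < prufer_rhs a \<theta> x"
    unfolding prufer_rhs_def using sin_cos_squared_add[of "\<theta> x"]
    by (cases "sin (\<theta> x) = 0") (auto intro!: add_nonneg_pos)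
qed

lemma theta_less_iff: "s \<in> {0..T} \<Longrightarrow> t \<in> {0..T} \<Longrightarrow> \<theta> s < \<theta> t \<longleftrightarrow> s < t"
  using theta_strict_mono[of s t] theta_strict_mono[of t s] by (cases s t rule: linorder_cases) auto

lemma theta_end: obtains m :: nat where "odd m" "\<theta> T = real m * pi"
proof -
  have "odd_pi (turn T a 0)"
  proof -
    have "v 0 * (growth T a 0 * sin (0 + turn T a 0)) = v 0 * (- sin 0)"
      "v 0 * (growth T a 0 * cos (0 + turn T a 0)) = v 0 * (- cos 0)"
      using endpoint_polar[OF sol, of "v 0" 0] u0 uT vT by (simp_all add: mult.assoc)
    then have "growth T a 0 * sin (0 + turn T a 0) = - sin 0" "growth T a 0 * cos (0 + turn T a 0) = - cos 0"
      using mult_left_cancel[OF v0] by blast+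
    then show ?thesis by (rule antiperiodic_direction(2)[OF growth_pos])
  qed
  then obtain k :: int where k: "\<theta> T = (2 * of_int k + 1) * pi" by (auto simp: odd_pi_def turn_def \<theta>_def)
  have "0 < \<theta> T" using theta_strict_mono[of 0 T] T theta(2) by simp
  then have "0 < 2 * real_of_int k + 1" by (simp add: k zero_less_mult_iff)
  then have "k \<ge> 0" by linarith
  then show thesis using that[of "nat (2 * k + 1)"] k by (simp add: even_nat_iff)
qed

text \<open>Up to a constant factor, \<open>u\<close> is positive between two consecutive multiples of \<open>\<pi>/2\<close> of the angle, increasing
  for even \<open>i\<close> and decreasing for odd \<open>i\<close>.\<close>
lemma quarter:
  fixes i :: nat
  assumes pr: "0 \<le> p" "p < r" "r \<le> T" and th: "\<theta> p = real i * (pi / 2)" "\<theta> r = real (i + 1) * (pi / 2)"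
  shows "w * (r - p) \<le> pi / 2"
    "w * cot (w * (r - p)) \<le> integral {p..r} (\<lambda>t. a t - w\<^sup>2)"
    "w * (r - p) = pi / 2 \<Longrightarrow> integral {p..r} (\<lambda>t. a t - w\<^sup>2) = 0"
    "w * (r - p) < pi / 2 \<Longrightarrow> w * cot (w * (r - p)) < integral {p..r} (\<lambda>t. a t - w\<^sup>2)"
proof -
  define j where "j = i div 2"
  (* The factor that makes u positive on this quarter wave. *)
  define s where "s = (- 1) ^ j / v 0"
  have a': "a absolutely_integrable_on {p..r}" using a pr by (auto intro: absolutely_integrable_on_subinterval)
  have S: "solves p r a (\<lambda>t. s * u t) (\<lambda>t. s * v t)"
    by (intro solves_cmult solves_subinterval[OF sol]) (use pr in auto)
  have above': "\<And>t. t \<in> {p..r} - N \<Longrightarrow> w\<^sup>2 \<le> a t" using above pr by auto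
  have sg: "(- 1) ^ j * ((- 1) ^ j * x) = x" for x :: real
    by (simp add: power_mult_distrib[symmetric] mult.assoc[symmetric])
  have su: "s * u t = amplitude 0 a \<theta> t * sin (\<theta> t - real j * pi)"
    and sv: "s * v t = amplitude 0 a \<theta> t * cos (\<theta> t - real j * pi)" if "t \<in> {p..r}" for t
    using polar[of t] that pr v0 by (auto simp: s_def sin_diff cos_diff mult_ac)
  have mono: "p \<le> t \<Longrightarrow> \<theta> p \<le> \<theta> t" "p < t \<Longrightarrow> \<theta> p < \<theta> t" "t \<le> r \<Longrightarrow> \<theta> t \<le> \<theta> r" "t < r \<Longrightarrow> \<theta> t < \<theta> r"
    if "t \<in> {p..r}" for t
    using theta_strict_mono[of p t] theta_strict_mono[of t r] that pr by (cases "t = p"; cases "t = r"; auto)+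
  note A = amplitude_pos[of 0 a \<theta>]
  have "w * (r - p) \<le> pi / 2 \<and> w * cot (w * (r - p)) \<le> integral {p..r} (\<lambda>t. a t - w\<^sup>2) \<and>
      (w * (r - p) = pi / 2 \<longrightarrow> integral {p..r} (\<lambda>t. a t - w\<^sup>2) = 0) \<and>
      (w * (r - p) < pi / 2 \<longrightarrow> w * cot (w * (r - p)) < integral {p..r} (\<lambda>t. a t - w\<^sup>2))" (is ?Q)
  proof (cases "even i")
    case True
    then have i: "i = 2 * j" by (simp add: j_def)
    have e: "\<theta> p - real j * pi = 0" "\<theta> r - real j * pi = pi / 2" using th by (simp_all add: i algebra_simps)
    have "s * u p = 0" "s * v r = 0" using su[of p] sv[of r] e pr by auto
    moreover have "s * u t > 0" if "t \<in> {p<..r}" for t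
      using su[of t] that mono[of t] e pi_gt_zero A by (auto intro!: mult_pos_pos sin_gt_zero)
    moreover have "s * v t \<ge> 0" if "t \<in> {p..r}" for t
      unfolding sv[OF that] using that mono[of t] e pi_gt_zero A by (auto intro!: mult_nonneg_nonneg cos_ge_zero simp: less_imp_le)
    ultimately show ?Q
      using quarter_wave[OF a' S pr(2) w_pos N above'] by auto
  next
    case False
    then have i: "i = 2 * j + 1" by (simp add: j_def)
    have e: "\<theta> p - real j * pi = pi / 2" "\<theta> r - real j * pi = pi" using th by (simp_all add: i algebra_simps)
    have "s * v p = 0" "s * u r = 0" using su[of r] sv[of p] e pr by auto
    moreover have "s * u t > 0" if "t \<in> {p..<r}" for t
      using su[of t] that mono[of t] e pi_gt_zero A by (auto intro!: mult_pos_pos sin_gt_zero)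
    moreover have "s * v t \<le> 0" if "t \<in> {p..r}" for t
    proof -
      have "0 \<le> cos (pi - (\<theta> t - real j * pi))" using that mono[of t] e pi_gt_zero by (intro cos_ge_zero) auto
      then show ?thesis unfolding sv[OF that] using A[of t] by (simp add: mult_nonneg_nonpos less_imp_le)
    qed
    ultimately show ?Q
      using quarter_wave_descending[OF a' S pr(2) w_pos N above'] by auto
  qed
  then show "w * (r - p) \<le> pi / 2"
    "w * cot (w * (r - p)) \<le> integral {p..r} (\<lambda>t. a t - w\<^sup>2)"
    "w * (r - p) = pi / 2 \<Longrightarrow> integral {p..r} (\<lambda>t. a t - w\<^sup>2) = 0"
    "w * (r - p) < pi / 2 \<Longrightarrow> w * cot (w * (r - p)) < integral {p..r} (\<lambda>t. a t - w\<^sup>2)"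
    by blast+
qed

end

context resonant_solution
begin

lemma theta_range:
  assumes "t \<in> {0..T}" shows "0 \<le> \<theta> t" "\<theta> t \<le> \<theta> T" "0 < t \<Longrightarrow> 0 < \<theta> t" "t < T \<Longrightarrow> \<theta> t < \<theta> T"
  using theta_strict_mono[of 0 t] theta_strict_mono[of t T] assms theta(2) by (cases "t = 0"; cases "t = T"; auto)+

lemma theta_inj: "s \<in> {0..T} \<Longrightarrow> t \<in> {0..T} \<Longrightarrow> \<theta> s = \<theta> t \<Longrightarrow> s = t"
  using theta_less_iff[of s t] theta_less_iff[of t s] by (cases s t rule: linorder_cases) auto

lemma sin_theta_zero_iff:
  assumes "t \<in> {0..T}"
  shows "sin (\<theta> t) = 0 \<longleftrightarrow> (\<exists>k::nat. \<theta> t = real (2 * k) * (pi / 2))"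
proof
  assume "sin (\<theta> t) = 0"
  then obtain k :: int where k: "\<theta> t = of_int k * pi" by (auto simp: sin_zero_iff_int2)
  then have "0 \<le> real_of_int k" using theta_range(1)[OF assms] pi_gt_zero by (simp add: zero_le_mult_iff)
  then show "\<exists>k::nat. \<theta> t = real (2 * k) * (pi / 2)" using k by (intro exI[of _ "nat k"]) simp
qed (auto simp: sin_npi)

lemma cos_theta_zero_iff:
  assumes "t \<in> {0..T}"
  shows "cos (\<theta> t) = 0 \<longleftrightarrow> (\<exists>k::nat. \<theta> t = real (2 * k + 1) * (pi / 2))"
proof
  assume "cos (\<theta> t) = 0"
  then obtain k :: int where k: "odd k" "\<theta> t = of_int k * (pi / 2)" by (auto simp: cos_zero_iff_int)
  then have "0 \<le> real_of_int k" using theta_range(1)[OF assms] by (smt (verit) mult_neg_pos pi_half_gt_zero)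
  moreover obtain j where "k = 2 * j + 1" using k(1) by (rule oddE)
  ultimately show "\<exists>k::nat. \<theta> t = real (2 * k + 1) * (pi / 2)" using k(2) by (intro exI[of _ "nat j"]) simp
next
  assume "\<exists>k::nat. \<theta> t = real (2 * k + 1) * (pi / 2)"
  then obtain k :: nat where "\<theta> t = of_int (2 * int k + 1) * (pi / 2)" by auto
  then show "cos (\<theta> t) = 0" unfolding cos_zero_iff_int by (metis odd_two_times_div_two_succ even_plus_one_iff even_mult_iff even_numeral)
qed

lemma zero_enum_from_angle:
  assumes m: "\<theta> T = real m * pi"
  shows "\<exists>x. zero_enum T u v m x"
proof -
  have "\<exists>t\<in>{0..T}. \<theta> t = real i * (pi / 2)" if "i \<le> 2 * m" for i :: nat
  proof -
    have "real i * (pi / 2) \<le> real (2 * m) * (pi / 2)" using that by (intro mult_right_mono) auto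
    then show ?thesis
      using IVT'[of \<theta> 0 "real i * (pi / 2)" T] prufer_continuous[OF theta(1)] T theta(2) m by auto
  qed
  then obtain x where x: "\<And>i. i \<le> 2 * m \<Longrightarrow> x i \<in> {0..T} \<and> \<theta> (x i) = real i * (pi / 2)" by metis
  have "zero_enum T u v m x"
    unfolding zero_enum_def
  proof (intro conjI allI impI)
    show "x 0 = 0" using x[of 0] theta_inj[of "x 0" 0] theta(2) T by simp
    show "x (2 * m) = T" using x[of "2 * m"] theta_inj[of "x (2 * m)" T] m T by simp
    show "x i < x (i + 1)" if "i < 2 * m" for i
    proof -
      have "real i * (pi / 2) < real (i + 1) * (pi / 2)" by (intro mult_strict_right_mono) auto
      moreover have "\<theta> (x i) = real i * (pi / 2)" "\<theta> (x (i + 1)) = real (i + 1) * (pi / 2)"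
        "x i \<in> {0..T}" "x (i + 1) \<in> {0..T}" using x[of i] x[of "i + 1"] that by auto
      ultimately show ?thesis using theta_less_iff[of "x i" "x (i + 1)"] by (simp only:)
    qed
    show "{t \<in> {0..T}. u t = 0} = (\<lambda>j. x (2 * j)) ` {..m}"
    proof (intro set_eqI iffI)
      fix t assume t: "t \<in> {t \<in> {0..T}. u t = 0}"
      then obtain k :: nat where k: "\<theta> t = real (2 * k) * (pi / 2)" using u_zero_iff[of t] sin_theta_zero_iff[of t] by auto
      have "real k * pi \<le> real m * pi" using theta_range(2)[of t] k m t by simp
      then have "k \<le> m" by simp
      then have "x (2 * k) \<in> {0..T}" "\<theta> t = \<theta> (x (2 * k))" using x[of "2 * k"] k by auto
      then have "t = x (2 * k)" using theta_inj[of t "x (2 * k)"] t by auto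
      then show "t \<in> (\<lambda>j. x (2 * j)) ` {..m}" using \<open>k \<le> m\<close> by auto
    next
      fix t assume "t \<in> (\<lambda>j. x (2 * j)) ` {..m}"
      then obtain j where j: "j \<le> m" "t = x (2 * j)" by auto
      then have xt: "t \<in> {0..T}" "\<theta> t = real (2 * j) * (pi / 2)" using x[of "2 * j"] by auto
      then have "u t = 0" using u_zero_iff[of t] sin_theta_zero_iff[of t] by blast
      then show "t \<in> {t \<in> {0..T}. u t = 0}" using xt by simp
    qed
    show "{t \<in> {0<..<T}. v t = 0} = (\<lambda>j. x (2 * j + 1)) ` {..<m}"
    proof (intro set_eqI iffI)
      fix t assume t: "t \<in> {t \<in> {0<..<T}. v t = 0}"
      then obtain k :: nat where k: "\<theta> t = real (2 * k + 1) * (pi / 2)" using v_zero_iff[of t] cos_theta_zero_iff[of t] by auto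
      have "real (2 * k + 1) * (pi / 2) < real (2 * m) * (pi / 2)" using theta_range(4)[of t] k m t by simp
      then have "real (2 * k + 1) < real (2 * m)" by (subst (asm) mult_less_cancel_right) auto
      then have "k < m" by simp
      then have "x (2 * k + 1) \<in> {0..T}" "\<theta> t = \<theta> (x (2 * k + 1))" using x[of "2 * k + 1"] k by auto
      then have "t = x (2 * k + 1)" using theta_inj[of t "x (2 * k + 1)"] t by auto
      then show "t \<in> (\<lambda>j. x (2 * j + 1)) ` {..<m}" using \<open>k < m\<close> by auto
    next
      fix t assume "t \<in> (\<lambda>j. x (2 * j + 1)) ` {..<m}"
      then obtain j where j: "j < m" "t = x (2 * j + 1)" by auto
      then have xt: "t \<in> {0..T}" "\<theta> t = real (2 * j + 1) * (pi / 2)" using x[of "2 * j + 1"] by auto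
      have "v t = 0" using v_zero_iff[of t] cos_theta_zero_iff[of t] xt by blast
      moreover have "t \<noteq> 0" using xt theta(2) by auto
      moreover have "t \<noteq> T"
      proof
        assume "t = T"
        then have "real (2 * j + 1) * (pi / 2) = real (2 * m) * (pi / 2)" using xt m by simp
        then have "real (2 * j + 1) = real (2 * m)" by (subst (asm) mult_cancel_right) auto
        then have "2 * j + 1 = 2 * m" by (simp only: of_nat_eq_iff)
        then show False by presburger
      qed
      ultimately show "t \<in> {t \<in> {0<..<T}. v t = 0}" using xt by auto
    qed
  qed
  then show ?thesis by blast
qed

lemma zero_enum_exists: "\<exists>m x. zero_enum T u v m x"
  using theta_end zero_enum_from_angle by metis

text \<open>An enumeration of the zeros cannot skip a multiple of \<open>\<pi>/2\<close>: the point where it is taken would be an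
  enumerated point strictly between two consecutive ones.\<close>
lemma zero_enum_angle:
  assumes e: "zero_enum T u v m x"
  shows "\<And>i. i \<le> 2 * m \<Longrightarrow> x i \<in> {0..T}" "\<And>i. i \<le> 2 * m \<Longrightarrow> \<theta> (x i) = real i * (pi / 2)" "odd m"
proof -
  have x0: "x 0 = 0" and xT: "x (2 * m) = T" and step: "\<And>i. i < 2 * m \<Longrightarrow> x i < x (i + 1)"
    and uz: "{t \<in> {0..T}. u t = 0} = (\<lambda>j. x (2 * j)) ` {..m}"
    and vz: "{t \<in> {0<..<T}. v t = 0} = (\<lambda>j. x (2 * j + 1)) ` {..<m}"
    using e by (auto simp: zero_enum_def)
  obtain M where M: "odd M" "\<theta> T = real M * pi" using theta_end .
  have less: "x i < x j" if "i < j" "j \<le> 2 * m" for i j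
    using that
  proof (induction j)
    case (Suc j)
    then show ?case using step[of j] by (cases "i = j") force+
  qed simp
  have in_enum: "\<exists>i\<le>2 * m. t = x i" if t: "t \<in> {0..T}" "\<theta> t = real k * (pi / 2)" for t and k :: nat
  proof (cases "even k")
    case True
    then have "u t = 0" using u_zero_iff[OF t(1)] sin_theta_zero_iff[OF t(1)] t(2) by (metis evenE)
    then have "t \<in> (\<lambda>j. x (2 * j)) ` {..m}" using uz t(1) by blast
    then obtain j where "j \<le> m" "t = x (2 * j)" by auto
    then show ?thesis by (intro exI[of _ "2 * j"]) simp
  next
    case False
    then have c: "cos (\<theta> t) = 0" using cos_theta_zero_iff[OF t(1)] t(2) by (metis oddE)
    then have "v t = 0" using v_zero_iff[OF t(1)] by simp
    moreover have "t \<noteq> 0" using c theta(2) by auto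
    moreover have "t \<noteq> T" using c M(2) by (auto simp: cos_npi)
    ultimately have "t \<in> (\<lambda>j. x (2 * j + 1)) ` {..<m}" using vz t(1) by auto
    then obtain j where "j < m" "t = x (2 * j + 1)" by auto
    then show ?thesis by (intro exI[of _ "2 * j + 1"]) simp
  qed
  have enum: "x i \<in> {0..T} \<and> (\<exists>k::nat. \<theta> (x i) = real k * (pi / 2))" if "i \<le> 2 * m" for i
  proof (cases "even i")
    case True
    then have "x i \<in> (\<lambda>j. x (2 * j)) ` {..m}" using that by (auto elim!: evenE)
    then have "x i \<in> {t \<in> {0..T}. u t = 0}" using uz by simp
    then show ?thesis using u_zero_iff sin_theta_zero_iff by blast
  next
    case False
    then have "x i \<in> (\<lambda>j. x (2 * j + 1)) ` {..<m}" using that by (auto elim!: oddE)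
    then have "x i \<in> {t \<in> {0<..<T}. v t = 0}" using vz by simp
    then have "x i \<in> {0..T}" "v (x i) = 0" by auto
    then show ?thesis using v_zero_iff cos_theta_zero_iff by blast
  qed
  show xi: "x i \<in> {0..T}" if "i \<le> 2 * m" for i using enum[OF that] by blast
  show th: "\<theta> (x i) = real i * (pi / 2)" if "i \<le> 2 * m" for i
    using that
  proof (induction i)
    case 0 then show ?case using x0 theta(2) by simp
  next
    case (Suc i)
    then have IH: "\<theta> (x i) = real i * (pi / 2)" by simp
    obtain k :: nat where k: "\<theta> (x (Suc i)) = real k * (pi / 2)" using enum[OF Suc.prems] by blast
    have xs: "x i < x (Suc i)" using step[of i] Suc.prems by simp
    then have "\<theta> (x i) < \<theta> (x (Suc i))" using theta_less_iff xi[of i] xi[of "Suc i"] Suc.prems by simp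
    then have "real i < real k" unfolding IH k by (simp add: mult_less_cancel_right)
    then have ik: "Suc i \<le> k" by simp
    show ?case
    proof (rule ccontr)
      assume "\<theta> (x (Suc i)) \<noteq> real (Suc i) * (pi / 2)"
      then have "Suc i < k" using ik k by (cases "k = Suc i") auto
      then have lt: "real (Suc i) * (pi / 2) < \<theta> (x (Suc i))" unfolding k by (intro mult_strict_right_mono) auto
      have gt: "\<theta> (x i) < real (Suc i) * (pi / 2)" unfolding IH by (intro mult_strict_right_mono) auto
      have sub: "{x i..x (Suc i)} \<subseteq> {0..T}" using xi[of i] xi[of "Suc i"] Suc.prems by auto
      obtain t where t: "x i \<le> t" "t \<le> x (Suc i)" "\<theta> t = real (Suc i) * (pi / 2)"
        using IVT'[of \<theta> "x i" "real (Suc i) * (pi / 2)" "x (Suc i)"] lt gt xs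
          continuous_on_subset[OF prufer_continuous[OF theta(1)] sub] by auto
      then obtain j where j: "j \<le> 2 * m" "t = x j" using in_enum[of t "Suc i"] sub by auto
      have "t \<noteq> x i" "t \<noteq> x (Suc i)" using t(3) lt gt by auto
      then have "x i < x j" "x j < x (Suc i)" using t j by auto
      then have "i < j" "j < Suc i" using less j(1) Suc.prems by (metis less_asym linorder_neqE_nat order_less_imp_le le_trans Suc_leD)+
      then show False by simp
    qed
  qed
  have "real M * pi = real m * pi" using th[of "2 * m"] xT M(2) by simp
  then show "odd m" using M(1) by simp
qed

lemma zero_enum_quarter:
  assumes e: "zero_enum T u v m x" and i: "i < 2 * m"
  shows "w * (x (i + 1) - x i) \<le> pi / 2"
    "w * cot (w * (x (i + 1) - x i)) \<le> integral {x i..x (i + 1)} (\<lambda>t. a t - w\<^sup>2)"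
    "w * (x (i + 1) - x i) = pi / 2 \<Longrightarrow> integral {x i..x (i + 1)} (\<lambda>t. a t - w\<^sup>2) = 0"
    "w * (x (i + 1) - x i) < pi / 2 \<Longrightarrow> w * cot (w * (x (i + 1) - x i)) < integral {x i..x (i + 1)} (\<lambda>t. a t - w\<^sup>2)"
    "0 \<le> x i" "x i < x (i + 1)" "x (i + 1) \<le> T"
proof -
  show s: "0 \<le> x i" "x i < x (i + 1)" "x (i + 1) \<le> T"
    using zero_enum_angle(1)[OF e, of i] zero_enum_angle(1)[OF e, of "i + 1"] i e by (auto simp: zero_enum_def)
  note Q = quarter[OF s zero_enum_angle(2)[OF e, of i] zero_enum_angle(2)[OF e, of "i + 1"]]
  show "w * (x (i + 1) - x i) \<le> pi / 2"
    "w * cot (w * (x (i + 1) - x i)) \<le> integral {x i..x (i + 1)} (\<lambda>t. a t - w\<^sup>2)"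
    "w * (x (i + 1) - x i) = pi / 2 \<Longrightarrow> integral {x i..x (i + 1)} (\<lambda>t. a t - w\<^sup>2) = 0"
    "w * (x (i + 1) - x i) < pi / 2 \<Longrightarrow> w * cot (w * (x (i + 1) - x i)) < integral {x i..x (i + 1)} (\<lambda>t. a t - w\<^sup>2)"
    using Q i by auto
qed

lemma excess_absolutely_integrable: "(\<lambda>t. a t - w\<^sup>2) absolutely_integrable_on {0..T}"
  by (intro set_integral_diff a absolutely_integrable_continuous_real continuous_intros)

lemma zero_enum_integral_sum:
  assumes e: "zero_enum T u v m x"
  shows "integral {0..T} (\<lambda>t. a t - w\<^sup>2) = (\<Sum>i<2*m. integral {x i..x (i + 1)} (\<lambda>t. a t - w\<^sup>2))"
proof -
  let ?f = "\<lambda>t. a t - w\<^sup>2"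
  have F: "primitive_on 0 T (\<lambda>t. integral {0..t} ?f) ?f"
    using primitive_on_indefinite_integral[OF excess_absolutely_integrable, of 0] by simp
  have "(\<Sum>i<2*m. integral {x i..x (i + 1)} ?f) = (\<Sum>i<2*m. integral {0..x (Suc i)} ?f - integral {0..x i} ?f)"
  proof (rule sum.cong[OF refl])
    fix i assume "i \<in> {..<2*m}"
    then show "integral {x i..x (i + 1)} ?f = integral {0..x (Suc i)} ?f - integral {0..x i} ?f"
      using primitive_on_integral(1)[OF F, of "x i" "x (i + 1)"] zero_enum_quarter(5-7)[OF e, of i] by simp
  qed
  also have "\<dots> = integral {0..x (2 * m)} ?f - integral {0..x 0} ?f"
    by (rule sum_lessThan_telescope)
  finally show ?thesis using e by (simp add: zero_enum_def)
qed

lemma zero_enum_length_sum: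
  assumes e: "zero_enum T u v m x"
  shows "(\<Sum>i<2*m. w * (x (i + 1) - x i)) = (2 * real n - 1) * pi"
proof -
  have "(\<Sum>i<2*m. w * (x (i + 1) - x i)) = w * (x (2 * m) - x 0)"
    using sum_lessThan_telescope[of x "2 * m"] by (simp add: sum_distrib_left[symmetric])
  then show ?thesis using e wT by (simp add: zero_enum_def)
qed

text \<open>If all quarter waves had maximal length, the excess would vanish on each of them.\<close>
lemma zero_enum_strict:
  assumes e: "zero_enum T u v m x"
  shows "\<exists>i<2 * m. w * (x (i + 1) - x i) < pi / 2"
proof (rule ccontr)
  assume "\<not> ?thesis"
  then have "w * (x (i + 1) - x i) = pi / 2" if "i < 2 * m" for i
    using zero_enum_quarter(1)[OF e that] that by force
  then have "(\<Sum>i<2*m. integral {x i..x (i + 1)} (\<lambda>t. a t - w\<^sup>2)) = 0"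
    using zero_enum_quarter(3)[OF e] by (intro sum.neutral) auto
  then show False using excess zero_enum_integral_sum[OF e] by simp
qed

text \<open>The \<open>2m\<close> quarter waves cover \<open>[0, T]\<close>, and not all of them have the maximal length \<open>T / (2(2n-1))\<close>; hence
  \<open>m > 2n-1\<close>, and \<open>m\<close> is odd.\<close>
lemma zero_enum_count:
  assumes e: "zero_enum T u v m x"
  shows "odd m" "m \<ge> 2 * n + 1"
proof -
  show o: "odd m" by (rule zero_enum_angle(3)[OF e])
  obtain i where i: "i < 2 * m" "w * (x (i + 1) - x i) < pi / 2" using zero_enum_strict[OF e] by blast
  have "(\<Sum>i<2*m. w * (x (i + 1) - x i)) < (\<Sum>i<2*m. pi / 2)"
    using zero_enum_quarter(1)[OF e] i by (intro sum_strict_mono_ex1) auto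
  then have "(2 * real n - 1) * pi < real m * pi" using zero_enum_length_sum[OF e] by simp
  then have "2 * real n - 1 < real m" by (subst (asm) mult_less_cancel_right) auto
  then have "2 * n \<le> m" by linarith
  then show "m \<ge> 2 * n + 1" using o by (cases "m = 2 * n") auto
qed

text \<open>Sum the quarter wave estimates, replacing the cotangent by its tangent at \<open>y0\<close>, the common value of \<open>y i\<close>
  for \<open>2(2n+1)\<close> quarter waves of equal length. As the sum of the \<open>y i\<close> is fixed and \<open>cot y0\<close> is
  positive, the resulting bound increases with the number of quarter waves, so that \<open>m = 2n+1\<close> is the worst
  case. One quarter wave is shorter than maximal and contributes a strict inequality.\<close>
lemma excess_lower_bound:
  "2 * (2 * real n + 1) * w * cot ((2 * real n - 1) * pi / (2 * (2 * real n + 1))) < integral {0..T} (\<lambda>t. a t - w\<^sup>2)"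
proof -
  obtain m x where e: "zero_enum T u v m x" using zero_enum_exists by blast
  define y where "y i = w * (x (i + 1) - x i)" for i
  define y0 where "y0 = (2 * real n - 1) * pi / (2 * (2 * real n + 1))"
  define I where "I i = integral {x i..x (i + 1)} (\<lambda>t. a t - w\<^sup>2)" for i
  define S where "S = inverse ((sin y0)\<^sup>2)"
  have S0: "S \<ge> 0" by (simp add: S_def)
  have "(2 * real n - 1) / (2 * (2 * real n + 1)) * pi < 1 / 2 * pi"
    by (intro mult_strict_right_mono) (auto simp: field_simps)
  then have y0: "0 < y0" "y0 < pi / 2" using n by (auto simp: y0_def)
  have c0: "0 < cot y0" using y0 by (intro cot_gt_zero)
  have y: "0 < y i" "y i \<le> pi / 2" if "i < 2 * m" for i
    using zero_enum_quarter(1,6)[OF e that] w_pos by (auto simp: y_def)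
  have ge: "w * (cot y0 - (y i - y0) * S) \<le> w * cot (y i)" if "i < 2 * m" for i
    unfolding S_def using cot_tangent_line[OF y[OF that] y0] w_pos by (intro mult_left_mono) auto
  have sy: "(\<Sum>i<2*m. y i) = 2 * (2 * real n + 1) * y0"
  proof -
    have "2 * (2 * real n + 1) > 0" by simp
    then have "2 * (2 * real n + 1) * y0 = (2 * real n - 1) * pi" by (simp add: y0_def)
    then show ?thesis using zero_enum_length_sum[OF e] by (simp add: y_def)
  qed
  have "2 * (2 * real n + 1) * (w * cot y0) \<le> 2 * real m * (w * cot y0)"
    using zero_enum_count(2)[OF e] w_pos c0 by (intro mult_right_mono) auto
  also have "\<dots> \<le> 2 * real m * (w * cot y0) + w * ((2 * real m - 2 * (2 * real n + 1)) * y0 * S)"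
    using zero_enum_count(2)[OF e] w_pos y0 S0 by simp
  also have "\<dots> = w * (\<Sum>i<2*m. cot y0 - (y i - y0) * S)"
  proof -
    have eq: "(\<Sum>i<2*m. cot y0 - (y i - y0) * S) = 2 * real m * cot y0 - (2 * (2 * real n + 1) * y0 - 2 * real m * y0) * S"
      by (simp add: sum_subtractf sum_distrib_right[symmetric] sy)
    show ?thesis unfolding eq by (simp add: algebra_simps)
  qed
  also have "\<dots> = (\<Sum>i<2*m. w * (cot y0 - (y i - y0) * S))" by (rule sum_distrib_left)
  also have "\<dots> < (\<Sum>i<2*m. I i)"
  proof (rule sum_strict_mono_ex1)
    show "\<forall>i\<in>{..<2*m}. w * (cot y0 - (y i - y0) * S) \<le> I i"
      using ge zero_enum_quarter(2)[OF e] by (fastforce simp: I_def y_def)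
    obtain i where "i < 2 * m" "y i < pi / 2" using zero_enum_strict[OF e] by (auto simp: y_def)
    then show "\<exists>i\<in>{..<2*m}. w * (cot y0 - (y i - y0) * S) < I i"
      using ge[of i] zero_enum_quarter(4)[OF e, of i] by (intro bexI[of _ i]) (auto simp: I_def y_def)
  qed simp
  also have "\<dots> = integral {0..T} (\<lambda>t. a t - w\<^sup>2)" using zero_enum_integral_sum[OF e] by (simp add: I_def)
  finally show ?thesis by (simp add: y0_def mult.assoc)
qed

end

section \<open>Periodic and antiperiodic continuation\<close>

text \<open>Only the values of \<open>F\<close> on \<open>[0, S)\<close> matter; they are continued with alternating signs.\<close>
definition antiperiodic_ext :: "real \<Rightarrow> (real \<Rightarrow> real) \<Rightarrow> real \<Rightarrow> real" where
  "antiperiodic_ext S F t = (if even \<lfloor>t / S\<rfloor> then 1 else - 1) * F (t - S * of_int \<lfloor>t / S\<rfloor>)"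

lemma antiperiodic_ext_add:
  assumes "S > 0"
  shows "antiperiodic_ext S F (t + S) = - antiperiodic_ext S F t"
proof -
  have "\<lfloor>(t + S) / S\<rfloor> = \<lfloor>t / S\<rfloor> + 1" using assms by (simp add: add_divide_distrib)
  then show ?thesis by (simp add: antiperiodic_ext_def algebra_simps)
qed

lemma antiperiodic_ext_add_mult:
  assumes "S > 0"
  shows "antiperiodic_ext S F (t + real k * S) = (- 1) ^ k * antiperiodic_ext S F t"
proof (induction k)
  case (Suc k)
  have eq: "t + real (Suc k) * S = (t + real k * S) + S" by (simp add: algebra_simps)
  show ?case unfolding eq using antiperiodic_ext_add[OF assms, of F "t + real k * S"] Suc by simp
qed simp

lemma antiperiodic_ext_start:
  assumes "S > 0" "0 \<le> t" "t < S"
  shows "antiperiodic_ext S F t = F t"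
proof -
  have "\<lfloor>t / S\<rfloor> = 0" using assms by (simp add: floor_eq_iff)
  then show ?thesis by (simp add: antiperiodic_ext_def)
qed

lemma antiperiodic_ext_cell:
  assumes S: "S > 0" and F: "F S = - F 0" and t: "t \<in> {0..S}"
  shows "antiperiodic_ext S F t = F t"
proof (cases "t = S")
  case True
  then show ?thesis using antiperiodic_ext_add[OF S, of F 0] antiperiodic_ext_start[OF S, of 0 F] S F by simp
next
  case False
  then show ?thesis using antiperiodic_ext_start[OF S, of t F] t by simp
qed

lemma primitive_on_antiperiodic_ext:
  assumes S: "S > 0" and F: "primitive_on 0 S F f" and FS: "F S = - F 0"
  shows "primitive_on 0 (real m * S) (antiperiodic_ext S F) (antiperiodic_ext S f)"
proof (induction m)
  case 0
  show ?case by (simp add: primitive_on_def absolutely_integrable_negligible)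
next
  case (Suc m)
  have "primitive_on (0 - - (real m * S)) (S - - (real m * S)) (\<lambda>x. F (x + - (real m * S))) (\<lambda>x. f (x + - (real m * S)))"
    by (rule primitive_on_shift[OF F])
  then have "primitive_on (real m * S) (real (Suc m) * S) (\<lambda>x. F (x - real m * S)) (\<lambda>x. f (x - real m * S))"
    by (simp add: algebra_simps)
  from primitive_on_cmult[OF this, of "(- 1) ^ m"]
  have "primitive_on (real m * S) (real (Suc m) * S) (antiperiodic_ext S F) (antiperiodic_ext S f)"
  proof (rule primitive_on_cong[of _ _ _ _ _ "{real (Suc m) * S}"])
    fix x assume x: "x \<in> {real m * S..real (Suc m) * S}"
    then have "x - real m * S \<in> {0..S}" by (simp add: algebra_simps)
    then show "(- 1) ^ m * F (x - real m * S) = antiperiodic_ext S F x"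
      using antiperiodic_ext_add_mult[OF S, of F "x - real m * S" m] antiperiodic_ext_cell[OF S FS] by simp
  next
    fix x assume x: "x \<in> {real m * S..real (Suc m) * S} - {real (Suc m) * S}"
    then have "0 \<le> x - real m * S" "x - real m * S < S" by (auto simp: algebra_simps)
    then show "(- 1) ^ m * f (x - real m * S) = antiperiodic_ext S f x"
      using antiperiodic_ext_add_mult[OF S, of f "x - real m * S" m] antiperiodic_ext_start[OF S, of _ f] by simp
  qed auto
  then show ?case
    using S by (intro primitive_on_combine[OF Suc]) (auto simp: mult_right_mono)
qed

lemma periodic_int_mult:
  assumes "\<And>x. q (x + S) = q x"
  shows "q (x - S * of_int k) = q (x :: real)"
proof -
  have nat: "q (x + S * real m) = q x" for x and m :: nat
  proof (induction m)
    case (Suc m)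
    have eq: "x + S * real (Suc m) = (x + S * real m) + S" by (simp add: algebra_simps)
    show ?case unfolding eq using assms[of "x + S * real m"] Suc by simp
  qed simp
  show ?thesis
  proof (cases "k \<ge> 0")
    case True
    then show ?thesis using nat[of "x - S * of_int k" "nat k"] by simp
  next
    case False
    then show ?thesis using nat[of x "nat (- k)"] by simp
  qed
qed

lemma solves_antiperiodic_ext:
  assumes S: "S > 0" and sol: "solves 0 S q u v" and bc: "u S = - u 0" "v S = - v 0"
    and per: "\<And>x. q (x + S) = q x"
  shows "solves 0 (real m * S) q (antiperiodic_ext S u) (antiperiodic_ext S v)"
proof -
  have "antiperiodic_ext S (\<lambda>t. - q t * u t) = (\<lambda>t. - q t * antiperiodic_ext S u t)"
    by (rule ext) (simp add: antiperiodic_ext_def periodic_int_mult[of q, OF per])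
  then show ?thesis
    using primitive_on_antiperiodic_ext[OF S _ bc(1), of v m] primitive_on_antiperiodic_ext[OF S _ bc(2), of "\<lambda>t. - q t * u t" m] sol
    by (simp add: solves_def)
qed

lemma periodic_primitive:
  fixes f :: "real \<Rightarrow> real" and S :: real
  assumes S: "S > 0" and f: "f absolutely_integrable_on {0..S}" and per: "\<And>x. f (x + S) = f x"
  shows "f absolutely_integrable_on {0..real m * S}" "integral {0..real m * S} f = real m * integral {0..S} f"
proof -
  have "f absolutely_integrable_on {0..real m * S} \<and> integral {0..real m * S} f = real m * integral {0..S} f"
  proof (induction m)
    case 0
    show ?case by (simp add: absolutely_integrable_negligible)
  next
    case (Suc m)
    have "primitive_on 0 S (\<lambda>x. integral {0..x} f) f"
      using primitive_on_indefinite_integral[OF f, of 0] by simp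
    from primitive_on_shift[OF this, of "- (real m * S)"]
    have "primitive_on (real m * S) (S + real m * S) (\<lambda>x. integral {0..x - real m * S} f) (\<lambda>x. f (x - real m * S))"
      by simp
    moreover have "(\<lambda>x. f (x - real m * S)) = f"
      using periodic_int_mult[of f S _ "int m"] per by (simp add: mult.commute)
    moreover have "S + real m * S = real (Suc m) * S" by (simp add: algebra_simps)
    ultimately have P: "primitive_on (real m * S) (real (Suc m) * S) (\<lambda>x. integral {0..x - real m * S} f) f"
      by (simp only:)
    have S1: "0 \<le> real m * S" "real m * S \<le> real (Suc m) * S" using S by (auto simp: mult_right_mono)
    have "integral {real m * S..real (Suc m) * S} f = integral {0..S} f"
      using primitive_on_integral(1)[OF P, of "real m * S" "real (Suc m) * S"] S1 by (simp add: algebra_simps)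
    moreover have ai: "f absolutely_integrable_on {0..real (Suc m) * S}"
      using absolutely_integrable_on_combine[OF _ primitive_on_absolutely_integrable[OF P]] Suc S1 by blast
    moreover have "integral {0..real (Suc m) * S} f = integral {0..real m * S} f + integral {real m * S..real (Suc m) * S} f"
      using S1 ai by (intro Henstock_Kurzweil_Integration.integral_combine[symmetric]) (auto simp: set_lebesgue_integral_eq_integral(1))
    ultimately show ?case using Suc by (simp add: algebra_simps)
  qed
  then show "f absolutely_integrable_on {0..real m * S}" "integral {0..real m * S} f = real m * integral {0..S} f" by auto
qed

lemma periodic_shift:
  fixes f :: "real \<Rightarrow> real" and S :: real
  assumes S: "S > 0" and f: "f absolutely_integrable_on {0..S}" and per: "\<And>x. f (x + S) = f x" and c: "c \<in> {0..S}"
  shows "(\<lambda>t. f (t + c)) absolutely_integrable_on {0..S}" "integral {0..S} (\<lambda>t. f (t + c)) = integral {0..S} f"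
proof -
  have f2: "f absolutely_integrable_on {0..2 * S}" using periodic_primitive(1)[OF S f per, of 2] by simp
  have P: "primitive_on 0 (2 * S) (\<lambda>x. integral {0..x} f) f"
    using primitive_on_indefinite_integral[OF f2, of 0] by simp
  have Pc: "primitive_on 0 S (\<lambda>x. integral {0..x + c} f) (\<lambda>t. f (t + c))"
    by (rule primitive_on_subinterval[OF primitive_on_shift[OF P, of c]]) (use c S in auto)
  then show "(\<lambda>t. f (t + c)) absolutely_integrable_on {0..S}" by (rule primitive_on_absolutely_integrable)
  have 1: "integral {0..S} (\<lambda>t. f (t + c)) = integral {0..S + c} f - integral {0..c} f"
    using primitive_on_integral(1)[OF Pc, of 0 S] S by simp
  have "primitive_on 0 S (\<lambda>x. integral {0..x + S} f) f"
    using primitive_on_subinterval[OF primitive_on_shift[OF P, of S], of 0 S] S per by simp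
  from primitive_on_integral(1)[OF this, of 0 c] c
  have "integral {0..S + c} f - integral {0..S} f = integral {0..c} f" by (simp add: add.commute)
  with 1 show "integral {0..S} (\<lambda>t. f (t + c)) = integral {0..S} f" by simp
qed

section \<open>The lower bound for the excess\<close>

text \<open>The integral form is invariant under translations of a periodic coefficient.\<close>
lemma prec_L1_const_iff:
  assumes a: "a absolutely_integrable_on {0..T}"
  shows "prec_L1 T (\<lambda>_. c) a \<longleftrightarrow>
    (\<exists>N. negligible N \<and> (\<forall>t\<in>{0..T} - N. c \<le> a t)) \<and> 0 < integral {0..T} (\<lambda>t. a t - c)"
proof -
  have ai: "(\<lambda>t. a t - c) absolutely_integrable_on {0..T}"
    by (rule absolutely_integrable_diff_const[OF a])
  let ?E = "{x \<in> {0..T}. c < a x}"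
  have "a \<in> borel_measurable (lebesgue_on {0..T})"
    using a by (intro absolutely_integrable_imp_borel_measurable) auto
  then have "{x \<in> space (lebesgue_on {0..T}). c < a x} \<in> sets (lebesgue_on {0..T})" by measurable
  then have E: "?E \<in> sets lebesgue" by (simp add: sets_restrict_space_iff)
  have ae: "(AE x in lebesgue. x \<in> {0..T} \<longrightarrow> c \<le> a x) \<longleftrightarrow> (\<exists>N. negligible N \<and> (\<forall>t\<in>{0..T} - N. c \<le> a t))"
    unfolding AE_lebesgue_iff_negligible by blast
  have "emeasure lebesgue ?E > 0 \<longleftrightarrow> 0 < integral {0..T} (\<lambda>t. a t - c)"
    if N: "negligible N" "\<forall>t\<in>{0..T} - N. c \<le> a t" for N
  proof
    assume pos: "emeasure lebesgue ?E > 0"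
    show "0 < integral {0..T} (\<lambda>t. a t - c)"
    proof (rule ccontr)
      assume "\<not> ?thesis"
      then obtain N' where N': "negligible N'" "\<forall>t\<in>{0..T} - N'. a t - c = 0"
        using ae_zero_if_integral_zero[OF ai N(1)] N(2) by auto
      then have "negligible ?E" by (intro negligible_subset[OF N'(1)]) auto
      then show False using pos by (simp add: negligible_iff_null_sets null_sets_def)
    qed
  next
    assume pos: "0 < integral {0..T} (\<lambda>t. a t - c)"
    show "emeasure lebesgue ?E > 0"
    proof (rule ccontr)
      assume "\<not> ?thesis"
      then have "negligible ?E" using E by (simp add: negligible_iff_null_sets null_sets_def)
      then have "negligible (N \<union> ?E)" using N(1) by (rule negligible_Un[rotated])
      moreover have "a t - c = 0" if "t \<in> {0..T} - (N \<union> ?E)" for t using that N(2) by force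
      ultimately have "integral {0..T} (\<lambda>t. a t - c) = integral {0..T} (\<lambda>_. 0)"
        by (metis (no_types, lifting) integral_spike)
      then show False using pos by simp
    qed
  qed
  then show ?thesis unfolding prec_L1_def ae by blast
qed

lemma Lam_iff:
  assumes T: "T > 0" and n: "n \<ge> 1" and w: "w = (2 * real n - 1) * pi / T"
  shows "a \<in> Lam T n \<longleftrightarrow> a \<in> L_per T \<and> (\<exists>N. negligible N \<and> (\<forall>t\<in>{0..T} - N. w\<^sup>2 \<le> a t)) \<and>
     0 < integral {0..T} (\<lambda>t. a t - w\<^sup>2) \<and> (\<exists>u v. antiper_solution T a u v \<and> nontrivial T u)"
proof -
  have "prec_L1 T (\<lambda>_. antiper_eigenvalue T (\<lambda>_. 0) (2 * n - 1)) a \<longleftrightarrow>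
    (\<exists>N. negligible N \<and> (\<forall>t\<in>{0..T} - N. w\<^sup>2 \<le> a t)) \<and> 0 < integral {0..T} (\<lambda>t. a t - w\<^sup>2)"
    if "a \<in> L_per T"
    unfolding antiper_eigenvalue_zero_potential[OF T n] w[symmetric]
    using that by (intro prec_L1_const_iff) (simp add: L_per_def)
  then show ?thesis by (auto simp: Lam_def)
qed

lemma L1_norm_excess:
  assumes a: "a absolutely_integrable_on {p..q}" and N: "negligible N" and le: "\<And>t. t \<in> {p..q} - N \<Longrightarrow> c \<le> a t"
  shows "L1_norm p q (\<lambda>t. a t - c) = integral {p..q} (\<lambda>t. a t - c)"
  by (rule L1_norm_eq_integral[OF _ N])
    (use le in \<open>auto intro!: absolutely_integrable_diff_const a\<close>)

text \<open>Every antiperiodic solution has a zero \<open>c\<close>. Translating the antiperiodic continuation by \<open>c\<close> gives a solution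
  that vanishes at the end points, for a translated coefficient with the same excess.\<close>
lemma Lam_excess_lower_bound:
  assumes T: "T > 0" and n: "n \<ge> 1" and w: "w = (2 * real n - 1) * pi / T" and a: "a \<in> Lam T n"
  shows "2 * (2 * real n + 1) * w * cot ((2 * real n - 1) * pi / (2 * (2 * real n + 1))) < integral {0..T} (\<lambda>t. a t - w\<^sup>2)"
proof -
  obtain N u v where per: "a \<in> L_per T" and N: "negligible N" "\<forall>t\<in>{0..T} - N. w\<^sup>2 \<le> a t"
    and ex: "0 < integral {0..T} (\<lambda>t. a t - w\<^sup>2)" and S: "antiper_solution T a u v" and nt: "nontrivial T u"
    using a Lam_iff[OF T n w] by auto
  have ai: "a absolutely_integrable_on {0..T}" and pa: "\<And>x. a (x + T) = a x" using per by (auto simp: L_per_def)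
  have sol: "solves 0 T a u v" and bc: "u T = - u 0" "v T = - v 0"
    using S antiper_solution_iff_solves[OF ai] by auto
  let ?U = "antiperiodic_ext T u" and ?V = "antiperiodic_ext T v"
  obtain c where c: "c \<in> {0..T}" "u c = 0"
    using IVT'[of u 0 0 T] IVT2'[of u T 0 0] solves_continuous(1)[OF sol] T bc(1)
    by (cases "u 0 \<le> 0") auto
  have Uc: "?U c = 0" using antiperiodic_ext_cell[OF T bc(1) c(1)] c(2) by simp
  have S2: "solves 0 (2 * T) a ?U ?V"
    using solves_antiperiodic_ext[OF T sol bc pa, of 2] by simp
  let ?u = "\<lambda>t. ?U (t + c)" and ?v = "\<lambda>t. ?V (t + c)" and ?a = "\<lambda>t. a (t + c)"
  have S3: "solves 0 T ?a ?u ?v"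
    unfolding solves_def
    using S2 primitive_on_subinterval[OF primitive_on_shift[of 0 "2 * T" ?U ?V c], of 0 T] c(1)
      primitive_on_subinterval[OF primitive_on_shift[of 0 "2 * T" ?V "\<lambda>t. - a t * ?U t" c], of 0 T]
    by (simp add: solves_def)
  have nt': "nontrivial T ?u"
  proof -
    obtain t where t: "t \<in> {0..T}" "u t \<noteq> 0" using nt by (auto simp: nontrivial_def)
    then have Ut: "?U t \<noteq> 0" using antiperiodic_ext_cell[OF T bc(1)] by simp
    show ?thesis
    proof (cases "c \<le> t")
      case True
      then show ?thesis using t Ut c unfolding nontrivial_def by (intro bexI[of _ "t - c"]) auto
    next
      case False
      then show ?thesis using t Ut c antiperiodic_ext_add[OF T, of u t] unfolding nontrivial_def
        by (intro bexI[of _ "t + T - c"]) auto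
    qed
  qed
  (* Beyond T - c the translated coefficient shows the values of a on the next period. *)
  define N' where "N' = {t. t + c \<in> N} \<union> {t. t + (c - T) \<in> N}"
  interpret resonant_solution T n ?a w N' ?u ?v
  proof
    show "T > 0" "n \<ge> 1" "w = (2 * real n - 1) * pi / T" by (fact T n w)+
    show "?a absolutely_integrable_on {0..T}" by (rule periodic_shift(1)[OF T ai pa c(1)])
    show "negligible N'" unfolding N'_def by (intro negligible_Un negligible_shift N(1))
    show "w\<^sup>2 \<le> ?a t" if "t \<in> {0..T} - N'" for t
    proof (cases "t + c \<le> T")
      case True
      then show ?thesis using N(2) that c by (auto simp: N'_def)
    next
      case False
      then have "w\<^sup>2 \<le> a (t + (c - T))" using N(2) that c by (auto simp: N'_def)
      then show ?thesis using pa[of "t + (c - T)"] by simp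
    qed
    have "integral {0..T} (\<lambda>t. ?a t - w\<^sup>2) = integral {0..T} (\<lambda>t. a t - w\<^sup>2)"
      by (rule periodic_shift(2)[OF T _ _ c(1), of "\<lambda>t. a t - w\<^sup>2"])
        (auto intro!: absolutely_integrable_diff_const ai simp: pa)
    then show "0 < integral {0..T} (\<lambda>t. ?a t - w\<^sup>2)" using ex by simp
    show "solves 0 T ?a ?u ?v" by (rule S3)
    show "?u 0 = 0" using Uc by simp
    show "?u T = 0" using antiperiodic_ext_add[OF T, of u c] Uc by (simp add: add.commute)
    show "?v 0 + ?v T = 0" using antiperiodic_ext_add[OF T, of v c] by (simp add: add.commute)
    show "nontrivial T ?u" by (rule nt')
  qed
  have "integral {0..T} (\<lambda>t. ?a t - w\<^sup>2) = integral {0..T} (\<lambda>t. a t - w\<^sup>2)"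
    by (rule periodic_shift(2)[OF T _ _ c(1), of "\<lambda>t. a t - w\<^sup>2"])
      (auto intro!: absolutely_integrable_diff_const ai simp: pa)
  then show ?thesis using excess_lower_bound by simp
qed

section \<open>Coefficients that realise the bounds\<close>

lemma tan_ge_self:
  fixes x :: real
  assumes "0 \<le> x" "x < pi / 2"
  shows "x \<le> tan x"
proof (cases "x = 0")
  case False
  have pos: "cos z > 0" if "0 \<le> z" "z \<le> x" for z
    using that assms by (intro cos_gt_zero_pi) auto
  obtain z where z: "0 < z" "z < x" "tan x - tan 0 = (x - 0) * inverse ((cos z)\<^sup>2)"
  proof -
    have "\<exists>z. 0 < z \<and> z < x \<and> tan x - tan 0 = (x - 0) * inverse ((cos z)\<^sup>2)"
    proof (rule MVT2)
      show "0 < x" using assms False by simp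
      show "(tan has_real_derivative inverse ((cos z)\<^sup>2)) (at z)" if "0 \<le> z" "z \<le> x" for z
        using pos[OF that] by (intro DERIV_tan) auto
    qed
    then show thesis using that by blast
  qed
  have "1 \<le> inverse ((cos z)\<^sup>2)"
    using pos[of z] z by (intro one_le_inverse) (auto simp: abs_square_le_1)
  then have "x * 1 \<le> x * inverse ((cos z)\<^sup>2)" using assms by (intro mult_left_mono) auto
  then show ?thesis using z(3) by simp
qed simp

text \<open>For the coefficient \<open>(m \<pi> / T)\<^sup>2\<close> and \<open>u t = sin (m \<pi> t / T)\<close> the angle turns by \<open>m \<pi>\<close>.\<close>
lemma constant_coefficient_example:
  assumes T: "T > 0" and n: "n \<ge> 1" and m: "odd m" "m \<ge> 2 * n + 1"
  shows "\<exists>a\<in>Lam T n. \<exists>u v x. antiper_solution T a u v \<and> nontrivial T u \<and> u 0 = 0 \<and> u T = 0 \<and> zero_enum T u v m x"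
proof -
  define w where "w = (2 * real n - 1) * pi / T"
  define k where "k = real m * pi / T"
  define u v where "u t = sin (k * t)" and "v t = k * cos (k * t)" for t
  have kT: "k * T = real m * pi" using T by (simp add: k_def)
  have k: "k > 0" using T m by (auto simp: k_def intro!: divide_pos_pos mult_pos_pos)
  obtain j where j: "m = 2 * j + 1" using m(1) by (rule oddE)
  have ai: "(\<lambda>_. k\<^sup>2) absolutely_integrable_on {0..T}" by (rule absolutely_integrable_continuous_real) simp
  have w0: "w > 0" using T n by (auto simp: w_def intro!: divide_pos_pos mult_pos_pos)
  have wk: "w < k" using T m(2) by (auto simp: w_def k_def intro!: divide_strict_right_mono mult_strict_right_mono)
  have w2: "w\<^sup>2 < k\<^sup>2" using wk w0 by (intro power_strict_mono) auto
  have S: "solves 0 T (\<lambda>_. k\<^sup>2) u v"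
    unfolding solves_def u_def v_def
    by (intro conjI primitive_on_classical)
      (auto intro!: derivative_eq_intros continuous_intros simp: field_simps power2_eq_square)
  have odd: "odd_pi (k * T)" unfolding odd_pi_def kT by (intro exI[of _ "int j"]) (simp add: j)
  have bc: "u 0 = 0" "u T = 0" "v 0 + v T = 0"
    using odd_pi_sin_cos[OF odd, of 0] by (simp_all add: u_def v_def)
  have nt: "nontrivial T u"
  proof -
    have "T / real m / 2 \<in> {0..T}" using T m(2) by (simp add: field_simps)
    moreover have "u (T / real m / 2) = 1" using T m(2) by (simp add: u_def k_def)
    ultimately show ?thesis unfolding nontrivial_def by (intro bexI[of _ "T / real m / 2"]) auto
  qed
  have ex: "0 < integral {0..T} (\<lambda>t. k\<^sup>2 - w\<^sup>2)" using w2 T by simp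
  interpret resonant_solution T n "\<lambda>_. k\<^sup>2" w "{}" u v
    using T n w_def ai w2 ex S bc nt by unfold_locales auto
  have "\<theta> T = real m * pi"
    using turn_constant_coefficient[OF k T, of j 0] kT j by (simp add: turn_def \<theta>_def)
  then obtain x where "zero_enum T u v m x" using zero_enum_from_angle by blast
  moreover have A: "antiper_solution T (\<lambda>_. k\<^sup>2) u v"
    unfolding antiper_solution_iff_solves[OF ai] using S bc by simp
  moreover have "(\<lambda>_. k\<^sup>2) \<in> Lam T n"
  proof -
    have "(\<lambda>_. k\<^sup>2) \<in> L_per T" using ai by (simp add: L_per_def)
    moreover have "\<exists>N. negligible N \<and> (\<forall>t\<in>{0..T} - N. w\<^sup>2 \<le> k\<^sup>2)" using w2 by (intro exI[of _ "{}"]) auto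
    ultimately show ?thesis using Lam_iff[OF T n w_def] ex A nt by blast
  qed
  ultimately show ?thesis using nt bc by blast
qed

text \<open>Consider the graph that is \<open>sin (w t)\<close> up to \<open>L - d\<close> and a multiple of \<open>cos (K (t - L))\<close> on \<open>[L - d, L]\<close>. Its pieces
  fit together to first order if \<open>K tan (K d) = w cot (w (L - d))\<close>. Multiplied by the denominators, this is \<open>h K = 0\<close>, and \<open>h\<close>
  has opposite signs at \<open>w\<close> and at \<open>\<pi>/(2d)\<close>. Then \<open>tan x \<ge> x\<close> bounds the mass \<open>K\<^sup>2 d\<close> of the bump.\<close>
lemma bump_frequency:
  fixes w L d :: real
  assumes w: "w > 0" and d: "0 < d" "d < L" and wL: "w * L < pi / 2"
  obtains K where "w < K" "K * d < pi / 2" "K * sin (K * d) * sin (w * (L - d)) = w * cos (w * (L - d)) * cos (K * d)"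
    "K * (K * d) \<le> w * cot (w * (L - d))"
proof -
  define h where "h K = K * sin (K * d) * sin (w * (L - d)) - w * cos (w * (L - d)) * cos (K * d)" for K
  define K1 where "K1 = pi / (2 * d)"
  have K1d: "K1 * d = pi / 2" using d by (simp add: K1_def)
  have wd: "w * d < w * L" using w d by simp
  then have wK1: "w < K1" using wL d by (simp add: K1_def field_simps)
  have r: "0 < w * (L - d)" "w * (L - d) < pi / 2" using w d wL wd by (auto simp: algebra_simps) (smt (verit) mult_pos_pos)
  have s: "sin (w * (L - d)) > 0" using r by (intro sin_gt_zero) auto
  have "h w = - w * (cos (w * (L - d)) * cos (w * d) - sin (w * (L - d)) * sin (w * d))"
    by (simp add: h_def algebra_simps)
  also have "\<dots> = - w * cos (w * (L - d) + w * d)" by (simp only: cos_add)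
  also have "w * (L - d) + w * d = w * L" by (simp add: algebra_simps)
  finally have "h w = - w * cos (w * L)" .
  moreover have "cos (w * L) > 0" using w d wL by (intro cos_gt_zero) auto
  ultimately have hw: "h w < 0" using w by simp
  have hK1: "h K1 > 0"
    using s wK1 w by (simp add: h_def K1d)
  have "continuous_on {w..K1} h" unfolding h_def by (intro continuous_intros)
  then obtain K where K: "w \<le> K" "K \<le> K1" "h K = 0"
    using IVT'[of h w 0 K1] hw hK1 wK1 by auto
  then have K': "w < K" "K < K1" using hw hK1 by (auto simp: less_le)
  then have "K * d < K1 * d" using d(1) by (intro mult_strict_right_mono) auto
  then have Kd: "0 < K * d" "K * d < pi / 2" using w d(1) K'(1) K1d by (auto intro!: mult_pos_pos)
  have c: "cos (K * d) > 0" using Kd by (intro cos_gt_zero) auto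
  have eq: "K * sin (K * d) * sin (w * (L - d)) = w * cos (w * (L - d)) * cos (K * d)"
    using K(3) by (simp add: h_def)
  have "K * (K * d) \<le> K * tan (K * d)" using tan_ge_self[of "K * d"] Kd K' w by (intro mult_left_mono) auto
  also have "\<dots> = w * cot (w * (L - d))"
    using eq c s by (simp add: tan_def cot_def field_simps)
  finally show thesis using that K'(1) Kd(2) eq by blast
qed

text \<open>The coefficient is \<open>K\<^sup>2\<close> on intervals of length \<open>2d\<close> around the extrema \<open>L, 3L, 5L, \<dots>\<close> of the solution and \<open>w\<^sup>2\<close>
  elsewhere. One cell \<open>[0, 2L]\<close> carries an antiperiodic solution, and \<open>2n+1\<close> cells, an odd number, make up
  \<open>[0, T]\<close>. For \<open>d \<rightarrow> 0\<close> the bound for the excess tends to the optimal constant.\<close>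
lemma concentrated_coefficient:
  assumes T: "T > 0" and n: "n \<ge> 1" and w_def: "w = (2 * real n - 1) * pi / T"
    and L_def: "L = T / (2 * (2 * real n + 1))" and d: "0 < d" "d < L"
  shows "\<exists>a\<in>Lam T n. integral {0..T} (\<lambda>t. a t - w\<^sup>2) \<le> 2 * (2 * real n + 1) * w * cot (w * (L - d))"
proof -
  have w: "w > 0" using T n by (auto simp: w_def intro!: divide_pos_pos mult_pos_pos)
  have L: "L > 0" using d by simp
  have "w * L = (2 * real n - 1) / (2 * (2 * real n + 1)) * pi" using T by (simp add: w_def L_def)
  also have "\<dots> < 1 / 2 * pi" by (intro mult_strict_right_mono) (auto simp: field_simps)
  finally have wL: "w * L < pi / 2" by simp
  obtain K where K: "w < K" "K * d < pi / 2" and match: "K * sin (K * d) * sin (w * (L - d)) = w * cos (w * (L - d)) * cos (K * d)"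
    and bound: "K * (K * d) \<le> w * cot (w * (L - d))"
    using bump_frequency[OF w d wL] by blast
  define S where "S = 2 * L"
  define m where "m = 2 * n + 1"
  have S: "S > 0" using L by (simp add: S_def)
  have mS: "real m * S = T" using n by (simp add: m_def S_def L_def field_simps)
  define C where "C = sin (w * (L - d)) / cos (K * d)"
  have c: "cos (K * d) > 0" using K d w by (intro cos_gt_zero) auto
  define b where "b s = (if s \<in> {L - d..L + d} then K\<^sup>2 - w\<^sup>2 else 0)" for s
  define a where "a t = w\<^sup>2 + b (t - S * of_int \<lfloor>t / S\<rfloor>)" for t
  define U where "U s = (if s \<le> L - d then sin (w * s) else if s \<le> L + d then C * cos (K * (s - L)) else sin (w * (S - s)))" for s
  define V where "V s = (if s \<le> L - d then w * cos (w * s) else if s \<le> L + d then - C * K * sin (K * (s - L)) else - w * cos (w * (S - s)))" for s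
  have K2: "w\<^sup>2 < K\<^sup>2" using K w by (intro power_strict_mono) auto
  have start: "a t = w\<^sup>2 + b t" if "0 \<le> t" "t < S" for t
  proof -
    have "\<lfloor>t / S\<rfloor> = 0" using that S by (simp add: floor_eq_iff)
    then show ?thesis by (simp add: a_def)
  qed
  have per: "a (t + S) = a t" for t
  proof -
    have "\<lfloor>(t + S) / S\<rfloor> = \<lfloor>t / S\<rfloor> + 1" using S by (simp add: add_divide_distrib)
    then show ?thesis by (simp add: a_def algebra_simps)
  qed
  have neg: "negligible {L - d, L + d, S}" by simp
  have Cm: "C * cos (K * d) = sin (w * (L - d))" using c by (simp add: C_def)
  have Cm': "C * K * sin (K * d) = w * cos (w * (L - d))" using c match by (simp add: C_def field_simps)
  have 1: "solves 0 (L - d) a U V"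
  proof (rule solves_cong[OF solves_sinusoid[of 0 "L - d" w 1 0] _ _ neg])
    fix t assume t: "t \<in> {0..L - d} - {L - d, L + d, S}"
    then show "w\<^sup>2 = a t" using start[of t] d S by (auto simp: b_def S_def)
  qed (use d in \<open>auto simp: U_def V_def\<close>)
  have 2: "solves (L - d) (L + d) a U V"
  proof (rule solves_cong[OF solves_cosinusoid[of "L - d" "L + d" K C L] _ _ neg])
    fix t assume t: "t \<in> {L - d..L + d} - {L - d, L + d, S}"
    then show "K\<^sup>2 = a t" using start[of t] d S by (auto simp: b_def S_def)
  next
    fix t assume t: "t \<in> {L - d..L + d}"
    show "C * cos (K * (t - L)) = U t" "- C * K * sin (K * (t - L)) = V t"
      using t Cm Cm' by (cases "t = L - d"; simp add: U_def V_def)+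
  qed
  have 3: "solves (L + d) S a U V"
  proof (rule solves_cong[OF solves_sinusoid[of "L + d" S w "-1" S] _ _ neg])
    fix t assume t: "t \<in> {L + d..S} - {L - d, L + d, S}"
    then show "w\<^sup>2 = a t" using start[of t] d S by (auto simp: b_def S_def)
  next
    fix t assume t: "t \<in> {L + d..S}"
    have e: "w * (t - S) = - (w * (S - t))" by (simp add: algebra_simps)
    have "S - (L + d) = L - d" by (simp add: S_def)
    then show "- 1 * sin (w * (t - S)) = U t" "- 1 * w * cos (w * (t - S)) = V t"
      using t Cm Cm' d unfolding e sin_minus cos_minus by (cases "t = L + d"; simp add: U_def V_def)+
  qed
  have cell: "solves 0 S a U V"
    using solves_combine[OF solves_combine[OF 1 2] 3] d by (simp add: S_def)
  have bcU: "U S = - U 0" "V S = - V 0" using d by (auto simp: U_def V_def S_def)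
  let ?u = "antiperiodic_ext S U" and ?v = "antiperiodic_ext S V"
  have sol: "solves 0 T a ?u ?v"
    using solves_antiperiodic_ext[OF S cell bcU per, of m] by (simp add: mS)
  have odd: "odd m" by (simp add: m_def)
  have bc: "?u 0 + ?u T = 0" "?v 0 + ?v T = 0"
    using antiperiodic_ext_add_mult[OF S, of U 0 m] antiperiodic_ext_add_mult[OF S, of V 0 m] odd
    by (simp_all add: mS)
  have "b absolutely_integrable_on {0..S} \<and> integral {0..S} b = 2 * d * (K\<^sup>2 - w\<^sup>2)"
  proof -
    have "((\<lambda>s. K\<^sup>2 - w\<^sup>2) has_integral (K\<^sup>2 - w\<^sup>2) * (L + d - (L - d))) {L - d..L + d}"
      using has_integral_const_real[of "K\<^sup>2 - w\<^sup>2" "L - d" "L + d"] d by (simp add: mult.commute)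
    then have I: "(b has_integral (K\<^sup>2 - w\<^sup>2) * (L + d - (L - d))) {0..S}"
      unfolding b_def using d by (subst has_integral_restrict) (auto simp: S_def)
    then have "b absolutely_integrable_on {0..S}"
      using K2 by (subst absolutely_integrable_on_iff_nonneg) (auto simp: b_def)
    then show ?thesis using integral_unique[OF I] by simp
  qed
  then have bi: "b absolutely_integrable_on {0..S}" and ib: "integral {0..S} b = 2 * d * (K\<^sup>2 - w\<^sup>2)" by auto
  have "(\<lambda>t. a t - w\<^sup>2) absolutely_integrable_on {0..S} \<and> integral {0..S} (\<lambda>t. a t - w\<^sup>2) = integral {0..S} b"
  proof
    show "(\<lambda>t. a t - w\<^sup>2) absolutely_integrable_on {0..S}"
      by (rule absolutely_integrable_spike[OF bi, of "{S}"]) (auto simp: start)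
    show "integral {0..S} (\<lambda>t. a t - w\<^sup>2) = integral {0..S} b"
      by (rule integral_spike[of "{S}"]) (auto simp: start)
  qed
  then have ai1: "(\<lambda>t. a t - w\<^sup>2) absolutely_integrable_on {0..S}" and ia: "integral {0..S} (\<lambda>t. a t - w\<^sup>2) = 2 * d * (K\<^sup>2 - w\<^sup>2)"
    using ib by auto
  have ai2: "(\<lambda>t. a t - w\<^sup>2) absolutely_integrable_on {0..T}"
    and I: "integral {0..T} (\<lambda>t. a t - w\<^sup>2) = real m * (2 * d * (K\<^sup>2 - w\<^sup>2))"
    using periodic_primitive[OF S ai1, of m] per ia by (simp_all add: mS)
  have ai: "a absolutely_integrable_on {0..T}"
    using absolutely_integrable_diff_const[OF ai2, of "- w\<^sup>2"] by simp
  have perT: "a (t + T) = a t" for t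
    using periodic_int_mult[of a S t "- int m"] per mS by (simp add: mult.commute)
  have ge: "w\<^sup>2 \<le> a t" for t using K2 by (simp add: a_def b_def)
  have ex: "0 < integral {0..T} (\<lambda>t. a t - w\<^sup>2)" unfolding I using K2 d by (simp add: m_def)
  have nt: "nontrivial T ?u"
  proof -
    have "?u (L - d) = sin (w * (L - d))"
      using antiperiodic_ext_start[OF S, of "L - d" U] d by (simp add: S_def U_def)
    moreover have "0 < sin (w * (L - d))"
    proof (rule sin_gt_zero)
      show "0 < w * (L - d)" using w d by simp
      have "w * (L - d) \<le> w * L" using w d by simp
      then show "w * (L - d) < pi" using wL pi_gt_zero by linarith
    qed
    moreover have "S \<le> T" using mS S mult_right_mono[of 1 "real m" S] by (simp add: m_def)
    ultimately show ?thesis unfolding nontrivial_def using d by (intro bexI[of _ "L - d"]) (auto simp: S_def)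
  qed
  have "antiper_solution T a ?u ?v" unfolding antiper_solution_iff_solves[OF ai] using sol bc by simp
  moreover have "a \<in> L_per T" using ai perT by (simp add: L_per_def)
  moreover have "\<exists>N. negligible N \<and> (\<forall>t\<in>{0..T} - N. w\<^sup>2 \<le> a t)" using ge by (intro exI[of _ "{}"]) auto
  ultimately have "a \<in> Lam T n" using Lam_iff[OF T n w_def] ex nt by blast
  moreover have "integral {0..T} (\<lambda>t. a t - w\<^sup>2) \<le> 2 * (2 * real n + 1) * w * cot (w * (L - d))"
  proof -
    have "d * (K\<^sup>2 - w\<^sup>2) \<le> K * (K * d)" using d by (simp add: algebra_simps power2_eq_square)
    also note bound
    finally have "2 * real m * (d * (K\<^sup>2 - w\<^sup>2)) \<le> 2 * real m * (w * cot (w * (L - d)))"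
      by (intro mult_left_mono) auto
    then show ?thesis unfolding I by (simp add: m_def algebra_simps)
  qed
  ultimately show ?thesis by blast
qed

section \<open>The optimal constant and the eigenvalue estimate\<close>

definition beta_value :: "real \<Rightarrow> nat \<Rightarrow> real" where
  "beta_value T n = 2 * pi * (2 * real n - 1) * (2 * real n + 1) / T
          * cot ((2 * real n - 1) * pi / (2 * (2 * real n + 1)))"

lemma beta_value_eq:
  assumes "w = (2 * real n - 1) * pi / T"
  shows "beta_value T n = 2 * (2 * real n + 1) * w * cot ((2 * real n - 1) * pi / (2 * (2 * real n + 1)))"
  unfolding beta_value_def assms by simp

lemma Lam_L1_norm:
  assumes T: "T > 0" and n: "n \<ge> 1" and w_def: "w = (2 * real n - 1) * pi / T" and a: "a \<in> Lam T n"
  shows "L1_norm 0 T (\<lambda>t. a t - w\<^sup>2) = integral {0..T} (\<lambda>t. a t - w\<^sup>2)"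
proof -
  have "a \<in> L_per T" "\<exists>N. negligible N \<and> (\<forall>t\<in>{0..T} - N. w\<^sup>2 \<le> a t)" using a Lam_iff[OF T n w_def] by auto
  then obtain N where "a absolutely_integrable_on {0..T}" "negligible N" "\<forall>t\<in>{0..T} - N. w\<^sup>2 \<le> a t"
    by (auto simp: L_per_def)
  then show ?thesis by (intro L1_norm_excess) auto
qed

lemma Lam_norm_greater:
  assumes T: "T > 0" and n: "n \<ge> 1" and a: "a \<in> Lam T n"
  shows "beta_value T n < L1_norm 0 T (\<lambda>t. a t - antiper_eigenvalue T (\<lambda>_. 0) (2 * n - 1))"
proof -
  define w where "w = (2 * real n - 1) * pi / T"
  show ?thesis
    using Lam_excess_lower_bound[OF T n w_def a]
    unfolding antiper_eigenvalue_zero_potential[OF T n] w_def[symmetric] Lam_L1_norm[OF T n w_def a]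
      beta_value_eq[OF w_def] .
qed

lemma beta1_eq:
  assumes T: "T > 0" and n: "n \<ge> 1"
  shows "beta1 T n = beta_value T n"
  unfolding beta1_def
proof (rule cInf_eq_non_empty)
  let ?l = "antiper_eigenvalue T (\<lambda>_. 0) (2 * n - 1)"
  show "(\<lambda>a. L1_norm 0 T (\<lambda>t. a t - ?l)) ` Lam T n \<noteq> {}"
    using constant_coefficient_example[OF T n, of "2 * n + 1"] by auto
  show "beta_value T n \<le> y" if "y \<in> (\<lambda>a. L1_norm 0 T (\<lambda>t. a t - ?l)) ` Lam T n" for y
    using that Lam_norm_greater[OF T n] by (auto simp: less_imp_le)
  show "y \<le> beta_value T n" if y: "\<And>x. x \<in> (\<lambda>a. L1_norm 0 T (\<lambda>t. a t - ?l)) ` Lam T n \<Longrightarrow> y \<le> x" for y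
  proof -
    define w where "w = (2 * real n - 1) * pi / T"
    define L where "L = T / (2 * (2 * real n + 1))"
    have L: "L > 0" using T by (simp add: L_def)
    have w: "w > 0" using T n by (auto simp: w_def intro!: divide_pos_pos mult_pos_pos)
    have wLeq: "w * L = (2 * real n - 1) * pi / (2 * (2 * real n + 1))" using T by (simp add: w_def L_def)
    have "w * L = (2 * real n - 1) / (2 * (2 * real n + 1)) * pi" by (simp add: wLeq)
    also have "\<dots> < 1 / 2 * pi" by (intro mult_strict_right_mono) (auto simp: field_simps)
    finally have "w * L < pi" using pi_gt_zero by linarith
    moreover have "0 < w * L" using w L by simp
    ultimately have wL: "0 < w * L" "w * L < pi" by auto
    have ub: "y \<le> 2 * (2 * real n + 1) * w * cot (w * (L - d))" if d: "0 < d" "d < L" for d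
    proof -
      obtain a where a: "a \<in> Lam T n" "integral {0..T} (\<lambda>t. a t - w\<^sup>2) \<le> 2 * (2 * real n + 1) * w * cot (w * (L - d))"
        using concentrated_coefficient[OF T n w_def L_def d] by blast
      have "y \<le> L1_norm 0 T (\<lambda>t. a t - w\<^sup>2)"
        using y a(1) unfolding antiper_eigenvalue_zero_potential[OF T n] w_def[symmetric] by blast
      then show ?thesis using Lam_L1_norm[OF T n w_def a(1)] a(2) by simp
    qed
    have "sin (w * L) \<noteq> 0" using sin_gt_zero[OF wL] by simp
    then have "isCont (\<lambda>d. 2 * (2 * real n + 1) * w * cot (w * (L - d))) 0"
      by (intro continuous_intros) auto
    then have "((\<lambda>d. 2 * (2 * real n + 1) * w * cot (w * (L - d))) \<longlongrightarrow> 2 * (2 * real n + 1) * w * cot (w * (L - 0))) (at_right 0)"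
      unfolding isCont_def by (rule filterlim_mono) (auto simp: at_le)
    moreover have "\<forall>\<^sub>F d in at_right 0. y \<le> 2 * (2 * real n + 1) * w * cot (w * (L - d))"
      unfolding eventually_at_right_field using L ub by (intro exI[of _ L]) auto
    ultimately have "y \<le> 2 * (2 * real n + 1) * w * cot (w * (L - 0))"
      by (intro tendsto_lowerbound[OF _ _ trivial_limit_at_right_real])
    then show ?thesis unfolding beta_value_eq[OF w_def] wLeq[symmetric] by simp
  qed
qed

text \<open>For the constant \<open>w\<^sup>2\<close> both extremal turns are \<open>(2n-1) \<pi>\<close>, and \<open>a\<close> lies above it; this is the first part. For
  the second one, follow the segment from \<open>w\<^sup>2\<close> to \<open>a\<close>. If the maximal turn reached \<open>(2n+1) \<pi>\<close> at \<open>a\<close>, it would equal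
  \<open>(2n+1) \<pi>\<close> at some point of the segment, which would then have an antiperiodic solution although its excess is at
  most the constant that is never attained.\<close>
lemma small_norm_extremal_turns:
  assumes T: "T > 0" and n: "n \<ge> 1" and w_def: "w = (2 * real n - 1) * pi / T"
    and a: "a \<in> L_per T" and N: "negligible N" and above: "\<And>t. t \<in> {0..T} - N \<Longrightarrow> w\<^sup>2 \<le> a t"
    and ex: "0 < integral {0..T} (\<lambda>t. a t - w\<^sup>2)" and small: "integral {0..T} (\<lambda>t. a t - w\<^sup>2) \<le> beta_value T n"
  shows "(2 * real n - 1) * pi < min_turn T a" "max_turn T a < (2 * real n + 1) * pi"
proof -
  have ai: "a absolutely_integrable_on {0..T}" using a by (simp add: L_per_def)
  have w: "w > 0" using T n by (auto simp: w_def intro!: divide_pos_pos mult_pos_pos)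
  define k where "k = n - 1"
  have k: "2 * real k + 1 = 2 * real n - 1" using n by (simp add: k_def)
  have wT: "w * T = (2 * real k + 1) * pi" using T by (simp add: w_def k)
  note const = extremal_turn_constant_coefficient[OF w T wT, unfolded k]
  have ca: "coefficient T a" using T ai by unfold_locales
  have cw: "coefficient T (\<lambda>_. w\<^sup>2)" by (rule coefficient_const[OF T])
  have nn: "\<not> negligible {t \<in> {0..T}. w\<^sup>2 \<noteq> a t}"
  proof
    assume "negligible {t \<in> {0..T}. w\<^sup>2 \<noteq> a t}"
    then have "integral {0..T} (\<lambda>t. a t - w\<^sup>2) = integral {0..T} (\<lambda>_. 0)"
      by (rule integral_spike) auto
    then show False using ex by simp
  qed
  show "(2 * real n - 1) * pi < min_turn T a"
    using extremal_turn_mono(4)[OF cw ca N above nn] const by simp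
  show "max_turn T a < (2 * real n + 1) * pi"
  proof (rule ccontr)
    assume far: "\<not> ?thesis"
    define q where "q s x = w\<^sup>2 + s * (a x - w\<^sup>2)" for s x
    have cd: "coefficient T (\<lambda>t. a t - w\<^sup>2)" using T absolutely_integrable_diff_const[OF ai] by unfold_locales
    have q0: "max_turn T (q 0) = (2 * real n - 1) * pi" and q1: "q 1 = a" using const by (simp_all add: q_def[abs_def])
    moreover have "continuous_on {0..1} (\<lambda>s. max_turn T (q s))"
      unfolding q_def[abs_def] by (rule extremal_turn_continuous(1)[OF cw cd])
    moreover have "(2 * real n - 1) * pi \<le> (2 * real n + 1) * pi" by (intro mult_right_mono) auto
    ultimately obtain s where s: "0 \<le> s" "s \<le> 1" "max_turn T (q s) = (2 * real n + 1) * pi"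
      using IVT'[of "\<lambda>s. max_turn T (q s)" 0 "(2 * real n + 1) * pi" 1] far by auto
    have "s \<noteq> 0"
    proof
      assume "s = 0"
      then have "(2 * real n + 1) * pi = (2 * real n - 1) * pi" using s(3) q0 by simp
      then show False using pi_gt_zero by (simp add: algebra_simps)
    qed
    then have s0: "s > 0" using s by simp
    have qex: "integral {0..T} (\<lambda>t. q s t - w\<^sup>2) = s * integral {0..T} (\<lambda>t. a t - w\<^sup>2)" by (simp add: q_def)
    have cq: "coefficient T (q s)" using coefficient_add_mult[OF cw cd, of s] by (simp add: q_def[abs_def])
    have "odd_pi (max_turn T (q s))" unfolding s(3) odd_pi_def by (intro exI[of _ "int n"]) simp
    then have "\<exists>u v. antiper_solution T (q s) u v \<and> nontrivial T u"
      using coefficient.antiper_eigenvalue_iff_extremal[OF cq] by blast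
    moreover have "q s \<in> L_per T"
      using cq a by (auto simp: L_per_def coefficient_def q_def)
    moreover have "\<exists>N. negligible N \<and> (\<forall>t\<in>{0..T} - N. w\<^sup>2 \<le> q s t)"
      using N above s0 by (intro exI[of _ N]) (auto simp: q_def)
    ultimately have L: "q s \<in> Lam T n"
      using Lam_iff[OF T n w_def] qex ex s0 by simp
    have "beta_value T n < s * integral {0..T} (\<lambda>t. a t - w\<^sup>2)"
      using Lam_norm_greater[OF T n L]
      unfolding antiper_eigenvalue_zero_potential[OF T n] w_def[symmetric] Lam_L1_norm[OF T n w_def L] qex .
    also have "\<dots> \<le> 1 * integral {0..T} (\<lambda>t. a t - w\<^sup>2)" using s ex by (intro mult_right_mono) auto
    finally show False using small by simp
  qed
qed

lemma small_norm_eigenvalues: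
  assumes T: "T > 0" and n: "n \<ge> 1" and a: "a \<in> L_per T"
    and prec: "prec_L1 T (\<lambda>_. antiper_eigenvalue T (\<lambda>_. 0) (2 * n - 1)) a"
    and small: "L1_norm 0 T a \<le> gamma1 T n"
  shows "antiper_eigenvalue T a (2 * n) < 0" "0 < antiper_eigenvalue T a (2 * n + 1)"
proof -
  define w where "w = (2 * real n - 1) * pi / T"
  have ai: "a absolutely_integrable_on {0..T}" using a by (simp add: L_per_def)
  have ev: "antiper_eigenvalue T (\<lambda>_. 0) (2 * n - 1) = w\<^sup>2"
    unfolding antiper_eigenvalue_zero_potential[OF T n] w_def ..
  obtain N where N: "negligible N" "\<And>t. t \<in> {0..T} - N \<Longrightarrow> w\<^sup>2 \<le> a t" and ex: "0 < integral {0..T} (\<lambda>t. a t - w\<^sup>2)"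
    using prec unfolding ev prec_L1_const_iff[OF ai] by blast
  have "L1_norm 0 T a = integral {0..T} a"
  proof (rule L1_norm_eq_integral[OF ai N(1)])
    show "0 \<le> a t" if "t \<in> {0..T} - N" for t using N(2)[OF that] zero_le_power2[of w] by linarith
  qed
  moreover have "integral {0..T} (\<lambda>t. a t - w\<^sup>2) = integral {0..T} a - T * w\<^sup>2"
    using ai T by (subst integral_diff) (auto simp: set_lebesgue_integral_eq_integral(1))
  ultimately have "integral {0..T} (\<lambda>t. a t - w\<^sup>2) \<le> beta_value T n"
    using small unfolding gamma1_def ev beta1_eq[OF T n] by simp
  note turns = small_norm_extremal_turns[OF T n w_def a N ex this]
  interpret bounded_below_coefficient T a "w\<^sup>2" N
    using T ai N by unfold_locales auto
  define k where "k = n - 1"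
  have k: "n = k + 1" using n by (simp add: k_def)
  show "antiper_eigenvalue T a (2 * n) < 0"
    using antiper_eigenvalue_neg_iff[of k] turns(1) by (simp add: k add.commute)
  show "0 < antiper_eigenvalue T a (2 * n + 1)"
    using antiper_eigenvalue_pos_iff[of n] turns(2) by simp
qed

lemma Lam_zero_structure:
  assumes T: "T > 0" and n: "n \<ge> 1" and a: "a \<in> Lam T n"
    and S: "antiper_solution T a u v" and nt: "nontrivial T u" and u0: "u 0 = 0" "u T = 0"
  shows "\<exists>m x. zero_enum T u v m x"
    "\<And>m x. zero_enum T u v m x \<Longrightarrow>
           (\<forall>i<2 * m. x (i + 1) - x i \<le> T / (2 * (2 * real n - 1))) \<and>
           (\<exists>i<2 * m. x (i + 1) - x i < T / (2 * (2 * real n - 1))) \<and>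
           odd m \<and> m \<ge> 2 * n + 1 \<and>
           (\<forall>i<2 * m.
              L1_norm (x i) (x (i + 1)) (\<lambda>t. a t - antiper_eigenvalue T (\<lambda>_. 0) (2 * n - 1))
                \<ge> (2 * real n - 1) * pi / T * cot ((2 * real n - 1) * pi / T * (x (i + 1) - x i)))"
proof -
  define w where "w = (2 * real n - 1) * pi / T"
  obtain N where per: "a \<in> L_per T" and Nw: "negligible N" "\<forall>t\<in>{0..T} - N. w\<^sup>2 \<le> a t"
    and ex: "0 < integral {0..T} (\<lambda>t. a t - w\<^sup>2)"
    using a Lam_iff[OF T n w_def] by auto
  have ai: "a absolutely_integrable_on {0..T}" using per by (simp add: L_per_def)
  have sol: "solves 0 T a u v" "v 0 + v T = 0" using S antiper_solution_iff_solves[OF ai] by auto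
  interpret resonant_solution T n a w N u v
    using T n w_def ai Nw ex sol u0 nt by unfold_locales auto
  show "\<exists>m x. zero_enum T u v m x" by (rule zero_enum_exists)
  fix m x assume e: "zero_enum T u v m x"
  have n': "2 * real n - 1 > 0" using n by linarith
  have le: "d \<le> T / (2 * (2 * real n - 1)) \<longleftrightarrow> w * d \<le> pi / 2" and lt: "d < T / (2 * (2 * real n - 1)) \<longleftrightarrow> w * d < pi / 2" for d
  proof -
    have "y * pi / T * (T / (2 * y)) = pi / 2" if "y > 0" for y using T that by simp
    from this[OF n'] have "w * (T / (2 * (2 * real n - 1))) = pi / 2" by (simp only: w_def)
    then show "d \<le> T / (2 * (2 * real n - 1)) \<longleftrightarrow> w * d \<le> pi / 2" "d < T / (2 * (2 * real n - 1)) \<longleftrightarrow> w * d < pi / 2"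
      using w_pos mult_le_cancel_left_pos[of w d] mult_less_cancel_left_pos[of w d] by metis+
  qed
  have norm: "L1_norm (x i) (x (i + 1)) (\<lambda>t. a t - w\<^sup>2) = integral {x i..x (i + 1)} (\<lambda>t. a t - w\<^sup>2)" if "i < 2 * m" for i
  proof (rule L1_norm_excess[OF _ Nw(1)])
    show "a absolutely_integrable_on {x i..x (i + 1)}"
      using absolutely_integrable_on_subinterval[OF ai] zero_enum_quarter(5-7)[OF e that] by auto
    show "w\<^sup>2 \<le> a t" if t: "t \<in> {x i..x (i + 1)} - N" for t
      using Nw(2) t zero_enum_quarter(5-7)[OF e \<open>i < 2 * m\<close>] by auto
  qed
  show "(\<forall>i<2 * m. x (i + 1) - x i \<le> T / (2 * (2 * real n - 1))) \<and>
           (\<exists>i<2 * m. x (i + 1) - x i < T / (2 * (2 * real n - 1))) \<and>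
           odd m \<and> m \<ge> 2 * n + 1 \<and>
           (\<forall>i<2 * m.
              L1_norm (x i) (x (i + 1)) (\<lambda>t. a t - antiper_eigenvalue T (\<lambda>_. 0) (2 * n - 1))
                \<ge> (2 * real n - 1) * pi / T * cot ((2 * real n - 1) * pi / T * (x (i + 1) - x i)))"
    unfolding le lt antiper_eigenvalue_zero_potential[OF T n] w_def[symmetric]
    using zero_enum_quarter(1,2)[OF e] zero_enum_strict[OF e] zero_enum_count[OF e] norm by simp
qed

theorem theorem3p1:
  fixes T :: real and n :: nat
  assumes T: "T > 0" and n: "n \<ge> 1"
  shows
    "(\<forall>a\<in>Lam T n. \<forall>u v. antiper_solution T a u v \<and> nontrivial T u \<and> u 0 = 0 \<and> u T = 0 \<longrightarrow>
        (\<exists>m x. zero_enum T u v m x) \<and>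
        (\<forall>m x. zero_enum T u v m x \<longrightarrow>
           (\<forall>i<2 * m. x (i + 1) - x i \<le> T / (2 * (2 * real n - 1))) \<and>
           (\<exists>i<2 * m. x (i + 1) - x i < T / (2 * (2 * real n - 1))) \<and>
           odd m \<and> m \<ge> 2 * n + 1 \<and>
           (\<forall>i<2 * m.
              L1_norm (x i) (x (i + 1)) (\<lambda>t. a t - antiper_eigenvalue T (\<lambda>_. 0) (2 * n - 1))
                \<ge> (2 * real n - 1) * pi / T * cot ((2 * real n - 1) * pi / T * (x (i + 1) - x i)))))
     \<and> (\<forall>m. odd m \<and> m \<ge> 2 * n + 1 \<longrightarrow>
          (\<exists>a\<in>Lam T n. \<exists>u v x. antiper_solution T a u v \<and> nontrivial T u \<and> u 0 = 0 \<and> u T = 0 \<and>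
             zero_enum T u v m x))
     \<and> beta1 T n = 2 * pi * (2 * real n - 1) * (2 * real n + 1) / T
          * cot ((2 * real n - 1) * pi / (2 * (2 * real n + 1)))
     \<and> \<not> (\<exists>a\<in>Lam T n.
            L1_norm 0 T (\<lambda>t. a t - antiper_eigenvalue T (\<lambda>_. 0) (2 * n - 1)) = beta1 T n)
     \<and> (\<forall>a\<in>L_per T. prec_L1 T (\<lambda>_. antiper_eigenvalue T (\<lambda>_. 0) (2 * n - 1)) a \<and>
            L1_norm 0 T a \<le> gamma1 T n \<longrightarrow>
          antiper_eigenvalue T a (2 * n) < 0 \<and> 0 < antiper_eigenvalue T a (2 * n + 1))"
proof (intro conjI ballI allI impI)
  show "\<exists>m x. zero_enum T u v m x"
    if "a \<in> Lam T n" "antiper_solution T a u v \<and> nontrivial T u \<and> u 0 = 0 \<and> u T = 0" for a u v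
    using Lam_zero_structure(1)[OF T n that(1)] that(2) by blast
next
  fix m assume "odd m \<and> m \<ge> 2 * n + 1"
  then show "\<exists>a\<in>Lam T n. \<exists>u v x. antiper_solution T a u v \<and> nontrivial T u \<and> u 0 = 0 \<and> u T = 0 \<and>
             zero_enum T u v m x"
    using constant_coefficient_example[OF T n] by blast
next
  show "beta1 T n = 2 * pi * (2 * real n - 1) * (2 * real n + 1) / T
          * cot ((2 * real n - 1) * pi / (2 * (2 * real n + 1)))"
    using beta1_eq[OF T n] by (simp only: beta_value_def)
next
  show "\<not> (\<exists>a\<in>Lam T n. L1_norm 0 T (\<lambda>t. a t - antiper_eigenvalue T (\<lambda>_. 0) (2 * n - 1)) = beta1 T n)"
    using Lam_norm_greater[OF T n] beta1_eq[OF T n] by fastforce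
next
  fix a assume "a \<in> L_per T"
    and "prec_L1 T (\<lambda>_. antiper_eigenvalue T (\<lambda>_. 0) (2 * n - 1)) a \<and> L1_norm 0 T a \<le> gamma1 T n"
  then show "antiper_eigenvalue T a (2 * n) < 0" "0 < antiper_eigenvalue T a (2 * n + 1)"
    using small_norm_eigenvalues[OF T n] by blast+
qed (use Lam_zero_structure(2)[OF T n] in blast)+

end
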